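(* Let $(X,T)$ be a minimal topological dynamical system ($X$ compact metric, $T$ a discrete abelian group) and let $d\ge 1$ be an integer. Then $\mathcal{HK}^{[d+1]}(G)$ has the property of unique $\tau$-closure on $X$ if and only if $(X,T)$ is a proximal extension of its maximal factor of order $d$, that is, if and only if the quotient map $X\to X/\mathbf{RP}^{[d]}(X)$ is a proximal extension.
   Context: Systems. A topological dynamical system $(X,T)$ is a compact metric space $X$ with a discrete abelian group $T$ acting by homeomorphisms; it is minimal if all orbits are dense. A pair $(x,y)$ is proximal if there are a net $(t_\lambda)$ in $T$ and $z\in X$ with $t_\lambda x\to z$, $t_\lambda y\to z$. An extension $\pi:(X,T)\to(Y,T)$ is a continuous equivariant surjection ($Y$ is then a factor of $X$); it is proximal if any two points in the same fibre of $\pi$ are proximal. Cubes. For an integer $n\ge1$, $X^{[n]}=X^{2^n}$ has coordinates indexed by $\{0,1\}^n$ (equivalently by subsets $\epsilon\subseteq[n]=\{1,\dots,n\}$, with $\emptyset\leftrightarrow(0,\dots,0)$); $x^{[n]}$ is the point with all coordinates $x$. A facet of $\{0,1\}^n$ is a subset obtained by fixing the value of one coordinate; it is an upper facet if it contains $(1,\dots,1)$. For a group $L$ with identity $e$, $g\in L$ and $\alpha\subseteq\{0,1\}^n$, $g^{(\alpha)}\in L^{[n]}$ has coordinate $g$ at $\epsilon\in\alpha$ and $e$ otherwise. $\mathcal{HK}^{[n]}(L)$ (resp. $\mathcal F^{[n]}(L)$) is the subgroup of $L^{[n]}$ generated by all $g^{(\alpha)}$, $g\in L$, $\alpha$ a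 facet (resp. an upper facet). $\mathcal{HK}^{[n]}(T)$ acts on $X^{[n]}$ coordinatewise, and $\boldsymbol Q^{[n]}(X)=\overline{\{\mathbf t x^{[n]}:\mathbf t\in\mathcal{HK}^{[n]}(T),x\in X\}}$ (same definition for compact Hausdorff systems). Regional proximality. $(x,y)\in\mathbf{RP}^{[d]}(X)$ if there are nets $(\mathbf f_\lambda)$ in $\mathcal F^{[d]}(T)$, $(x_\lambda),(y_\lambda)$ in $X$, and $\mathbf a_*\in X^{2^d-1}$ with $(\mathbf f_\lambda x_\lambda^{[d]},\mathbf f_\lambda y_\lambda^{[d]})\to(x,\mathbf a_*,y,\mathbf a_* )$ (first coordinate of each block is the $\emptyset$-coordinate). A system is of order $d$ if $\mathbf{RP}^{[d]}$ is the diagonal. For minimal systems $\mathbf{RP}^{[d]}(X)$ is a closed invariant equivalence relation and $X/\mathbf{RP}^{[d]}(X)$ is the maximal factor of order $d$. The group $G$. $\beta T$ is the Stone–Čech compactification of $T$ with its semigroup structure ($p\mapsto pq$ continuous for all $q$, $p\mapsto tp$ continuous for $t\in T$); it acts on every system by $px=\lim t_\lambda x$ when $T\ni t_\lambda\to p$. Fix a minimal left ideal $M$ of $\beta T$ (the universal minimal system) and an idempotent $u\in M$. $G=uM$ is a group with identity $u$; in $\mathcal{HK}^{[n]}(G)$ the identity used is $u$. $\tau$-closure. The inclusion of $\mathcal{HK}^{[n]}(T)$ in $T^{[n]}$ extends to a continuous semigroup homomorphism $\beta\mathcal{HK}^{[n]}(T)\to(\beta T)^{[n]}$, so $\beta\mathcal{HK}^{[n]}(T)$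 acts coordinatewise. There is a minimal idempotent $\hat u\in\beta\mathcal{HK}^{[n]}(T)$ mapped to $u^{[n]}$; fix one. Identifying elements of $G(\mathcal{HK}^{[n]}(T))=\hat u\,\beta\mathcal{HK}^{[n]}(T)\,\hat u$ with their images in $(\beta T)^{[n]}$, this group becomes $u^{[n]}\boldsymbol Q^{[n]}(M)$, which contains $\mathcal{HK}^{[n]}(G)$ and acts coordinatewise on $X^{[n]}$. For $A\subseteq u^{[n]}\boldsymbol Q^{[n]}(M)$ put $\hat u\circ A=\{\lim \mathbf t_\lambda \mathbf a_\lambda:\mathbf t_\lambda\in\mathcal{HK}^{[n]}(T),\ \mathbf t_\lambda\to\hat u,\ \mathbf a_\lambda\in A\}$ and $\mathrm{cl}_\tau(A)=u^{[n]}(\hat u\circ A)$ (the closure for the $\tau$-topology). Property. $\mathcal{HK}^{[n]}(G)$ has the property of unique $\tau$-closure on $X$ if for every $\mathbf x\in\boldsymbol Q^{[n]}(X)$, any two elements of $\mathrm{cl}_\tau(\mathcal{HK}^{[n]}(G))\mathbf x$ having $2^n-1$ coordinates in common are equal. *)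

theory Defs
  imports
    "HOL-Analysis.Analysis"
    "HOL-Algebra.Group_Action"
    "HOL-Algebra.Elementary_Groups"
    "HOL-Algebra.Product_Groups"
begin

text \<open>
  Conventions. A net in a set \<open>S\<close> is rendered by its filter of tails: a proper filter \<open>F\<close>
  with \<open>F \<le> principal S\<close>. A tuple of nets over one index set is a proper filter on the
  corresponding product set, and convergence is convergence of the projections
  along this filter. Every such filter is the filter of tails of some net, so the sets of limits
  obtained are the same, and no quantification over index types is needed.
\<close>

section \<open>Topological dynamical systems\<close>

locale dynamical_system = comm_group T + group_action T "topspace X" \<phi>
  for T :: "('t, 'm) monoid_scheme" (structure) and X :: "'x topology"
    and \<phi> :: "'t \<Rightarrow> 'x \<Rightarrow> 'x" +
  assumes compact: "compact_space X"
    and metrizable: "metrizable_space X"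
    and homeomorphism: "t \<in> carrier T \<Longrightarrow> homeomorphic_map X X (\<phi> t)"

definition minimal_action ::
    "('t, 'm) monoid_scheme \<Rightarrow> 'x topology \<Rightarrow> ('t \<Rightarrow> 'x \<Rightarrow> 'x) \<Rightarrow> bool" where
  "minimal_action T X \<phi> \<longleftrightarrow> (\<forall>x \<in> topspace X. X closure_of (orbit T \<phi> x) = topspace X)"

definition proximal ::
    "('t, 'm) monoid_scheme \<Rightarrow> 'x topology \<Rightarrow> ('t \<Rightarrow> 'x \<Rightarrow> 'x) \<Rightarrow> 'x \<Rightarrow> 'x \<Rightarrow> bool" where
  "proximal T X \<phi> x y \<longleftrightarrow> x \<in> topspace X \<and> y \<in> topspace X \<and>
     (\<exists>F z. F \<noteq> bot \<and> F \<le> principal (carrier T) \<and>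
        limitin X (\<lambda>t. \<phi> t x) z F \<and> limitin X (\<lambda>t. \<phi> t y) z F)"

definition extension ::
    "('t, 'm) monoid_scheme \<Rightarrow> 'x topology \<Rightarrow> ('t \<Rightarrow> 'x \<Rightarrow> 'x) \<Rightarrow>
     'y topology \<Rightarrow> ('t \<Rightarrow> 'y \<Rightarrow> 'y) \<Rightarrow> ('x \<Rightarrow> 'y) \<Rightarrow> bool" where
  "extension T X \<phi> Y \<psi> \<pi> \<longleftrightarrow>
     dynamical_system T X \<phi> \<and> dynamical_system T Y \<psi> \<and>
     continuous_map X Y \<pi> \<and> \<pi> ` topspace X = topspace Y \<and>
     (\<forall>t \<in> carrier T. \<forall>x \<in> topspace X. \<pi> (\<phi> t x) = \<psi> t (\<pi> x))"

definition proximal_extension ::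
    "('t, 'm) monoid_scheme \<Rightarrow> 'x topology \<Rightarrow> ('t \<Rightarrow> 'x \<Rightarrow> 'x) \<Rightarrow>
     'y topology \<Rightarrow> ('t \<Rightarrow> 'y \<Rightarrow> 'y) \<Rightarrow> ('x \<Rightarrow> 'y) \<Rightarrow> bool" where
  "proximal_extension T X \<phi> Y \<psi> \<pi> \<longleftrightarrow>
     extension T X \<phi> Y \<psi> \<pi> \<and>
     (\<forall>x \<in> topspace X. \<forall>y \<in> topspace X. \<pi> x = \<pi> y \<longrightarrow> proximal T X \<phi> x y)"

section \<open>Cubes\<close>

text \<open>Vertices of \<open>{0,1}\<^sup>n\<close> are subsets of \<open>{1..n}\<close>.\<close>

definition cube :: "nat \<Rightarrow> nat set set" where
  "cube n = Pow {1..n}"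

definition facet :: "nat \<Rightarrow> nat set set \<Rightarrow> bool" where
  "facet n \<alpha> \<longleftrightarrow> (\<exists>i \<in> {1..n}. \<alpha> = {\<epsilon> \<in> cube n. i \<in> \<epsilon>} \<or> \<alpha> = {\<epsilon> \<in> cube n. i \<notin> \<epsilon>})"

definition upper_facet :: "nat \<Rightarrow> nat set set \<Rightarrow> bool" where
  "upper_facet n \<alpha> \<longleftrightarrow> facet n \<alpha> \<and> {1..n} \<in> \<alpha>"

abbreviation cube_top :: "nat \<Rightarrow> 'x topology \<Rightarrow> (nat set \<Rightarrow> 'x) topology" where
  "cube_top n X \<equiv> product_topology (\<lambda>_. X) (cube n)"

abbreviation cube_group :: "nat \<Rightarrow> ('g, 'm) monoid_scheme \<Rightarrow> (nat set \<Rightarrow> 'g) monoid" where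
  "cube_group n L \<equiv> product_group (cube n) (\<lambda>_. L)"

definition cube_diag :: "nat \<Rightarrow> 'x \<Rightarrow> nat set \<Rightarrow> 'x" where
  "cube_diag n x = (\<lambda>\<epsilon> \<in> cube n. x)"

definition face_element ::
    "nat \<Rightarrow> ('g, 'm) monoid_scheme \<Rightarrow> 'g \<Rightarrow> nat set set \<Rightarrow> nat set \<Rightarrow> 'g" where
  "face_element n L g \<alpha> = (\<lambda>\<epsilon> \<in> cube n. if \<epsilon> \<in> \<alpha> then g else \<one>\<^bsub>L\<^esub>)"

definition HK :: "nat \<Rightarrow> ('g, 'm) monoid_scheme \<Rightarrow> (nat set \<Rightarrow> 'g) monoid" where
  "HK n L = subgroup_generated (cube_group n L)
     {face_element n L g \<alpha> | g \<alpha>. g \<in> carrier L \<and> facet n \<alpha>}"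

definition Face :: "nat \<Rightarrow> ('g, 'm) monoid_scheme \<Rightarrow> (nat set \<Rightarrow> 'g) monoid" where
  "Face n L = subgroup_generated (cube_group n L)
     {face_element n L g \<alpha> | g \<alpha>. g \<in> carrier L \<and> upper_facet n \<alpha>}"

definition cube_act ::
    "nat \<Rightarrow> ('g \<Rightarrow> 'x \<Rightarrow> 'x) \<Rightarrow> (nat set \<Rightarrow> 'g) \<Rightarrow> (nat set \<Rightarrow> 'x) \<Rightarrow> nat set \<Rightarrow> 'x" where
  "cube_act n \<phi> t x = (\<lambda>\<epsilon> \<in> cube n. \<phi> (t \<epsilon>) (x \<epsilon>))"

definition Q_cube ::
    "nat \<Rightarrow> ('t, 'm) monoid_scheme \<Rightarrow> 'x topology \<Rightarrow> ('t \<Rightarrow> 'x \<Rightarrow> 'x) \<Rightarrow> (nat set \<Rightarrow> 'x) set" where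
  "Q_cube n T X \<phi> = cube_top n X closure_of
     {cube_act n \<phi> t (cube_diag n x) | t x. t \<in> carrier (HK n T) \<and> x \<in> topspace X}"

section \<open>Regional proximality and the maximal factor of order \<open>d\<close>\<close>

text \<open>The point \<open>(x, a)\<close> of \<open>X\<^sup>[\<^sup>d\<^sup>]\<close> is \<open>w({} := x)\<close>, where \<open>w\<close> agrees with \<open>a\<close> off \<open>{}\<close>.\<close>

definition RP ::
    "nat \<Rightarrow> ('t, 'm) monoid_scheme \<Rightarrow> 'x topology \<Rightarrow> ('t \<Rightarrow> 'x \<Rightarrow> 'x) \<Rightarrow> ('x \<times> 'x) set" where
  "RP d T X \<phi> = {(x, y). x \<in> topspace X \<and> y \<in> topspace X \<and>
     (\<exists>(F :: ((nat set \<Rightarrow> 't) \<times> 'x \<times> 'x) filter) w. F \<noteq> bot \<and>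
        F \<le> principal (carrier (Face d T) \<times> topspace X \<times> topspace X) \<and>
        limitin (cube_top d X) (\<lambda>(f, a, b). cube_act d \<phi> f (cube_diag d a)) (w({} := x)) F \<and>
        limitin (cube_top d X) (\<lambda>(f, a, b). cube_act d \<phi> f (cube_diag d b)) (w({} := y)) F)}"

definition quotient_proj :: "'x topology \<Rightarrow> ('x \<times> 'x) set \<Rightarrow> 'x \<Rightarrow> 'x set" where
  "quotient_proj X R = (\<lambda>x \<in> topspace X. R `` {x})"

definition quotient_top :: "'x topology \<Rightarrow> ('x \<times> 'x) set \<Rightarrow> 'x set topology" where
  "quotient_top X R = topology (\<lambda>U. U \<subseteq> topspace X // R \<and>
     openin X {x \<in> topspace X. quotient_proj X R x \<in> U})"

definition quotient_act ::
    "'x topology \<Rightarrow> ('x \<times> 'x) set \<Rightarrow> ('t \<Rightarrow> 'x \<Rightarrow> 'x) \<Rightarrow> 't \<Rightarrow> 'x set \<Rightarrow> 'x set" where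
  "quotient_act X R \<phi> t = (\<lambda>C \<in> topspace X // R. \<phi> t ` C)"

lemma openin_quotient_top:
  "openin (quotient_top X R) U \<longleftrightarrow>
     U \<subseteq> topspace X // R \<and> openin X {x \<in> topspace X. quotient_proj X R x \<in> U}"
proof -
  let ?pre = "\<lambda>U. {x \<in> topspace X. quotient_proj X R x \<in> U}"
  have int: "?pre (S \<inter> S') = ?pre S \<inter> ?pre S'" for S S' by auto
  have un: "?pre (\<Union>K) = (\<Union>S\<in>K. ?pre S)" for K by auto
  have "istopology (\<lambda>U. U \<subseteq> topspace X // R \<and> openin X (?pre U))"
    unfolding istopology_def int un by (auto intro!: openin_Union)
  then show ?thesis
    unfolding quotient_top_def by (simp add: topology_inverse')
qed

section \<open>The Stone-Cech compactification\<close>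

text \<open>The Stone-Cech compactification of a discrete set \<open>S\<close> is the space of ultrafilters on \<open>S\<close>
  with the clopen sets \<open>{p. A \<in> p}\<close>, \<open>A \<subseteq> S\<close>, as a base; \<open>s \<in> S\<close> is identified with
  the principal ultrafilter \<open>principal {s}\<close>.\<close>

definition ultrafilters :: "'s set \<Rightarrow> 's filter set" where
  "ultrafilters S = {p. p \<noteq> bot \<and> p \<le> principal S \<and>
     (\<forall>P. eventually P p \<or> eventually (\<lambda>s. \<not> P s) p)}"

definition beta_top :: "'s set \<Rightarrow> 's filter topology" where
  "beta_top S = topology_generated_by {{p \<in> ultrafilters S. \<forall>\<^sub>F s in p. s \<in> A} | A. A \<subseteq> S}"

text \<open>The value at \<open>p\<close> of the continuous extension to ultrafilters of a map \<open>f\<close> into a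
  compact Hausdorff space \<open>K\<close>.\<close>

definition beta_ext :: "'k topology \<Rightarrow> ('s \<Rightarrow> 'k) \<Rightarrow> 's filter \<Rightarrow> 'k" where
  "beta_ext K f p = (THE z. limitin K f z p)"

text \<open>The product satisfies \<open>p q = lim\<^bsub>s\<rightarrow>p\<^esub> lim\<^bsub>t\<rightarrow>q\<^esub> s t\<close>, so \<open>p \<mapsto> p q\<close> is continuous for every \<open>q\<close>
  and \<open>q \<mapsto> s q\<close> is continuous for every group element \<open>s\<close>.\<close>

definition beta_mult :: "('s, 'm) monoid_scheme \<Rightarrow> 's filter \<Rightarrow> 's filter \<Rightarrow> 's filter" where
  "beta_mult H p q = Abs_filter (\<lambda>P. \<forall>\<^sub>F s in p. \<forall>\<^sub>F t in q. P (s \<otimes>\<^bsub>H\<^esub> t))"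

definition beta :: "('s, 'm) monoid_scheme \<Rightarrow> 's filter monoid" where
  "beta H = \<lparr>carrier = ultrafilters (carrier H), mult = beta_mult H, one = principal {\<one>\<^bsub>H\<^esub>}\<rparr>"

lemma eventually_beta_mult:
  "eventually P (beta_mult H p q) \<longleftrightarrow> (\<forall>\<^sub>F s in p. \<forall>\<^sub>F t in q. P (s \<otimes>\<^bsub>H\<^esub> t))"
  unfolding beta_mult_def
proof (rule eventually_Abs_filter, unfold_locales)
  show "\<forall>\<^sub>F s in p. \<forall>\<^sub>F t in q. P (s \<otimes>\<^bsub>H\<^esub> t) \<and> Q (s \<otimes>\<^bsub>H\<^esub> t)"
    if "\<forall>\<^sub>F s in p. \<forall>\<^sub>F t in q. P (s \<otimes>\<^bsub>H\<^esub> t)" "\<forall>\<^sub>F s in p. \<forall>\<^sub>F t in q. Q (s \<otimes>\<^bsub>H\<^esub> t)" for P Q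
    using that by (auto simp: eventually_conj_iff)
  show "\<forall>\<^sub>F s in p. \<forall>\<^sub>F t in q. Q (s \<otimes>\<^bsub>H\<^esub> t)"
    if "\<forall>x. P x \<longrightarrow> Q x" "\<forall>\<^sub>F s in p. \<forall>\<^sub>F t in q. P (s \<otimes>\<^bsub>H\<^esub> t)" for P Q
    using that(2) by (rule eventually_mono) (use that(1) in \<open>auto elim: eventually_mono\<close>)
qed auto

lemma topspace_beta_top [simp]: "topspace (beta_top S) = ultrafilters S"
  by (auto simp: beta_top_def topology_generated_by_topspace ultrafilters_def le_principal)

lemma limitin_beta_top_principal:
  assumes "p \<in> ultrafilters S"
  shows "limitin (beta_top S) (\<lambda>s. principal {s}) p p"
proof -
  have *: "\<forall>\<^sub>F s in p. principal {s} \<in> U"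
    if "generate_topology_on {{p \<in> ultrafilters S. \<forall>\<^sub>F s in p. s \<in> A} | A. A \<subseteq> S} U" "p \<in> U" for U
    using that
  proof (induction rule: generate_topology_on.induct)
    case (Int a b)
    then show ?case by (auto simp: eventually_conj_iff)
  next
    case (UN K)
    then obtain k where "k \<in> K" "p \<in> k" by blast
    with UN have "\<forall>\<^sub>F s in p. principal {s} \<in> k" by blast
    then show ?case using \<open>k \<in> K\<close> by (auto elim: eventually_mono)
  next
    case (Basis s)
    then obtain A where s: "s = {p \<in> ultrafilters S. \<forall>\<^sub>F s in p. s \<in> A}" and A: "A \<subseteq> S"
      by blast
    have "principal {x} \<in> s" if "x \<in> A" for x
      using that A by (auto simp: s ultrafilters_def eventually_principal principal_eq_bot_iff)
    moreover have "\<forall>\<^sub>F x in p. x \<in> A"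
      using Basis.prems by (simp add: s)
    ultimately show ?case
      by (rule_tac eventually_mono)
  qed auto
  show ?thesis
    unfolding limitin_def topspace_beta_top
  proof (intro conjI allI impI)
    fix U assume "openin (beta_top S) U \<and> p \<in> U"
    then show "\<forall>\<^sub>F s in p. principal {s} \<in> U"
      unfolding beta_top_def openin_topology_generated_by_iff by (blast intro: *)
  qed (rule assms)
qed

definition beta_act :: "'x topology \<Rightarrow> ('t \<Rightarrow> 'x \<Rightarrow> 'x) \<Rightarrow> 't filter \<Rightarrow> 'x \<Rightarrow> 'x" where
  "beta_act X \<phi> p x = beta_ext X (\<lambda>t. \<phi> t x) p"

text \<open>The continuous extension of the inclusion of the \<open>n\<close>-th Host-Kra cube group of \<open>T\<close> into the
  \<open>n\<close>-th cube of the compactification of \<open>T\<close>.\<close>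

definition beta_cube ::
    "nat \<Rightarrow> ('t, 'm) monoid_scheme \<Rightarrow> (nat set \<Rightarrow> 't) filter \<Rightarrow> nat set \<Rightarrow> 't filter" where
  "beta_cube n T =
     beta_ext (cube_top n (beta_top (carrier T))) (\<lambda>t. \<lambda>\<epsilon> \<in> cube n. principal {t \<epsilon>})"

definition left_ideal :: "('s, 'm) monoid_scheme \<Rightarrow> 's set \<Rightarrow> bool" where
  "left_ideal S L \<longleftrightarrow> L \<noteq> {} \<and> L \<subseteq> carrier S \<and> (\<forall>p \<in> carrier S. \<forall>q \<in> L. p \<otimes>\<^bsub>S\<^esub> q \<in> L)"

definition minimal_left_ideal :: "('s, 'm) monoid_scheme \<Rightarrow> 's set \<Rightarrow> bool" where
  "minimal_left_ideal S L \<longleftrightarrow> left_ideal S L \<and> (\<forall>K. left_ideal S K \<and> K \<subseteq> L \<longrightarrow> K = L)"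

definition idempotent_in :: "('s, 'm) monoid_scheme \<Rightarrow> 's \<Rightarrow> bool" where
  "idempotent_in S p \<longleftrightarrow> p \<in> carrier S \<and> p \<otimes>\<^bsub>S\<^esub> p = p"

definition minimal_idempotent :: "('s, 'm) monoid_scheme \<Rightarrow> 's \<Rightarrow> bool" where
  "minimal_idempotent S p \<longleftrightarrow> idempotent_in S p \<and> (\<exists>L. minimal_left_ideal S L \<and> p \<in> L)"

section \<open>The group \<open>G = u M\<close> and unique \<open>\<tau>\<close>-closure\<close>

definition G_group ::
    "('t, 'm) monoid_scheme \<Rightarrow> 't filter set \<Rightarrow> 't filter \<Rightarrow> 't filter monoid" where
  "G_group T M u = (beta T)\<lparr>carrier := (\<lambda>p. u \<otimes>\<^bsub>beta T\<^esub> p) ` M, one := u\<rparr>"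

text \<open>Below, \<open>v\<close> is an idempotent of the compactification of the \<open>n\<close>-th Host-Kra cube group
  of \<open>T\<close>, and the set \<open>A\<close> consists of points of the \<open>n\<close>-th cube of \<open>M\<close>.\<close>

definition circle ::
    "nat \<Rightarrow> ('t, 'm) monoid_scheme \<Rightarrow> 't filter set \<Rightarrow> (nat set \<Rightarrow> 't) filter \<Rightarrow>
     (nat set \<Rightarrow> 't filter) set \<Rightarrow> (nat set \<Rightarrow> 't filter) set" where
  "circle n T M v A = {w.
     \<exists>F :: ((nat set \<Rightarrow> 't) \<times> (nat set \<Rightarrow> 't filter)) filter. F \<noteq> bot \<and>
        F \<le> principal (carrier (HK n T) \<times> A) \<and>
        limitin (beta_top (carrier (HK n T))) (\<lambda>(t, a). principal {t}) v F \<and>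
        limitin (cube_top n (subtopology (beta_top (carrier T)) M))
          (\<lambda>(t, a). cube_act n (\<lambda>s p. principal {s} \<otimes>\<^bsub>beta T\<^esub> p) t a) w F}"

definition tau_closure ::
    "nat \<Rightarrow> ('t, 'm) monoid_scheme \<Rightarrow> 't filter set \<Rightarrow> 't filter \<Rightarrow> (nat set \<Rightarrow> 't) filter \<Rightarrow>
     (nat set \<Rightarrow> 't filter) set \<Rightarrow> (nat set \<Rightarrow> 't filter) set" where
  "tau_closure n T M u v A = (\<lambda>w. cube_diag n u \<otimes>\<^bsub>cube_group n (beta T)\<^esub> w) ` circle n T M v A"

definition unique_tau_closure ::
    "nat \<Rightarrow> ('t, 'm) monoid_scheme \<Rightarrow> 't filter set \<Rightarrow> 't filter \<Rightarrow> (nat set \<Rightarrow> 't) filter \<Rightarrow>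
     'x topology \<Rightarrow> ('t \<Rightarrow> 'x \<Rightarrow> 'x) \<Rightarrow> bool" where
  "unique_tau_closure n T M u v X \<phi> \<longleftrightarrow>
     (\<forall>x \<in> Q_cube n T X \<phi>.
        let C = (\<lambda>a. cube_act n (beta_act X \<phi>) a x) `
                  tau_closure n T M u v (carrier (HK n (G_group T M u)))
        in \<forall>y \<in> C. \<forall>z \<in> C.
             (\<exists>\<epsilon> \<in> cube n. \<forall>\<eta> \<in> cube n - {\<epsilon>}. y \<eta> = z \<eta>) \<longrightarrow> y = z)"

end

(*
Regional proximality is controlled by cubes with a corner: (x, y) is in RP^[d] iff the point with
coordinate x at the empty vertex and y elsewhere lies in Q^[d+1]. The key fact is that every point of
Q^[n] with coordinate x at the empty vertex can be contracted to x^[n] by limits of face elements.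
It is proved by induction on n, the upper facet being handled by idempotents in the Stone-Cech
compactification of the face group. It also gives that RP^[d] is a closed invariant equivalence
relation, so the quotient is a system.

The group T embeds in G by t -> t u, so the tau-closure of HK^[n](G) contains u p u for every p in the
compactification of HK^[n](T), and its orbits in Q^[n](X) consist of the points of Q^[n](X) that are
fixed by u. Two such points that differ in a single coordinate differ there by a pair in RP^[n-1], and
conversely. As both members of the pair are fixed by u, they are proximal only if they are equal.
*)

theory Submission
  imports Defs "HOL-Algebra.FiniteProduct"
begin

text \<open>The obstacle is the varying base point. A point of \<open>QF n\<close> is a limit of f
  a^[n] in which the face element f and the base point a vary together, so a limit equal to x on a
  facet says nothing directly about f x^[n]. \<open>face_filter\<close> therefore records the face
  elements only and quantifies the base point away. By minimality any base point can be translated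
  close to any other, and diagonal translations commute with face elements. Hence the filter at a
  diagonal point does not depend on that point, it is closed under multiplication, and right
  multiplication by its members preserves limits. This freedom is used to turn every coordinate on
  the lower facet, apart from the one at the empty vertex, into an idempotent fixing x; the base
  point on that facet may then be taken to be x.

  In the algebraic part closed sets of ultrafilters are represented by filters, and
  \<open>beta_mult\<close> is applied to arbitrary filters. Compactness becomes the existence of an
  ultrafilter below a proper filter, and \<open>beta_mult G \<phi> \<phi> \<le> \<phi>\<close>
  guarantees that the ultrafilters below \<open>\<phi>\<close> form a closed semigroup.\<close>

section \<open>Ultrafilters and idempotents\<close>

text \<open>Zorn's lemma for the reversed order, with infima of chains as bounds. It produces both
  ultrafilters and minimal closed semigroups.\<close>

lemma minimal_filter:
  fixes \<phi> :: "'a filter"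
  assumes "P \<phi>"
    and Inf: "\<And>C. C \<noteq> {} \<Longrightarrow> (\<And>\<psi> \<xi>. \<psi> \<in> C \<Longrightarrow> \<xi> \<in> C \<Longrightarrow> \<psi> \<le> \<xi> \<or> \<xi> \<le> \<psi>) \<Longrightarrow> (\<And>\<psi>. \<psi> \<in> C \<Longrightarrow> P \<psi>) \<Longrightarrow> P (Inf C)"
  obtains \<psi> where "\<psi> \<le> \<phi>" "P \<psi>" "\<And>\<xi>. \<xi> \<le> \<psi> \<Longrightarrow> P \<xi> \<Longrightarrow> \<xi> = \<psi>"
proof -
  define A where "A = {\<psi>. \<psi> \<le> \<phi> \<and> P \<psi>}"
  have "\<exists>m\<in>A. \<forall>a\<in>A. a \<le> m \<longrightarrow> a = m"
  proof (rule predicate_Zorn)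
    show "partial_order_on A (relation_of (\<lambda>x y. y \<le> x) A)"
      by (rule partial_order_on_relation_ofI) auto
    show "\<exists>u\<in>A. \<forall>a\<in>C. u \<le> a" if C: "C \<in> Chains (relation_of (\<lambda>x y. y \<le> x) A)" for C
    proof (cases "C = {}")
      case True
      then show ?thesis using assms(1) by (auto simp: A_def)
    next
      case False
      have sub: "\<psi> \<in> A" if "\<psi> \<in> C" for \<psi>
        using C that by (auto simp: Chains_def relation_of_def)
      have lin: "\<psi> \<le> \<xi> \<or> \<xi> \<le> \<psi>" if "\<psi> \<in> C" "\<xi> \<in> C" for \<psi> \<xi>
        using C that by (auto simp: Chains_def relation_of_def)
      have "P (Inf C)"
        using False lin sub by (intro Inf) (auto simp: A_def)
      moreover have "Inf C \<le> \<phi>"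
        using False sub by (auto simp: A_def intro: Inf_lower2)
      ultimately show ?thesis
        by (intro bexI[of _ "Inf C"]) (auto simp: A_def intro: Inf_lower)
    qed
  qed
  then obtain m where m: "m \<in> A" "\<forall>a\<in>A. a \<le> m \<longrightarrow> a = m" by blast
  show ?thesis
  proof (rule that)
    show "m \<le> \<phi>" "P m" using m(1) by (auto simp: A_def)
    show "\<xi> = m" if "\<xi> \<le> m" "P \<xi>" for \<xi>
      using m that \<open>m \<le> \<phi>\<close> by (auto simp: A_def)
  qed
qed

text \<open>The sets of a chain of filters are directed, so the infimum adds no new ones; in
  particular properness passes to it.\<close>

lemma eventually_Inf_chain:
  fixes C :: "'a filter set"
  assumes "C \<noteq> {}" "\<And>\<psi> \<xi>. \<psi> \<in> C \<Longrightarrow> \<xi> \<in> C \<Longrightarrow> \<psi> \<le> \<xi> \<or> \<xi> \<le> \<psi>"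
  shows "eventually P (Inf C) \<longleftrightarrow> (\<exists>\<psi>\<in>C. eventually P \<psi>)"
  using assms by (intro eventually_Inf_base) (auto simp: le_inf_iff)

text \<open>Detached from an ambient set, the condition passes to images and products without
  tracking carriers.\<close>

definition ultra :: "'a filter \<Rightarrow> bool" where
  "ultra p \<longleftrightarrow> p \<noteq> bot \<and> (\<forall>P. eventually P p \<or> (\<forall>\<^sub>F s in p. \<not> P s))"

lemma ultrafilters_iff: "p \<in> ultrafilters S \<longleftrightarrow> ultra p \<and> p \<le> principal S"
  by (auto simp: ultrafilters_def ultra_def)

lemma ultraD: "p \<in> ultrafilters S \<Longrightarrow> ultra p"
  by (simp add: ultrafilters_iff)

lemma ultrafilters_mono: "p \<in> ultrafilters S \<Longrightarrow> S \<subseteq> S' \<Longrightarrow> p \<in> ultrafilters S'"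
  by (auto simp: ultrafilters_def le_principal elim: eventually_mono)

lemma eventually_in_ultrafilter: "p \<in> ultrafilters S \<Longrightarrow> \<forall>\<^sub>F s in p. s \<in> S"
  by (simp add: ultrafilters_iff le_principal)

lemma ultra_not_eventually:
  assumes "ultra p"
  shows "\<not> eventually P p \<longleftrightarrow> (\<forall>\<^sub>F s in p. \<not> P s)"
proof
  show "\<not> eventually P p" if "\<forall>\<^sub>F s in p. \<not> P s"
  proof
    assume "eventually P p"
    with that have "\<forall>\<^sub>F s in p. False" by eventually_elim simp
    then show False using assms by (simp add: ultra_def)
  qed
qed (use assms in \<open>auto simp: ultra_def\<close>)

text \<open>Finer filters are smaller in this order. Later proofs establish one inequality between
  ultrafilters and conclude equality from this.\<close>

lemma ultra_minimal:
  assumes p: "ultra p" and "q \<le> p" "q \<noteq> bot"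
  shows "q = p"
proof (rule antisym[OF assms(2)], rule filter_leI, rule ccontr)
  fix P assume P: "eventually P q" "\<not> eventually P p"
  then have "\<forall>\<^sub>F s in q. \<not> P s"
    using assms(2) by (simp add: ultra_not_eventually[OF p] filter_leD)
  with P(1) have "\<forall>\<^sub>F s in q. False" by eventually_elim simp
  then show False using assms(3) by simp
qed

lemma ultra_principal [simp]: "ultra (principal {a})"
  by (auto simp: ultra_def eventually_principal principal_eq_bot_iff)

lemma principal_in_ultrafilters [simp]: "principal {a} \<in> ultrafilters S \<longleftrightarrow> a \<in> S"
  by (simp add: ultrafilters_iff)

lemma ultra_filtermap: "ultra p \<Longrightarrow> ultra (filtermap f p)"
  by (simp add: ultra_def eventually_filtermap filtermap_bot_iff)

lemma filtermap_ultrafilters: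
  "p \<in> ultrafilters S \<Longrightarrow> f ` S \<subseteq> S' \<Longrightarrow> filtermap f p \<in> ultrafilters S'"
  by (auto simp: ultrafilters_iff ultra_filtermap le_principal eventually_filtermap
      elim!: eventually_mono)

lemma filtermap_const:
  assumes "p \<noteq> bot"
  shows "filtermap (\<lambda>_. c) p = principal {c}"
  using assms by (auto simp: filter_eq_iff eventually_filtermap eventually_principal)

lemma ultra_exists:
  assumes "\<phi> \<noteq> bot"
  obtains p where "ultra p" "p \<le> \<phi>"
proof -
  obtain p where p: "p \<le> \<phi>" "p \<noteq> bot" "\<And>\<xi>. \<xi> \<le> p \<Longrightarrow> \<xi> \<noteq> bot \<Longrightarrow> \<xi> = p"
  proof (rule minimal_filter[of "\<lambda>\<psi>. \<psi> \<noteq> bot" \<phi>])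
    fix C :: "'a filter set"
    assume "C \<noteq> {}" "\<And>\<psi> \<xi>. \<psi> \<in> C \<Longrightarrow> \<xi> \<in> C \<Longrightarrow> \<psi> \<le> \<xi> \<or> \<xi> \<le> \<psi>" "\<And>\<psi>. \<psi> \<in> C \<Longrightarrow> \<psi> \<noteq> bot"
    then show "Inf C \<noteq> bot"
      unfolding trivial_limit_def by (subst eventually_Inf_chain) (auto simp: trivial_limit_def)
  qed (use assms in auto)
  \<comment> \<open>Cutting a minimal proper filter down to a set that it does not exclude must
    leave it unchanged.\<close>
  have "eventually P p" if "\<not> (\<forall>\<^sub>F s in p. \<not> P s)" for P
  proof -
    have "inf p (principal {s. P s}) \<noteq> bot"
      using that by (simp add: trivial_limit_def eventually_inf_principal)
    then have "inf p (principal {s. P s}) = p" by (intro p(3)) auto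
    then have "p \<le> principal {s. P s}" by (metis inf.cobounded2)
    then show ?thesis by (simp add: le_principal)
  qed
  then have "ultra p" using p(2) by (auto simp: ultra_def)
  with p(1) that show ?thesis by blast
qed

section \<open>Products of filters and idempotents of closed semigroups\<close>

lemma beta_mult_mono:
  "p \<le> p' \<Longrightarrow> q \<le> q' \<Longrightarrow> beta_mult S p q \<le> beta_mult S p' q'"
  by (auto simp: le_filter_def eventually_beta_mult elim!: eventually_mono)

lemma beta_mult_not_bot: "p \<noteq> bot \<Longrightarrow> q \<noteq> bot \<Longrightarrow> beta_mult S p q \<noteq> bot"
  unfolding trivial_limit_def eventually_beta_mult by simp

lemma beta_mult_ultra:
  assumes p: "ultra p" and q: "ultra q"
  shows "ultra (beta_mult S p q)"
  unfolding ultra_def eventually_beta_mult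
proof (intro conjI allI)
  show "beta_mult S p q \<noteq> bot"
    using assms by (simp add: ultra_def beta_mult_not_bot)
  show "(\<forall>\<^sub>F s in p. \<forall>\<^sub>F t in q. P (s \<otimes>\<^bsub>S\<^esub> t)) \<or> (\<forall>\<^sub>F s in p. \<forall>\<^sub>F t in q. \<not> P (s \<otimes>\<^bsub>S\<^esub> t))" for P
    unfolding ultra_not_eventually[OF q, symmetric] using p by (simp add: ultra_def)
qed

lemma beta_mult_le_principal:
  assumes "p \<le> principal A" "q \<le> principal B"
    and "\<And>s t. s \<in> A \<Longrightarrow> t \<in> B \<Longrightarrow> s \<otimes>\<^bsub>S\<^esub> t \<in> C"
  shows "beta_mult S p q \<le> principal C"
  using assms unfolding le_principal eventually_beta_mult
  by (auto elim!: eventually_mono)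

lemma beta_mult_ultrafilters:
  assumes "p \<in> ultrafilters A" "q \<in> ultrafilters B"
    and "\<And>s t. s \<in> A \<Longrightarrow> t \<in> B \<Longrightarrow> s \<otimes>\<^bsub>S\<^esub> t \<in> C"
  shows "beta_mult S p q \<in> ultrafilters C"
  using assms by (auto simp: ultrafilters_iff intro: beta_mult_ultra beta_mult_le_principal)

lemma (in monoid) beta_mult_assoc:
  assumes "p \<le> principal (carrier G)" "q \<le> principal (carrier G)" "r \<le> principal (carrier G)"
  shows "beta_mult G (beta_mult G p q) r = beta_mult G p (beta_mult G q r)"
proof -
  have *: "\<forall>\<^sub>F s in p. s \<in> carrier G" "\<forall>\<^sub>F s in q. s \<in> carrier G" "\<forall>\<^sub>F s in r. s \<in> carrier G"
    using assms by (auto simp: le_principal)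
  show ?thesis
    unfolding filter_eq_iff eventually_beta_mult
    by (intro allI eventually_cong[OF *(1)] eventually_cong[OF *(2)] eventually_cong[OF *(3)])
       (simp add: m_assoc)
qed

lemma filtermap_beta_mult:
  assumes "p \<le> principal A" "q \<le> principal B"
    and "\<And>s t. s \<in> A \<Longrightarrow> t \<in> B \<Longrightarrow> h (s \<otimes>\<^bsub>S\<^esub> t) = h s \<otimes>\<^bsub>S'\<^esub> h t"
  shows "filtermap h (beta_mult S p q) = beta_mult S' (filtermap h p) (filtermap h q)"
proof -
  have A: "\<forall>\<^sub>F s in p. s \<in> A" and B: "\<forall>\<^sub>F s in q. s \<in> B" using assms by (auto simp: le_principal)
  show ?thesis
    unfolding filter_eq_iff eventually_beta_mult eventually_filtermap
    by (intro allI eventually_cong[OF A] eventually_cong[OF B]) (simp add: assms(3))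
qed

text \<open>A closed set of ultrafilters is \<open>{p. p \<le> \<phi>}\<close> for a filter \<open>\<phi>\<close>, and its right translate by \<open>q\<close>
  is given by the filter \<open>beta_mult S \<phi> q\<close>.\<close>

lemma beta_mult_factor:
  assumes r: "ultra r" "r \<le> beta_mult S \<phi> q" and q: "ultra q"
  obtains p where "ultra p" "p \<le> \<phi>" "beta_mult S p q = r"
proof -
  \<comment> \<open>An ultrafilter p below \<open>\<xi>\<close> lies below \<open>\<phi>\<close> and
    contains, for each P that holds along r, the set of s such that P (s t) holds for q-almost all
    t. The second condition says that p q lies below r.\<close>
  define \<xi> where "\<xi> = inf \<phi> (INF P\<in>{P. eventually P r}. principal {s. \<forall>\<^sub>F t in q. P (s \<otimes>\<^bsub>S\<^esub> t)})"
  have ev: "eventually Q (INF P\<in>{P. eventually P r}. principal {s. \<forall>\<^sub>F t in q. P (s \<otimes>\<^bsub>S\<^esub> t)}) \<longleftrightarrow>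
      (\<exists>P. eventually P r \<and> (\<forall>s. (\<forall>\<^sub>F t in q. P (s \<otimes>\<^bsub>S\<^esub> t)) \<longrightarrow> Q s))" for Q
  proof (subst eventually_INF_base)
    show "\<exists>x\<in>{P. eventually P r}. principal {s. \<forall>\<^sub>F t in q. x (s \<otimes>\<^bsub>S\<^esub> t)} \<le>
            inf (principal {s. \<forall>\<^sub>F t in q. a (s \<otimes>\<^bsub>S\<^esub> t)}) (principal {s. \<forall>\<^sub>F t in q. b (s \<otimes>\<^bsub>S\<^esub> t)})"
      if "a \<in> {P. eventually P r}" "b \<in> {P. eventually P r}" for a b
      using that by (intro bexI[of _ "\<lambda>x. a x \<and> b x"]) (auto simp: eventually_conj_iff)
    show "{P. eventually P r} \<noteq> {}" by (auto intro: exI[of _ "\<lambda>_. True"])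
  qed (auto simp: eventually_principal)
  \<comment> \<open>Were the conditions incompatible, the ultrafilter q would put the complement of
    some set of r into the product of \<open>\<phi>\<close> and q, which r refines.\<close>
  have "\<xi> \<noteq> bot"
  proof
    assume "\<xi> = bot"
    then have "eventually (\<lambda>_. False) \<xi>" by simp
    then obtain A B where AB: "eventually A \<phi>" "\<And>s. A s \<Longrightarrow> \<not> B s"
        "eventually B (INF P\<in>{P. eventually P r}. principal {s. \<forall>\<^sub>F t in q. P (s \<otimes>\<^bsub>S\<^esub> t)})"
      unfolding \<xi>_def eventually_inf by auto
    then obtain P where P: "eventually P r" "\<And>s. (\<forall>\<^sub>F t in q. P (s \<otimes>\<^bsub>S\<^esub> t)) \<Longrightarrow> B s"
      unfolding ev by auto
    have "\<forall>\<^sub>F s in \<phi>. \<forall>\<^sub>F t in q. \<not> P (s \<otimes>\<^bsub>S\<^esub> t)"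
      using AB(1) by (rule eventually_mono) (metis AB(2) P(2) ultra_not_eventually[OF q])
    then have "\<forall>\<^sub>F s in beta_mult S \<phi> q. \<not> P s"
      by (simp add: eventually_beta_mult)
    then have "\<forall>\<^sub>F s in r. \<not> P s"
      using r(2) by (rule filter_leD[rotated])
    then show False
      using P(1) ultra_not_eventually[OF r(1), of P] by blast
  qed
  then obtain p where p: "ultra p" "p \<le> \<xi>" by (rule ultra_exists)
  have "beta_mult S p q \<le> r"
  proof (rule filter_leI)
    fix P assume "eventually P r"
    then have "\<xi> \<le> principal {s. \<forall>\<^sub>F t in q. P (s \<otimes>\<^bsub>S\<^esub> t)}"
      unfolding \<xi>_def by (intro le_infI2 INF_lower) simp
    then have "\<forall>\<^sub>F s in \<xi>. \<forall>\<^sub>F t in q. P (s \<otimes>\<^bsub>S\<^esub> t)" by (simp add: le_principal)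
    then show "eventually P (beta_mult S p q)"
      unfolding eventually_beta_mult using p(2) by (rule filter_leD[rotated])
  qed
  then have "beta_mult S p q = r"
    using beta_mult_ultra[OF p(1) q] by (intro ultra_minimal[OF r(1)]) (auto simp: ultra_def)
  moreover have "p \<le> \<phi>" using p(2) by (simp add: \<xi>_def)
  ultimately show ?thesis using p(1) that by blast
qed

text \<open>Let \<open>\<psi>\<close> be a minimal filter of this kind and p an ultrafilter below
  it. The product \<open>\<psi>\<close> p is of the same kind, hence equals \<open>\<psi>\<close>,
  so some r below \<open>\<psi>\<close> satisfies r p = p. The filter of all such r is again of this
  kind, so p lies below it and p p = p.\<close>

lemma (in monoid) Ellis_Numakura:
  assumes "\<phi> \<noteq> bot" "\<phi> \<le> principal (carrier G)" "beta_mult G \<phi> \<phi> \<le> \<phi>"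
  obtains p where "ultra p" "p \<le> \<phi>" "beta_mult G p p = p"
proof -
  define Sub where "Sub \<psi> \<longleftrightarrow> \<psi> \<noteq> bot \<and> \<psi> \<le> principal (carrier G) \<and> beta_mult G \<psi> \<psi> \<le> \<psi>" for \<psi>
  obtain \<psi> where \<psi>: "\<psi> \<le> \<phi>" "Sub \<psi>" "\<And>\<xi>. \<xi> \<le> \<psi> \<Longrightarrow> Sub \<xi> \<Longrightarrow> \<xi> = \<psi>"
  proof (rule minimal_filter[of Sub \<phi>])
    fix C :: "'a filter set"
    assume C: "C \<noteq> {}" "\<And>\<psi> \<xi>. \<psi> \<in> C \<Longrightarrow> \<xi> \<in> C \<Longrightarrow> \<psi> \<le> \<xi> \<or> \<xi> \<le> \<psi>" "\<And>\<psi>. \<psi> \<in> C \<Longrightarrow> Sub \<psi>"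
    have 1: "Inf C \<noteq> bot"
      using C unfolding trivial_limit_def
      by (subst eventually_Inf_chain) (auto simp: trivial_limit_def Sub_def)
    obtain c where c: "c \<in> C" using C(1) by blast
    have 2: "Inf C \<le> principal (carrier G)"
      using C(3)[OF c] c by (auto simp: Sub_def intro: Inf_lower2)
    have 3: "beta_mult G (Inf C) (Inf C) \<le> Inf C"
    proof (rule Inf_greatest)
      fix \<psi> assume "\<psi> \<in> C"
      then show "beta_mult G (Inf C) (Inf C) \<le> \<psi>"
        using C(3) by (meson Inf_lower Sub_def beta_mult_mono order_trans)
    qed
    show "Sub (Inf C)" using 1 2 3 by (simp add: Sub_def)
  qed (use assms in \<open>auto simp: Sub_def\<close>)
  have \<psi>_bot: "\<psi> \<noteq> bot" and \<psi>_car: "\<psi> \<le> principal (carrier G)"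
    and \<psi>_mult: "beta_mult G \<psi> \<psi> \<le> \<psi>" using \<psi>(2) by (auto simp: Sub_def)
  obtain p where p: "ultra p" "p \<le> \<psi>" using \<psi>_bot by (rule ultra_exists)
  have p_car: "p \<le> principal (carrier G)" using p \<psi>_car by simp
  have le: "beta_mult G \<psi> p \<le> \<psi>"
    using beta_mult_mono[OF order_refl p(2)] \<psi>_mult by (rule order_trans)
  have "beta_mult G (beta_mult G \<psi> p) (beta_mult G \<psi> p) \<le> beta_mult G \<psi> p"
  proof -
    have "beta_mult G (beta_mult G \<psi> p) (beta_mult G \<psi> p) \<le> beta_mult G \<psi> (beta_mult G \<psi> p)"
      by (rule beta_mult_mono[OF le order_refl])
    also have "\<dots> = beta_mult G (beta_mult G \<psi> \<psi>) p"
      using \<psi>_car p_car by (simp add: beta_mult_assoc)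
    also have "\<dots> \<le> beta_mult G \<psi> p"
      by (rule beta_mult_mono[OF \<psi>_mult order_refl])
    finally show ?thesis .
  qed
  then have "Sub (beta_mult G \<psi> p)"
    using \<psi>_bot p(1) le \<psi>_car by (auto simp: Sub_def ultra_def beta_mult_not_bot)
  then have eq: "beta_mult G \<psi> p = \<psi>" by (rule \<psi>(3)[OF le])
  then obtain r where r: "ultra r" "r \<le> \<psi>" "beta_mult G r p = p"
    using beta_mult_factor[OF p(1), of G \<psi> p] p by auto
  \<comment> \<open>The stabiliser of p as a filter: the ultrafilters below \<open>\<xi>\<close> are
    the s below \<open>\<psi>\<close> with s p = p.\<close>
  define \<xi> where "\<xi> = inf \<psi> (INF P\<in>{P. eventually P p}. principal {s. \<forall>\<^sub>F t in p. P (s \<otimes> t)})"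
  have "r \<le> \<xi>"
    unfolding \<xi>_def
  proof (intro inf_greatest INF_greatest r(2))
    fix P assume "P \<in> {P. eventually P p}"
    then have "eventually P (beta_mult G r p)" using r(3) by simp
    then show "r \<le> principal {s. \<forall>\<^sub>F t in p. P (s \<otimes> t)}"
      by (simp add: eventually_beta_mult le_principal)
  qed
  then have "\<xi> \<noteq> bot" using r(1) by (auto simp: ultra_def bot_unique)
  have \<xi>\<psi>: "\<xi> \<le> \<psi>" by (simp add: \<xi>_def)
  have \<xi>p: "beta_mult G \<xi> p \<le> p"
  proof (rule filter_leI)
    fix P assume "eventually P p"
    then have "\<xi> \<le> principal {s. \<forall>\<^sub>F t in p. P (s \<otimes> t)}"
      unfolding \<xi>_def by (intro le_infI2 INF_lower) simp
    then show "eventually P (beta_mult G \<xi> p)"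
      by (simp add: eventually_beta_mult le_principal)
  qed
  have \<xi>_car: "\<xi> \<le> principal (carrier G)" using \<xi>\<psi> \<psi>_car by simp
  have "beta_mult G \<xi> \<xi> \<le> \<xi>"
    unfolding \<xi>_def
  proof (intro inf_greatest INF_greatest; fold \<xi>_def)
    show "beta_mult G \<xi> \<xi> \<le> \<psi>"
      using beta_mult_mono[OF \<xi>\<psi> \<xi>\<psi>] \<psi>_mult by (rule order_trans)
  next
    fix P assume P: "P \<in> {P. eventually P p}"
    have "beta_mult G (beta_mult G \<xi> \<xi>) p = beta_mult G \<xi> (beta_mult G \<xi> p)"
      using \<xi>_car p_car by (simp add: beta_mult_assoc)
    also have "\<dots> \<le> p"
      using beta_mult_mono[OF order_refl \<xi>p] \<xi>p by (rule order_trans)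
    finally have "eventually P (beta_mult G (beta_mult G \<xi> \<xi>) p)"
      using P by (auto dest: filter_leD)
    then show "beta_mult G \<xi> \<xi> \<le> principal {s. \<forall>\<^sub>F t in p. P (s \<otimes> t)}"
      by (subst (asm) eventually_beta_mult) (simp add: le_principal)
  qed
  then have "\<xi> = \<psi>"
    using \<open>\<xi> \<noteq> bot\<close> \<xi>_car by (intro \<psi>(3)[OF \<xi>\<psi>]) (simp add: Sub_def)
  then have "p \<le> \<xi>" using p(2) by simp
  have "beta_mult G p p \<le> p"
    using beta_mult_mono[OF \<open>p \<le> \<xi>\<close> order_refl] \<xi>p by (rule order_trans)
  then have "beta_mult G p p = p"
    using p(1) by (intro ultra_minimal) (auto simp: ultra_def beta_mult_not_bot)
  then show ?thesis using that p \<psi>(1) by (meson order_trans)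
qed

text \<open>The left ideal \<open>\<phi>\<close> c is closed under multiplication, so it contains an
  idempotent, and every ultrafilter in it factors as b c. The left factor b is what the later
  corrections use.\<close>

lemma (in monoid) idempotent_in_left_ideal:
  assumes c: "ultra c" "c \<le> \<phi>" and \<phi>: "\<phi> \<le> principal (carrier G)" "beta_mult G \<phi> \<phi> \<le> \<phi>"
  obtains b where "ultra b" "b \<le> \<phi>"
    "beta_mult G (beta_mult G b c) (beta_mult G b c) = beta_mult G b c"
proof -
  have c_car: "c \<le> principal (carrier G)" using c \<phi> by simp
  have "\<phi> \<noteq> bot" using c by (auto simp: ultra_def bot_unique)
  have le: "beta_mult G \<phi> c \<le> \<phi>"
    using beta_mult_mono[OF order_refl c(2)] \<phi>(2) by (rule order_trans)
  obtain w where w: "ultra w" "w \<le> beta_mult G \<phi> c" "beta_mult G w w = w"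
  proof (rule Ellis_Numakura)
    show "beta_mult G \<phi> c \<noteq> bot"
      using \<open>\<phi> \<noteq> bot\<close> c(1) by (simp add: ultra_def beta_mult_not_bot)
    show "beta_mult G \<phi> c \<le> principal (carrier G)" using le \<phi>(1) by simp
    have "beta_mult G (beta_mult G \<phi> c) (beta_mult G \<phi> c) \<le> beta_mult G \<phi> (beta_mult G \<phi> c)"
      by (rule beta_mult_mono[OF le order_refl])
    also have "\<dots> = beta_mult G (beta_mult G \<phi> \<phi>) c"
      using \<phi> c_car by (simp add: beta_mult_assoc)
    also have "\<dots> \<le> beta_mult G \<phi> c"
      by (rule beta_mult_mono[OF \<phi>(2) order_refl])
    finally show "beta_mult G (beta_mult G \<phi> c) (beta_mult G \<phi> c) \<le> beta_mult G \<phi> c" .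
  qed
  obtain b where "ultra b" "b \<le> \<phi>" "beta_mult G b c = w"
    using beta_mult_factor[OF w(1,2) c(1)] .
  with that w(3) show ?thesis by blast
qed

section \<open>Minimal left ideals\<close>

lemma carrier_beta [simp]: "carrier (beta H) = ultrafilters (carrier H)"
  and mult_beta [simp]: "mult (beta H) = beta_mult H"
  and one_beta [simp]: "one (beta H) = principal {\<one>\<^bsub>H\<^esub>}"
  by (simp_all add: beta_def)

lemma (in monoid) beta_assoc:
  assumes "p \<in> ultrafilters (carrier G)" "q \<in> ultrafilters (carrier G)" "r \<in> ultrafilters (carrier G)"
  shows "beta_mult G (beta_mult G p q) r = beta_mult G p (beta_mult G q r)"
  using assms by (simp add: ultrafilters_iff beta_mult_assoc)

lemma (in monoid) beta_closed:
  assumes "p \<in> ultrafilters (carrier G)" "q \<in> ultrafilters (carrier G)"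
  shows "beta_mult G p q \<in> ultrafilters (carrier G)"
  using assms by (rule beta_mult_ultrafilters) simp

lemma (in monoid) beta_left_one:
  assumes "p \<le> principal (carrier G)"
  shows "beta_mult G (principal {\<one>}) p = p"
proof -
  have "\<forall>\<^sub>F s in p. s \<in> carrier G" using assms by (simp add: le_principal)
  then show ?thesis
    unfolding filter_eq_iff eventually_beta_mult eventually_principal
    by (intro allI) (simp, rule eventually_cong, assumption, simp)
qed

lemma (in monoid) beta_right_one:
  assumes "p \<le> principal (carrier G)"
  shows "beta_mult G p (principal {\<one>}) = p"
proof -
  have "\<forall>\<^sub>F s in p. s \<in> carrier G" using assms by (simp add: le_principal)
  then show ?thesis
    unfolding filter_eq_iff eventually_beta_mult eventually_principal
    by (intro allI) (simp, rule eventually_cong, assumption, simp)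
qed

locale minimal_ideal = monoid G for G (structure) +
  fixes M
  assumes min_ideal: "minimal_left_ideal (beta G) M"
begin

lemma ideal_subset: "M \<subseteq> ultrafilters (carrier G)"
  and ideal_closed: "p \<in> ultrafilters (carrier G) \<Longrightarrow> a \<in> M \<Longrightarrow> beta_mult G p a \<in> M"
  and ideal_nonempty: "M \<noteq> {}"
  using min_ideal by (auto simp: minimal_left_ideal_def left_ideal_def)

lemma ideal_mem [simp]: "a \<in> M \<Longrightarrow> a \<in> ultrafilters (carrier G)"
  using ideal_subset by blast

text \<open>The translate is a left ideal contained in M. Surjectivity of right translations on M is
  the source of the identities that follow.\<close>

lemma ideal_eq_translate:
  assumes "a \<in> M"
  shows "(\<lambda>p. beta_mult G p a) ` M = M"
proof -
  have "left_ideal (beta G) ((\<lambda>p. beta_mult G p a) ` M)"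
    unfolding left_ideal_def carrier_beta mult_beta
  proof (intro conjI ballI)
    show "(\<lambda>p. beta_mult G p a) ` M \<noteq> {}" using ideal_nonempty by simp
    show "(\<lambda>p. beta_mult G p a) ` M \<subseteq> ultrafilters (carrier G)"
      using assms by (auto intro: beta_closed)
    fix p q assume p: "p \<in> ultrafilters (carrier G)" and "q \<in> (\<lambda>p. beta_mult G p a) ` M"
    then obtain b where b: "b \<in> M" "q = beta_mult G b a" by blast
    then have "beta_mult G p q = beta_mult G (beta_mult G p b) a"
      using p assms by (simp add: beta_assoc)
    then show "beta_mult G p q \<in> (\<lambda>p. beta_mult G p a) ` M"
      using ideal_closed[OF p b(1)] by blast
  qed
  moreover have "(\<lambda>p. beta_mult G p a) ` M \<subseteq> M"
    using assms by (auto intro: ideal_closed)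
  ultimately show ?thesis
    using min_ideal by (auto simp: minimal_left_ideal_def)
qed

lemma idempotent_right_identity:
  assumes "u \<in> M" "beta_mult G u u = u" "a \<in> M"
  shows "beta_mult G a u = a"
proof -
  obtain b where "b \<in> M" "a = beta_mult G b u"
    using ideal_eq_translate[OF assms(1)] assms(3) by blast
  then show ?thesis using assms by (simp add: beta_assoc)
qed

text \<open>Take r with r p = u and replace it by u r. In (p r)(p r) the inner product r p is u,
  which is absorbed by r.\<close>

lemma right_inverse:
  assumes u: "u \<in> M" "beta_mult G u u = u" and p: "p \<in> M"
  obtains r where "r \<in> M" "beta_mult G u r = r" "beta_mult G r p = u"
    "beta_mult G (beta_mult G p r) (beta_mult G p r) = beta_mult G p r"
proof -
  obtain r where r: "r \<in> M" "u = beta_mult G r p"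
    using ideal_eq_translate[OF p] u(1) by blast
  let ?r = "beta_mult G u r"
  have rM: "?r \<in> M" using u r by (auto intro: ideal_closed)
  have ur: "beta_mult G u ?r = ?r" using u r by (metis beta_assoc ideal_mem)
  have rp: "beta_mult G ?r p = u" using u r p by (metis beta_assoc ideal_mem)
  have "beta_mult G (beta_mult G p ?r) (beta_mult G p ?r)
      = beta_mult G p (beta_mult G (beta_mult G ?r p) ?r)"
    using p rM by (simp add: beta_assoc beta_closed)
  also have "\<dots> = beta_mult G p ?r" by (simp only: rp ur)
  finally show ?thesis using that rM ur rp by blast
qed

text \<open>Multiply by an r for which p r is an idempotent of M: such an idempotent is a right
  identity on M.\<close>

lemma right_cancel:
  assumes u: "u \<in> M" "beta_mult G u u = u" and "a \<in> M" "b \<in> M" "p \<in> M"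
    and eq: "beta_mult G a p = beta_mult G b p"
  shows "a = b"
proof -
  obtain r where r: "r \<in> M" "beta_mult G (beta_mult G p r) (beta_mult G p r) = beta_mult G p r"
    using right_inverse[OF u \<open>p \<in> M\<close>] by metis
  have pr: "beta_mult G p r \<in> M" using assms r by (auto intro: ideal_closed)
  have "a = beta_mult G (beta_mult G a p) r"
    using idempotent_right_identity[OF pr r(2) \<open>a \<in> M\<close>] assms(3,5) r(1) by (simp add: beta_assoc)
  also have "\<dots> = beta_mult G (beta_mult G b p) r" by (simp only: eq)
  also have "\<dots> = b"
    using idempotent_right_identity[OF pr r(2) \<open>b \<in> M\<close>] assms(4,5) r(1) by (simp add: beta_assoc)
  finally show ?thesis .
qed

text \<open>With w = b a, both w b and b give w after right multiplication by a, so w b = b by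
  cancellation and (a b)(a b) = a (w b) = a b. A correcting factor found on the left can thus be
  used on the right.\<close>

lemma idempotent_swap:
  assumes u: "u \<in> M" "beta_mult G u u = u" and a: "a \<in> M" and b: "b \<in> M"
    and w: "beta_mult G (beta_mult G b a) (beta_mult G b a) = beta_mult G b a"
  shows "beta_mult G (beta_mult G a b) (beta_mult G a b) = beta_mult G a b"
proof -
  let ?w = "beta_mult G b a"
  have wM: "?w \<in> M" using a b by (auto intro: ideal_closed)
  have "beta_mult G ?w b = b"
  proof (rule right_cancel[OF u _ b a])
    show "beta_mult G ?w b \<in> M" using b wM by (auto intro: ideal_closed)
    show "beta_mult G (beta_mult G ?w b) a = beta_mult G b a"
      using w a b wM by (simp add: beta_assoc[of ?w])
  qed
  moreover have "beta_mult G (beta_mult G a b) (beta_mult G a b) = beta_mult G a (beta_mult G ?w b)"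
    using a b by (simp add: beta_assoc beta_closed)
  ultimately show ?thesis by simp
qed

end

section \<open>Ultrafilter actions on compact Hausdorff spaces\<close>

text \<open>For D W = {s. f s \<in> W} this is the pullback along f of the neighbourhood filter of
  y. A general monotone D also allows a further parameter of a net to be existentially
  quantified.\<close>

definition nbhd_pull :: "'z topology \<Rightarrow> 'z \<Rightarrow> ('z set \<Rightarrow> 's set) \<Rightarrow> 's filter" where
  "nbhd_pull Z y D = (INF W\<in>{W. openin Z W \<and> y \<in> W}. principal (D W))"

lemma eventually_nbhd_pull:
  assumes "y \<in> topspace Z" "\<And>W W'. W \<subseteq> W' \<Longrightarrow> D W \<subseteq> D W'"
  shows "eventually P (nbhd_pull Z y D) \<longleftrightarrow> (\<exists>W. openin Z W \<and> y \<in> W \<and> (\<forall>s\<in>D W. P s))"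
proof -
  have "eventually P (nbhd_pull Z y D) \<longleftrightarrow>
      (\<exists>W\<in>{W. openin Z W \<and> y \<in> W}. eventually P (principal (D W)))"
    unfolding nbhd_pull_def
  proof (rule eventually_INF_base)
    show "{W. openin Z W \<and> y \<in> W} \<noteq> {}" using assms(1) by blast
    show "\<exists>W\<in>{W. openin Z W \<and> y \<in> W}. principal (D W) \<le> inf (principal (D U)) (principal (D V))"
      if "U \<in> {W. openin Z W \<and> y \<in> W}" "V \<in> {W. openin Z W \<and> y \<in> W}" for U V
      using that assms(2)[of "U \<inter> V" U] assms(2)[of "U \<inter> V" V]
      by (intro bexI[of _ "U \<inter> V"]) auto
  qed
  then show ?thesis by (auto simp: eventually_principal)
qed

lemma le_nbhd_pull:
  "r \<le> nbhd_pull Z y D \<longleftrightarrow> (\<forall>W. openin Z W \<longrightarrow> y \<in> W \<longrightarrow> (\<forall>\<^sub>F s in r. s \<in> D W))"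
  unfolding nbhd_pull_def le_INF_iff le_principal by simp blast

lemma nbhd_pull_not_bot:
  assumes "y \<in> topspace Z" "\<And>W W'. W \<subseteq> W' \<Longrightarrow> D W \<subseteq> D W'"
    and "\<And>W. openin Z W \<Longrightarrow> y \<in> W \<Longrightarrow> D W \<noteq> {}"
  shows "nbhd_pull Z y D \<noteq> bot"
proof -
  have "\<exists>s. s \<in> D W" if "openin Z W" "y \<in> W" for W
    using assms(3)[OF that] by blast
  then have "\<not> eventually (\<lambda>_. False) (nbhd_pull Z y D)"
    by (subst eventually_nbhd_pull) (use assms(1,2) in \<open>simp_all only:\<close>, blast)
  then show ?thesis unfolding trivial_limit_def .
qed

lemma ultra_limit_exists:
  assumes K: "compact_space K" and p: "ultra p" and f: "\<forall>\<^sub>F s in p. f s \<in> topspace K"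
  shows "\<exists>z. limitin K f z p"
proof (rule ccontr)
  assume no: "\<nexists>z. limitin K f z p"
  define \<U> where "\<U> = {U. openin K U \<and> \<not> (\<forall>\<^sub>F s in p. f s \<in> U)}"
  have "topspace K \<subseteq> \<Union>\<U>"
  proof
    fix z assume "z \<in> topspace K"
    moreover have "\<not> limitin K f z p" using no by simp
    ultimately show "z \<in> \<Union>\<U>" unfolding limitin_def \<U>_def by auto
  qed
  then obtain \<F> where \<F>: "finite \<F>" "\<F> \<subseteq> \<U>" "topspace K \<subseteq> \<Union>\<F>"
    using compactinD[OF K[unfolded compact_space_def], of \<U>] by (auto simp: \<U>_def)
  have "\<forall>\<^sub>F s in p. \<forall>V\<in>\<F>. f s \<notin> V"
  proof (rule eventually_ball_finite[OF \<F>(1)], rule ballI)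
    fix V assume "V \<in> \<F>"
    then have "\<not> (\<forall>\<^sub>F s in p. f s \<in> V)" using \<F>(2) by (auto simp: \<U>_def)
    then show "\<forall>\<^sub>F s in p. f s \<notin> V" by (simp only: ultra_not_eventually[OF p])
  qed
  then have "\<forall>\<^sub>F s in p. False"
    using f by eventually_elim (use \<F>(3) in blast)
  then show False using p by (simp add: ultra_def)
qed

lemma beta_ext_eqI:
  assumes "Hausdorff_space K" "p \<noteq> bot" "limitin K f z p"
  shows "beta_ext K f p = z"
  unfolding beta_ext_def
proof (rule the_equality)
  show "limitin K f z p" by (rule assms(3))
  show "w = z" if "limitin K f w p" for w
    using limitin_Hausdorff_unique[OF that assms(3,2,1)] .
qed

lemma limitin_beta_ext:
  assumes "compact_space K" "Hausdorff_space K" "ultra p" "\<forall>\<^sub>F s in p. f s \<in> topspace K"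
  shows "limitin K f (beta_ext K f p) p"
proof -
  obtain z where z: "limitin K f z p" using ultra_limit_exists[OF assms(1,3,4)] by blast
  moreover have "beta_ext K f p = z"
    using assms(3) by (intro beta_ext_eqI[OF assms(2) _ z]) (simp add: ultra_def)
  ultimately show ?thesis by simp
qed

text \<open>One setting for T acting on X and for the full product group acting on cubes. The face
  and Host-Kra groups enter as sets A of group elements, through
  \<open>ultrafilters A\<close>.\<close>

locale compact_action = group S for S (structure) +
  fixes Z :: "'z topology" and act :: "'a \<Rightarrow> 'z \<Rightarrow> 'z"
  assumes Z_compact: "compact_space Z" and Z_Hausdorff: "Hausdorff_space Z"
    and act_continuous: "s \<in> carrier S \<Longrightarrow> continuous_map Z Z (act s)"
    and act_mult: "s \<in> carrier S \<Longrightarrow> t \<in> carrier S \<Longrightarrow> z \<in> topspace Z \<Longrightarrow>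
      act (s \<otimes> t) z = act s (act t z)"
    and act_one: "z \<in> topspace Z \<Longrightarrow> act \<one> z = z"
begin

lemma act_closed: "s \<in> carrier S \<Longrightarrow> z \<in> topspace Z \<Longrightarrow> act s z \<in> topspace Z"
  using act_continuous by (auto simp: continuous_map_def)

lemma openin_act_vimage:
  "s \<in> carrier S \<Longrightarrow> openin Z W \<Longrightarrow> openin Z {z \<in> topspace Z. act s z \<in> W}"
  using openin_continuous_map_preimage[OF act_continuous] by simp

lemma act_inv:
  assumes "s \<in> carrier S" "z \<in> topspace Z"
  shows "act (inv s) (act s z) = z" "act s (act (inv s) z) = z"
  using assms act_mult[of "inv s" s z] act_mult[of s "inv s" z] act_one[of z]
  by (metis inv_closed l_inv, metis inv_closed r_inv)

lemma limitin_beta_act: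
  assumes "p \<in> ultrafilters (carrier S)" "z \<in> topspace Z"
  shows "limitin Z (\<lambda>s. act s z) (beta_act Z act p z) p"
  unfolding beta_act_def
proof (rule limitin_beta_ext[OF Z_compact Z_Hausdorff])
  show "ultra p" using assms by (simp add: ultrafilters_iff)
  show "\<forall>\<^sub>F s in p. act s z \<in> topspace Z"
    using eventually_in_ultrafilter[OF assms(1)]
    by (rule eventually_mono) (use assms in \<open>simp add: act_closed\<close>)
qed

lemma beta_act_closed [simp]:
  "p \<in> ultrafilters (carrier S) \<Longrightarrow> z \<in> topspace Z \<Longrightarrow> beta_act Z act p z \<in> topspace Z"
  by (rule limitin_topspace[OF limitin_beta_act])

lemma beta_act_eqI:
  assumes "p \<in> ultrafilters (carrier S)" "limitin Z (\<lambda>s. act s z) y p"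
  shows "beta_act Z act p z = y"
  unfolding beta_act_def
  using assms Z_Hausdorff by (intro beta_ext_eqI) (auto simp: ultrafilters_def)

lemma eventually_beta_act:
  assumes "p \<in> ultrafilters (carrier S)" "z \<in> topspace Z" "openin Z W" "beta_act Z act p z \<in> W"
  shows "\<forall>\<^sub>F s in p. act s z \<in> W"
  using limitin_beta_act[OF assms(1,2)] assms(3,4) by (simp add: limitin_def)

lemma beta_act_mult:
  assumes p: "p \<in> ultrafilters (carrier S)" and q: "q \<in> ultrafilters (carrier S)"
    and z: "z \<in> topspace Z"
  shows "beta_act Z act (beta_mult S p q) z = beta_act Z act p (beta_act Z act q z)"
proof (rule beta_act_eqI)
  show "beta_mult S p q \<in> ultrafilters (carrier S)" using p q by (rule beta_closed)
  show "limitin Z (\<lambda>s. act s z) (beta_act Z act p (beta_act Z act q z)) (beta_mult S p q)"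
    unfolding limitin_def eventually_beta_mult
  proof (intro conjI allI impI)
    fix W assume W: "openin Z W \<and> beta_act Z act p (beta_act Z act q z) \<in> W"
    have "\<forall>\<^sub>F s in p. act s (beta_act Z act q z) \<in> W"
      using p q z W by (intro eventually_beta_act) auto
    then show "\<forall>\<^sub>F s in p. \<forall>\<^sub>F t in q. act (s \<otimes> t) z \<in> W"
      using eventually_in_ultrafilter[OF p]
    proof eventually_elim
      case (elim s)
      have "\<forall>\<^sub>F t in q. act t z \<in> {z \<in> topspace Z. act s z \<in> W}"
        using q z W elim by (intro eventually_beta_act openin_act_vimage) auto
      then show ?case
        using eventually_in_ultrafilter[OF q]
        by eventually_elim (use elim z in \<open>auto simp: act_mult\<close>)
    qed
  next
    show "beta_act Z act p (beta_act Z act q z) \<in> topspace Z" using p q z by simp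
  qed
qed

lemma beta_act_principal:
  assumes "s \<in> carrier S" "z \<in> topspace Z"
  shows "beta_act Z act (principal {s}) z = act s z"
proof (rule beta_act_eqI)
  show "limitin Z (\<lambda>s. act s z) (act s z) (principal {s})"
    unfolding limitin_def eventually_principal using act_closed[OF assms] by simp
qed (use assms in simp)

lemma beta_act_in_closed:
  assumes p: "p \<in> ultrafilters A" and A: "A \<subseteq> carrier S" and z: "z \<in> topspace Z"
    and C: "closedin Z C" "\<And>s. s \<in> A \<Longrightarrow> act s z \<in> C"
  shows "beta_act Z act p z \<in> C"
proof (rule limitin_closedin[OF _ C(1)])
  show "limitin Z (\<lambda>s. act s z) (beta_act Z act p z) p"
    using p A z by (intro limitin_beta_act) (rule ultrafilters_mono)
  show "\<forall>\<^sub>F s in p. act s z \<in> C"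
    using eventually_in_ultrafilter[OF p] by (rule eventually_mono) (rule C(2))
  show "p \<noteq> bot" using p by (simp add: ultrafilters_def)
qed

text \<open>The elements of A that bring z near y generate a proper filter, and any ultrafilter
  below it carries z to y. Closures of orbits thus become orbits of the extended action.\<close>

lemma closure_of_orbit_imp_beta_act:
  assumes A: "A \<subseteq> carrier S" and y: "y \<in> Z closure_of ((\<lambda>s. act s z) ` A)"
  obtains p where "p \<in> ultrafilters A" "beta_act Z act p z = y"
proof -
  let ?D = "\<lambda>W. {s \<in> A. act s z \<in> W}"
  have yZ: "y \<in> topspace Z" by (rule subsetD[OF closure_of_subset_topspace y])
  have "nbhd_pull Z y ?D \<noteq> bot"
  proof (rule nbhd_pull_not_bot[OF yZ])
    show "?D W \<noteq> {}" if W: "openin Z W" "y \<in> W" for W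
    proof -
      obtain w where "w \<in> (\<lambda>s. act s z) ` A" "w \<in> W"
        using y[unfolded in_closure_of, THEN conjunct2, rule_format, OF conjI[OF W(2,1)]] by auto
      then show ?thesis by blast
    qed
  qed blast
  then obtain p where p: "ultra p" "p \<le> nbhd_pull Z y ?D" by (rule ultra_exists)
  then have ev: "\<forall>\<^sub>F s in p. s \<in> ?D W" if "openin Z W" "y \<in> W" for W
    using that by (simp add: le_nbhd_pull)
  have "\<forall>\<^sub>F s in p. s \<in> A"
    using ev[OF openin_topspace yZ] by (rule eventually_mono) simp
  then have pA: "p \<in> ultrafilters A" using p(1) by (simp add: ultrafilters_iff le_principal)
  moreover have "beta_act Z act p z = y"
  proof (rule beta_act_eqI)
    show "p \<in> ultrafilters (carrier S)" using pA A by (rule ultrafilters_mono)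
    show "limitin Z (\<lambda>s. act s z) y p"
      unfolding limitin_def
    proof (intro conjI allI impI yZ)
      fix W assume "openin Z W \<and> y \<in> W"
      then have "\<forall>\<^sub>F s in p. s \<in> ?D W" by (intro ev) auto
      then show "\<forall>\<^sub>F s in p. act s z \<in> W" by eventually_elim simp
    qed
  qed
  ultimately show ?thesis by (rule that)
qed

text \<open>Fix a in M. The products p a that fix z form a closed semigroup, nonempty because the
  orbit of a z accumulates at z. An idempotent in it lies in M.\<close>

lemma idempotent_fixing:
  assumes M: "minimal_left_ideal (beta S) M" and z: "z \<in> topspace Z"
    and dense: "\<And>y. y \<in> topspace Z \<Longrightarrow> z \<in> Z closure_of ((\<lambda>s. act s y) ` carrier S)"
  obtains u where "u \<in> M" "beta_mult S u u = u" "beta_act Z act u z = z"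
proof -
  interpret minimal_ideal S M using M by (intro minimal_ideal.intro minimal_ideal_axioms.intro is_monoid)
  obtain a where a: "a \<in> M" using ideal_nonempty by blast
  then have a': "a \<in> ultrafilters (carrier S)" using ideal_subset by blast
  let ?top = "principal (carrier S)"
  let ?\<eta> = "nbhd_pull Z z (\<lambda>W. {s \<in> carrier S. act s z \<in> W})"
  \<comment> \<open>The intersection of two closed sets: the products p a, and the ultrafilters
    fixing z.\<close>
  define \<psi> where "\<psi> = inf (beta_mult S ?top a) ?\<eta>"
  have \<eta>_iff: "p \<le> ?\<eta> \<longleftrightarrow> beta_act Z act p z = z" if "p \<in> ultrafilters (carrier S)" for p
  proof
    assume "p \<le> ?\<eta>"
    then have "limitin Z (\<lambda>s. act s z) z p"
      unfolding limitin_def le_nbhd_pull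
    proof (intro conjI allI impI z)
      fix W assume W: "openin Z W \<and> z \<in> W"
      assume "\<forall>W. openin Z W \<longrightarrow> z \<in> W \<longrightarrow> (\<forall>\<^sub>F s in p. s \<in> {s \<in> carrier S. act s z \<in> W})"
      with W have "\<forall>\<^sub>F s in p. s \<in> {s \<in> carrier S. act s z \<in> W}" by blast
      then show "\<forall>\<^sub>F s in p. act s z \<in> W" by eventually_elim simp
    qed
    then show "beta_act Z act p z = z" by (rule beta_act_eqI[OF that])
  next
    assume "beta_act Z act p z = z"
    then show "p \<le> ?\<eta>"
      unfolding le_nbhd_pull
      using eventually_beta_act[OF that z] eventually_in_ultrafilter[OF that]
      by (auto simp: eventually_conj_iff)
  qed
  have car: "\<psi> \<le> ?top"
  proof -
    have "beta_mult S ?top a \<le> ?top"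
      using a' by (intro beta_mult_le_principal) (auto simp: ultrafilters_iff)
    then show ?thesis by (simp add: \<psi>_def le_infI1)
  qed
  obtain p where p: "p \<in> ultrafilters (carrier S)" "beta_act Z act p (beta_act Z act a z) = z"
    using closure_of_orbit_imp_beta_act[OF order_refl dense[OF beta_act_closed[OF a' z]]] .
  have "beta_mult S p a \<le> \<psi>"
    unfolding \<psi>_def
  proof (rule inf_greatest)
    show "beta_mult S p a \<le> beta_mult S ?top a"
      using p by (intro beta_mult_mono) (auto simp: ultrafilters_iff)
    show "beta_mult S p a \<le> ?\<eta>"
      using p a' z by (simp add: \<eta>_iff beta_closed beta_act_mult)
  qed
  then have "\<psi> \<noteq> bot"
    using beta_mult_ultra[of p a S] p(1) a' by (auto simp: ultrafilters_iff ultra_def bot_unique)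
  moreover have "beta_mult S \<psi> \<psi> \<le> \<psi>"
    unfolding \<psi>_def
  proof (rule inf_greatest; fold \<psi>_def)
    have "beta_mult S \<psi> \<psi> \<le> beta_mult S ?top (beta_mult S ?top a)"
      using car by (intro beta_mult_mono) (auto simp: \<psi>_def)
    also have "\<dots> = beta_mult S (beta_mult S ?top ?top) a"
      using a' by (simp add: beta_mult_assoc ultrafilters_iff)
    also have "\<dots> \<le> beta_mult S ?top a"
      by (intro beta_mult_mono beta_mult_le_principal) auto
    finally show "beta_mult S \<psi> \<psi> \<le> beta_mult S ?top a" .
    have le: "\<psi> \<le> ?\<eta>" by (simp add: \<psi>_def)
    \<comment> \<open>If s z lies in W, the preimage of W under s is a neighbourhood of z; t z
      enters it along \<open>\<psi>\<close>, and then s (t z) lies in W.\<close>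
    show "beta_mult S \<psi> \<psi> \<le> ?\<eta>"
      unfolding le_nbhd_pull eventually_beta_mult
    proof (intro allI impI)
      fix W assume W: "openin Z W" "z \<in> W"
      then have "\<forall>\<^sub>F s in \<psi>. s \<in> {s \<in> carrier S. act s z \<in> W}"
        using le unfolding le_nbhd_pull by blast
      then show "\<forall>\<^sub>F s in \<psi>. \<forall>\<^sub>F t in \<psi>. s \<otimes> t \<in> {s \<in> carrier S. act s z \<in> W}"
      proof eventually_elim
        case (elim s)
        then have "\<forall>\<^sub>F t in \<psi>. t \<in> {t \<in> carrier S. act t z \<in> {z \<in> topspace Z. act s z \<in> W}}"
          using le W z unfolding le_nbhd_pull by (auto intro: openin_act_vimage)
        then show ?case
          by eventually_elim (use elim z in \<open>auto simp: act_mult\<close>)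
      qed
    qed
  qed
  ultimately obtain u where u: "ultra u" "u \<le> \<psi>" "beta_mult S u u = u"
    using Ellis_Numakura[OF _ car] by blast
  have u': "u \<in> ultrafilters (carrier S)" using u car by (auto simp: ultrafilters_iff)
  have "u \<le> beta_mult S ?top a" using u(2) by (simp add: \<psi>_def)
  then obtain b where "ultra b" "b \<le> ?top" "beta_mult S b a = u"
    using beta_mult_factor[OF u(1) _ ultraD[OF a']] by blast
  then have "u \<in> M" using a by (auto simp: ultrafilters_iff intro: ideal_closed)
  moreover have "beta_act Z act u z = z"
    using u(2) u' by (simp add: \<eta>_iff \<psi>_def)
  ultimately show ?thesis using u(3) that by blast
qed

end

section \<open>Host-Kra and face groups\<close>

definition cube_dup :: "nat \<Rightarrow> (nat set \<Rightarrow> 'a) \<Rightarrow> nat set \<Rightarrow> 'a" where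
  "cube_dup n h = (\<lambda>\<epsilon>\<in>cube (Suc n). h (\<epsilon> - {Suc n}))"

text \<open>Reflection of the cube in the directions belonging to \<open>\<eta>\<close>. It
  exchanges {} and \<open>\<eta>\<close>, which brings an arbitrary vertex to the distinguished
  corner.\<close>

definition cube_refl :: "nat \<Rightarrow> nat set \<Rightarrow> (nat set \<Rightarrow> 'a) \<Rightarrow> nat set \<Rightarrow> 'a" where
  "cube_refl n \<eta> h = (\<lambda>\<epsilon>\<in>cube n. h ((\<epsilon> - \<eta>) \<union> (\<eta> - \<epsilon>)))"

lemma finite_cube [simp]: "finite (cube n)" and finite_vertex: "\<epsilon> \<in> cube n \<Longrightarrow> finite \<epsilon>"
  by (auto simp: cube_def intro: finite_subset)

lemma cube_empty [simp]: "{} \<in> cube n"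
  by (simp add: cube_def)

lemma vertex_bounds: "\<epsilon> \<in> cube n \<Longrightarrow> i \<in> \<epsilon> \<Longrightarrow> i \<in> {1..n}"
  by (auto simp: cube_def)

lemma vertex_Pi: "\<epsilon> \<in> cube n \<Longrightarrow> g \<in> {1..n} \<rightarrow> A \<Longrightarrow> g \<in> \<epsilon> \<rightarrow> A"
  by (auto simp: cube_def Pi_iff)

lemma cube_Suc_lower: "\<epsilon> \<in> cube n \<Longrightarrow> \<epsilon> \<in> cube (Suc n)"
  by (auto simp: cube_def)

lemma cube_Suc_notin: "\<epsilon> \<in> cube n \<Longrightarrow> Suc n \<notin> \<epsilon>"
  by (auto simp: cube_def)

lemma cube_Suc_Diff: "\<epsilon> \<in> cube (Suc n) \<Longrightarrow> \<epsilon> - {Suc n} \<in> cube n"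
  by (auto simp: cube_def atLeastAtMostSuc_conv)

lemma cube_symdiff: "\<epsilon> \<in> cube n \<Longrightarrow> \<eta> \<in> cube n \<Longrightarrow> (\<epsilon> - \<eta>) \<union> (\<eta> - \<epsilon>) \<in> cube n"
  by (auto simp: cube_def)

context group
begin

lemma group_cube_group [simp]: "group (cube_group n G)"
  by (rule product_group) (rule is_group)

lemma face_element_carrier:
  "t \<in> carrier G \<Longrightarrow> face_element n G t \<alpha> \<in> carrier (cube_group n G)"
  by (auto simp: face_element_def)

lemma inv_face_element:
  assumes "t \<in> carrier G"
  shows "inv\<^bsub>cube_group n G\<^esub> (face_element n G t \<alpha>) = face_element n G (inv t) \<alpha>"
proof -
  have "inv\<^bsub>cube_group n G\<^esub> (face_element n G t \<alpha>) = (\<lambda>\<epsilon>\<in>cube n. inv (face_element n G t \<alpha> \<epsilon>))"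
    using face_element_carrier[OF assms, of n \<alpha>] by (intro inv_product_group) (auto simp: is_group)
  then show ?thesis by (auto simp: face_element_def)
qed

lemma subgroup_Face: "subgroup (carrier (Face n G)) (cube_group n G)"
  unfolding Face_def carrier_subgroup_generated
  by (intro group.generate_is_subgroup) auto

lemma subgroup_HK: "subgroup (carrier (HK n G)) (cube_group n G)"
  unfolding HK_def carrier_subgroup_generated
  by (intro group.generate_is_subgroup) auto

end

context comm_group
begin

abbreviation cube_mult :: "(nat set \<Rightarrow> 'a) \<Rightarrow> nat \<Rightarrow> (nat set \<Rightarrow> 'a) \<Rightarrow> nat set \<Rightarrow> 'a"
    ("(_ \<star>\<^bsub>_\<^esub>/ _)" [70, 0, 71] 70) where
  "f \<star>\<^bsub>n\<^esub> g \<equiv> f \<otimes>\<^bsub>cube_group n G\<^esub> g"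

text \<open>Coordinates on the face group: as the group is abelian, an element is given by one g i
  per direction i, and its value at a vertex collects the upper facets containing that
  vertex.\<close>

definition face_elt :: "nat \<Rightarrow> (nat \<Rightarrow> 'a) \<Rightarrow> nat set \<Rightarrow> 'a" where
  "face_elt n g = (\<lambda>\<epsilon>\<in>cube n. finprod G g \<epsilon>)"

lemma finprod_vertex_closed:
  "\<epsilon> \<in> cube n \<Longrightarrow> g \<in> {1..n} \<rightarrow> carrier G \<Longrightarrow> finprod G g \<epsilon> \<in> carrier G"
  by (rule finprod_closed) (rule vertex_Pi)

lemma finprod_single:
  assumes "\<epsilon> \<in> cube n" "t \<in> carrier G"
  shows "finprod G (\<lambda>j. if j = i then t else \<one>) \<epsilon> = (if i \<in> \<epsilon> then t else \<one>)"
proof (cases "i \<in> \<epsilon>")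
  case True
  have "finprod G (\<lambda>j. if i = j then t else \<one>) \<epsilon> = t"
    using finprod_singleton[OF True finite_vertex[OF assms(1)], of "\<lambda>_. t"] assms(2) by simp
  then show ?thesis using True by (simp add: eq_commute cong: if_cong)
next
  case False
  then show ?thesis by (auto intro!: finprod_one_eqI)
qed

lemma finprod_vertex_mult:
  assumes "\<epsilon> \<in> cube n" "g \<in> {1..n} \<rightarrow> carrier G" "g' \<in> {1..n} \<rightarrow> carrier G"
  shows "finprod G (\<lambda>i. g i \<otimes> g' i) \<epsilon> = finprod G g \<epsilon> \<otimes> finprod G g' \<epsilon>"
  by (rule finprod_multf; rule vertex_Pi[OF assms(1)]; rule assms)

lemma upper_facet_iff: "upper_facet n \<alpha> \<longleftrightarrow> (\<exists>i\<in>{1..n}. \<alpha> = {\<epsilon> \<in> cube n. i \<in> \<epsilon>})"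
  unfolding upper_facet_def facet_def by (auto simp: cube_def)

lemma face_element_eq_face_elt:
  assumes "t \<in> carrier G"
  shows "face_element n G t {\<epsilon> \<in> cube n. i \<in> \<epsilon>} = face_elt n (\<lambda>j. if j = i then t else \<one>)"
  unfolding face_element_def face_elt_def
  by (rule restrict_ext) (simp add: finprod_single assms)

lemma face_elt_mult:
  assumes "g \<in> {1..n} \<rightarrow> carrier G" "g' \<in> {1..n} \<rightarrow> carrier G"
  shows "face_elt n g \<star>\<^bsub>n\<^esub> face_elt n g' = face_elt n (\<lambda>i. g i \<otimes> g' i)"
  unfolding face_elt_def mult_product_group
  by (rule restrict_ext) (simp only: finprod_vertex_mult[OF _ assms] restrict_apply')

lemma face_elt_in_Face:
  assumes "g \<in> {1..n} \<rightarrow> carrier G"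
  shows "face_elt n g \<in> carrier (Face n G)"
proof -
  let ?S = "{face_element n G t \<alpha> |t \<alpha>. t \<in> carrier G \<and> upper_facet n \<alpha>}"
  \<comment> \<open>The directions are switched on one at a time, each by a generator.\<close>
  have "face_elt n (\<lambda>i. if i \<le> k then g i else \<one>) \<in> carrier (Face n G)" if "k \<le> n" for k
    using that
  proof (induction k)
    case 0
    have "face_elt n (\<lambda>i. if i \<le> 0 then g i else \<one>) = \<one>\<^bsub>cube_group n G\<^esub>"
      unfolding face_elt_def one_product_group
      by (rule restrict_ext, rule finprod_one_eqI) (auto dest: vertex_bounds)
    then show ?case
      by (simp only: Face_def carrier_subgroup_generated generate.one)
  next
    case (Suc k)
    have gk: "g (Suc k) \<in> carrier G" using assms Suc by (auto simp: Pi_iff)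
    let ?h = "\<lambda>j. if j = Suc k then g (Suc k) else \<one>"
    have "face_elt n (\<lambda>i. if i \<le> Suc k then g i else \<one>)
        = face_elt n (\<lambda>i. (if i \<le> k then g i else \<one>) \<otimes> ?h i)"
      unfolding face_elt_def
    proof (rule restrict_ext, rule finprod_cong)
      fix \<epsilon> assume e: "\<epsilon> \<in> cube n"
      show "((\<lambda>i. if i \<le> Suc k then g i else \<one>) \<in> \<epsilon> \<rightarrow> carrier G) = True"
        using assms vertex_bounds[OF e] by (auto simp: Pi_iff)
      show "i \<in> \<epsilon> =simp=> (if i \<le> Suc k then g i else \<one>) = (if i \<le> k then g i else \<one>) \<otimes> ?h i" for i
        using assms vertex_bounds[OF e] gk by (auto simp: Pi_iff simp_implies_def le_Suc_eq)
    qed simp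
    also have "\<dots> = face_elt n (\<lambda>i. if i \<le> k then g i else \<one>) \<star>\<^bsub>n\<^esub> face_elt n ?h"
      using assms gk by (intro face_elt_mult[symmetric]) (auto simp: Pi_iff)
    also have "face_elt n ?h = face_element n G (g (Suc k)) {\<epsilon> \<in> cube n. Suc k \<in> \<epsilon>}"
      by (rule face_element_eq_face_elt[OF gk, symmetric])
    finally have eq: "face_elt n (\<lambda>i. if i \<le> Suc k then g i else \<one>) =
        face_elt n (\<lambda>i. if i \<le> k then g i else \<one>)
          \<star>\<^bsub>n\<^esub> face_element n G (g (Suc k)) {\<epsilon> \<in> cube n. Suc k \<in> \<epsilon>}" .
    have "face_element n G (g (Suc k)) {\<epsilon> \<in> cube n. Suc k \<in> \<epsilon>} \<in> carrier (cube_group n G) \<inter> ?S"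
    proof (intro IntI face_element_carrier gk)
      have "upper_facet n {\<epsilon> \<in> cube n. Suc k \<in> \<epsilon>}"
        using Suc.prems by (auto simp: upper_facet_iff)
      then show "face_element n G (g (Suc k)) {\<epsilon> \<in> cube n. Suc k \<in> \<epsilon>} \<in> ?S" using gk by blast
    qed
    then show ?case
      unfolding eq using Suc
      unfolding Face_def carrier_subgroup_generated
      by (intro generate.eng) (auto intro: generate.incl)
  qed
  from this[of n] have "face_elt n (\<lambda>i. if i \<le> n then g i else \<one>) \<in> carrier (Face n G)" by simp
  moreover have "face_elt n (\<lambda>i. if i \<le> n then g i else \<one>) = face_elt n g"
    unfolding face_elt_def using assms
    by (intro restrict_ext finprod_cong) (auto simp: Pi_iff simp_implies_def dest: vertex_bounds)
  ultimately show ?thesis by simp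
qed

lemma carrier_Face: "carrier (Face n G) = face_elt n ` ({1..n} \<rightarrow> carrier G)"
proof
  show "face_elt n ` ({1..n} \<rightarrow> carrier G) \<subseteq> carrier (Face n G)"
    using face_elt_in_Face by blast
  have single: "face_element n G t \<alpha> \<in> face_elt n ` ({1..n} \<rightarrow> carrier G)"
    if "t \<in> carrier G" "upper_facet n \<alpha>" for t \<alpha>
    using that by (auto simp: upper_facet_iff face_element_eq_face_elt)
  show "carrier (Face n G) \<subseteq> face_elt n ` ({1..n} \<rightarrow> carrier G)"
  proof
    fix h assume "h \<in> carrier (Face n G)"
    then show "h \<in> face_elt n ` ({1..n} \<rightarrow> carrier G)"
      unfolding Face_def carrier_subgroup_generated
    proof (induction rule: generate.induct)
      case one
      have "\<one>\<^bsub>cube_group n G\<^esub> = face_elt n (\<lambda>_. \<one>)"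
        unfolding face_elt_def one_product_group by (rule restrict_ext) simp
      then show ?case by auto
    next
      case (incl h)
      then show ?case using single by auto
    next
      case (inv h)
      then obtain t \<alpha> where "t \<in> carrier G" "upper_facet n \<alpha>" "h = face_element n G t \<alpha>" by auto
      then show ?case using single[of "inv t" \<alpha>] by (simp only: inv_face_element inv_closed)
    next
      case (eng h1 h2)
      then obtain g1 g2 where "g1 \<in> {1..n} \<rightarrow> carrier G" "h1 = face_elt n g1"
          "g2 \<in> {1..n} \<rightarrow> carrier G" "h2 = face_elt n g2" by blast
      then show ?case by (auto simp: face_elt_mult Pi_iff simp del: mult_product_group)
    qed
  qed
qed

lemma Face_subset_HK: "carrier (Face n G) \<subseteq> carrier (HK n G)"
  unfolding Face_def HK_def carrier_subgroup_generated
  by (rule group.mono_generate[OF group_cube_group]) (auto simp: upper_facet_def)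

lemma face_element_in_HK:
  "t \<in> carrier G \<Longrightarrow> facet n \<alpha> \<Longrightarrow> face_element n G t \<alpha> \<in> carrier (HK n G)"
  unfolding HK_def carrier_subgroup_generated
  by (intro generate.incl) (auto simp: face_element_def)

lemma cube_diag_in_HK:
  assumes "n \<ge> 1" "t \<in> carrier G"
  shows "cube_diag n t \<in> carrier (HK n G)"
proof -
  let ?\<alpha> = "{\<epsilon> \<in> cube n. 1 \<in> \<epsilon>}" and ?\<beta> = "{\<epsilon> \<in> cube n. 1 \<notin> \<epsilon>}"
  have "facet n ?\<alpha>" "facet n ?\<beta>" using assms(1) by (auto simp: facet_def)
  then have "face_element n G t ?\<alpha> \<star>\<^bsub>n\<^esub> face_element n G t ?\<beta> \<in> carrier (HK n G)"
    using assms(2) by (intro subgroup.m_closed[OF subgroup_HK] face_element_in_HK)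
  moreover have "face_element n G t ?\<alpha> \<star>\<^bsub>n\<^esub> face_element n G t ?\<beta> = cube_diag n t"
    unfolding face_element_def cube_diag_def mult_product_group
    by (rule restrict_ext) (use assms(2) in auto)
  ultimately show ?thesis by simp
qed

lemma cube_diag_carrier [simp]: "t \<in> carrier G \<Longrightarrow> cube_diag n t \<in> carrier (cube_group n G)"
  by (auto simp: cube_diag_def)

lemma cube_diag_mult:
  "cube_diag n s \<star>\<^bsub>n\<^esub> cube_diag n t = cube_diag n (s \<otimes> t)"
  unfolding cube_diag_def mult_product_group by (rule restrict_ext) simp

lemma cube_diag_commute:
  assumes "t \<in> carrier G" "h \<in> carrier (cube_group n G)"
  shows "cube_diag n t \<star>\<^bsub>n\<^esub> h = h \<star>\<^bsub>n\<^esub> cube_diag n t"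
  unfolding cube_diag_def mult_product_group
  by (rule restrict_ext) (use assms in \<open>auto intro: m_comm\<close>)

text \<open>A lower facet element with value t is the diagonal element of t times the upper facet
  element with the inverse of t. Diagonal elements are central, so they can be collected on the
  right.\<close>

lemma HK_decompose:
  assumes "n \<ge> 1" "h \<in> carrier (HK n G)"
  obtains a f where "a \<in> carrier G" "f \<in> carrier (Face n G)"
    "h = f \<star>\<^bsub>n\<^esub> cube_diag n a"
proof -
  interpret K: group "cube_group n G" by simp
  note F = subgroup.mem_carrier[OF subgroup_Face]
  let ?P = "\<lambda>h. \<exists>a\<in>carrier G. \<exists>f\<in>carrier (Face n G). h = f \<star>\<^bsub>n\<^esub> cube_diag n a"
  have single: "?P (face_element n G t \<alpha>)" if t: "t \<in> carrier G" and "facet n \<alpha>" for t \<alpha>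
  proof -
    obtain i where i: "i \<in> {1..n}" and "\<alpha> = {\<epsilon> \<in> cube n. i \<in> \<epsilon>} \<or> \<alpha> = {\<epsilon> \<in> cube n. i \<notin> \<epsilon>}"
      using \<open>facet n \<alpha>\<close> by (auto simp: facet_def)
    then consider "\<alpha> = {\<epsilon> \<in> cube n. i \<in> \<epsilon>}" | "\<alpha> = {\<epsilon> \<in> cube n. i \<notin> \<epsilon>}" by blast
    then show ?thesis
    proof cases
      case 1
      have "face_element n G t \<alpha> = face_element n G t \<alpha> \<star>\<^bsub>n\<^esub> cube_diag n \<one>"
        unfolding face_element_def cube_diag_def mult_product_group
        by (rule restrict_ext) (use t in auto)
      moreover have "face_element n G t \<alpha> \<in> carrier (Face n G)"
        using i t by (simp add: 1 face_element_eq_face_elt face_elt_in_Face)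
      ultimately show ?thesis by blast
    next
      case 2
      let ?\<beta> = "{\<epsilon> \<in> cube n. i \<in> \<epsilon>}"
      have "face_element n G t \<alpha> = face_element n G (inv t) ?\<beta> \<star>\<^bsub>n\<^esub> cube_diag n t"
        unfolding face_element_def cube_diag_def mult_product_group 2
        by (rule restrict_ext) (use t in auto)
      moreover have "face_element n G (inv t) ?\<beta> \<in> carrier (Face n G)"
        using i t by (simp add: face_element_eq_face_elt face_elt_in_Face)
      ultimately show ?thesis using t by blast
    qed
  qed
  have "?P h"
    using assms(2) unfolding HK_def carrier_subgroup_generated
  proof (induction rule: generate.induct)
    case one
    have "\<one>\<^bsub>cube_group n G\<^esub> = \<one>\<^bsub>cube_group n G\<^esub> \<star>\<^bsub>n\<^esub> cube_diag n \<one>"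
      unfolding cube_diag_def mult_product_group one_product_group by (rule restrict_ext) simp
    then show ?case using subgroup.one_closed[OF subgroup_Face] by blast
  next
    case (incl h)
    then obtain t \<alpha> where t: "t \<in> carrier G" "facet n \<alpha>" and h: "h = face_element n G t \<alpha>" by auto
    show ?case unfolding h using t by (rule single)
  next
    case (inv h)
    then obtain t \<alpha> where "t \<in> carrier G" "facet n \<alpha>" "h = face_element n G t \<alpha>" by auto
    then show ?case using single[of "inv t" \<alpha>] by (simp only: inv_face_element inv_closed)
  next
    case (eng h1 h2)
    then obtain a1 f1 a2 f2 where 1: "a1 \<in> carrier G" "f1 \<in> carrier (Face n G)"
        "h1 = f1 \<star>\<^bsub>n\<^esub> cube_diag n a1"
      and 2: "a2 \<in> carrier G" "f2 \<in> carrier (Face n G)"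
        "h2 = f2 \<star>\<^bsub>n\<^esub> cube_diag n a2" by blast
    have "h1 \<star>\<^bsub>n\<^esub> h2
        = f1 \<star>\<^bsub>n\<^esub> ((cube_diag n a1 \<star>\<^bsub>n\<^esub> f2) \<star>\<^bsub>n\<^esub> cube_diag n a2)"
      using 1(1,2) 2(1,2) unfolding 1(3) 2(3)
      by (simp only: K.m_assoc K.m_closed F cube_diag_carrier)
    also have "\<dots> = (f1 \<star>\<^bsub>n\<^esub> f2) \<star>\<^bsub>n\<^esub> (cube_diag n a1 \<star>\<^bsub>n\<^esub> cube_diag n a2)"
      using 1(1,2) 2(1,2)
      by (simp only: cube_diag_commute[OF 1(1) F[OF 2(2)]] K.m_assoc K.m_closed F cube_diag_carrier)
    also have "\<dots> = (f1 \<star>\<^bsub>n\<^esub> f2) \<star>\<^bsub>n\<^esub> cube_diag n (a1 \<otimes> a2)"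
      by (simp only: cube_diag_mult)
    finally show ?case
      using 1(1,2) 2(1,2) subgroup.m_closed[OF subgroup_Face] by blast
  qed
  then show ?thesis using that by blast
qed

lemma Face_empty [simp]: "f \<in> carrier (Face n G) \<Longrightarrow> f {} = \<one>"
  by (auto simp: carrier_Face face_elt_def)

text \<open>The same g works, with trivial value in the new direction.\<close>

lemma Face_dup:
  assumes "f \<in> carrier (Face n G)"
  shows "cube_dup n f \<in> carrier (Face (Suc n) G)"
proof -
  obtain g where g: "g \<in> {1..n} \<rightarrow> carrier G" "f = face_elt n g"
    using assms by (auto simp: carrier_Face)
  have g': "g(Suc n := \<one>) \<in> {1..Suc n} \<rightarrow> carrier G" using g(1) by (auto simp: Pi_iff)
  have "cube_dup n f = face_elt (Suc n) (g(Suc n := \<one>))"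
    unfolding cube_dup_def face_elt_def
  proof (rule restrict_ext)
    fix \<epsilon> assume e: "\<epsilon> \<in> cube (Suc n)"
    have fin: "finite \<epsilon>" using e by (rule finite_vertex)
    have cl: "g(Suc n := \<one>) \<in> \<epsilon> \<rightarrow> carrier G" by (rule vertex_Pi[OF e g'])
    have "finprod G (g(Suc n := \<one>)) \<epsilon> = finprod G (g(Suc n := \<one>)) (\<epsilon> - {Suc n})"
      using fin cl by (intro finprod_mono_neutral_cong_right) auto
    also have "\<dots> = finprod G g (\<epsilon> - {Suc n})"
    proof (rule finprod_cong')
      show "g \<in> \<epsilon> - {Suc n} \<rightarrow> carrier G"
      proof
        fix i assume "i \<in> \<epsilon> - {Suc n}"
        then show "g i \<in> carrier G" using funcset_mem[OF cl, of i] by simp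
      qed
    qed auto
    finally show "f (\<epsilon> - {Suc n}) = finprod G (g(Suc n := \<one>)) \<epsilon>"
      using cube_Suc_Diff[OF e] by (simp add: g(2) face_elt_def)
  qed
  then show ?thesis using g' by (simp add: face_elt_in_Face)
qed

lemma Face_restrict:
  assumes "f \<in> carrier (Face (Suc n) G)"
  shows "restrict f (cube n) \<in> carrier (Face n G)"
proof -
  obtain g where g: "g \<in> {1..Suc n} \<rightarrow> carrier G" "f = face_elt (Suc n) g"
    using assms by (auto simp: carrier_Face)
  have "restrict f (cube n) = face_elt n g"
    unfolding face_elt_def g(2) by (rule restrict_ext) (simp add: cube_Suc_lower del: cube_empty)
  moreover have "g \<in> {1..n} \<rightarrow> carrier G"
    using g(1) by (rule subsetD[OF Pi_anti_mono, rotated]) simp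
  ultimately show ?thesis by (simp add: face_elt_in_Face)
qed

lemma face_element_top_in_Face:
  "t \<in> carrier G \<Longrightarrow> face_element (Suc n) G t {\<epsilon> \<in> cube (Suc n). Suc n \<in> \<epsilon>} \<in> carrier (Face (Suc n) G)"
  by (simp add: face_element_eq_face_elt face_elt_in_Face)

text \<open>The value of g in direction n + 1 acts on the upper facet only. This presents f a^[n+1]
  as two n-cubes with a common face element and base points a and t a.\<close>

lemma Face_Suc_decompose:
  assumes "f \<in> carrier (Face (Suc n) G)"
  obtains t where "t \<in> carrier G" "f = cube_dup n (restrict f (cube n)) \<star>\<^bsub>Suc n\<^esub>
    face_element (Suc n) G t {\<epsilon> \<in> cube (Suc n). Suc n \<in> \<epsilon>}"
proof -
  obtain g where g: "g \<in> {1..Suc n} \<rightarrow> carrier G" "f = face_elt (Suc n) g"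
    using assms by (auto simp: carrier_Face)
  have "f = cube_dup n (restrict f (cube n)) \<star>\<^bsub>Suc n\<^esub>
    face_element (Suc n) G (g (Suc n)) {\<epsilon> \<in> cube (Suc n). Suc n \<in> \<epsilon>}"
    unfolding g(2) face_elt_def mult_product_group face_element_def
  proof (rule restrict_ext)
    fix \<epsilon> assume e: "\<epsilon> \<in> cube (Suc n)"
    have cl: "g \<in> \<epsilon> \<rightarrow> carrier G" by (rule vertex_Pi[OF e g(1)])
    have fin: "finite \<epsilon>" using e by (rule finite_vertex)
    have "finprod G g \<epsilon> = finprod G g (\<epsilon> - {Suc n}) \<otimes> (if Suc n \<in> \<epsilon> then g (Suc n) else \<one>)"
    proof (cases "Suc n \<in> \<epsilon>")
      case True
      have "finprod G g (insert (Suc n) (\<epsilon> - {Suc n})) = g (Suc n) \<otimes> finprod G g (\<epsilon> - {Suc n})"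
        using cl fin True by (intro finprod_insert) auto
      moreover have "finprod G g (\<epsilon> - {Suc n}) \<in> carrier G" using cl by (intro finprod_closed) auto
      ultimately show ?thesis using True cl by (auto simp: insert_absorb intro: m_comm)
    next
      case False
      then show ?thesis using finprod_closed[OF cl] by simp
    qed
    then show "finprod G g \<epsilon> = cube_dup n (\<lambda>\<epsilon>\<in>cube n. (\<lambda>\<epsilon>\<in>cube (Suc n). finprod G g \<epsilon>) \<epsilon>) \<epsilon> \<otimes>
        (\<lambda>\<epsilon>'\<in>cube (Suc n). if \<epsilon>' \<in> {\<epsilon> \<in> cube (Suc n). Suc n \<in> \<epsilon>} then g (Suc n) else \<one>) \<epsilon>"
      using e cube_Suc_Diff[OF e] by (simp add: cube_dup_def cube_Suc_lower)
  qed
  moreover have "g (Suc n) \<in> carrier G" using g(1) by (auto simp: Pi_iff)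
  ultimately show ?thesis using that by blast
qed

text \<open>The product of g over the symmetric difference of \<open>\<epsilon>\<close> and
  \<open>\<eta>\<close> is its product over \<open>\<eta>\<close> times the product over
  \<open>\<epsilon>\<close> of g inverted on \<open>\<eta>\<close>: the factors of the intersection
  cancel. The first factor does not depend on \<open>\<epsilon>\<close>, whence the diagonal
  element.\<close>

lemma Face_refl:
  assumes "f \<in> carrier (Face n G)" and \<eta>: "\<eta> \<in> cube n"
  obtains a f' where "a \<in> carrier G" "f' \<in> carrier (Face n G)"
    "cube_refl n \<eta> f = f' \<star>\<^bsub>n\<^esub> cube_diag n a"
proof -
  obtain g where g: "g \<in> {1..n} \<rightarrow> carrier G" "f = face_elt n g"
    using assms by (auto simp: carrier_Face)
  define g' where "g' i = (if i \<in> \<eta> then inv (g i) else g i)" for i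
  have g': "g' \<in> {1..n} \<rightarrow> carrier G" using g(1) by (auto simp: g'_def Pi_iff)
  have "cube_refl n \<eta> f = face_elt n g' \<star>\<^bsub>n\<^esub> cube_diag n (finprod G g \<eta>)"
    unfolding cube_refl_def mult_product_group
  proof (rule restrict_ext)
    fix \<epsilon> assume e: "\<epsilon> \<in> cube n"
    have cl: "g \<in> A \<rightarrow> carrier G" if "A \<subseteq> \<epsilon> \<union> \<eta>" for A
    proof
      fix i assume "i \<in> A"
      then have "i \<in> \<epsilon> \<or> i \<in> \<eta>" using that by blast
      then show "g i \<in> carrier G"
        using funcset_mem[OF vertex_Pi[OF e g(1)]] funcset_mem[OF vertex_Pi[OF \<eta> g(1)]] by blast
    qed
    have cl': "g' \<in> A \<rightarrow> carrier G" if "A \<subseteq> \<epsilon> \<union> \<eta>" for A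
      using cl[OF that] by (auto simp: g'_def Pi_iff)
    have fin: "finite \<epsilon>" "finite \<eta>" using e \<eta> by (auto intro: finite_vertex)
    define A where "A = finprod G g (\<epsilon> - \<eta>)"
    define B where "B = finprod G g (\<eta> - \<epsilon>)"
    define C where "C = finprod G g (\<eta> \<inter> \<epsilon>)"
    define C' where "C' = finprod G g' (\<eta> \<inter> \<epsilon>)"
    have ABC: "A \<in> carrier G" "B \<in> carrier G" "C \<in> carrier G" "C' \<in> carrier G"
      unfolding A_def B_def C_def C'_def by (intro finprod_closed cl cl'; blast)+
    have 1: "finprod G g ((\<epsilon> - \<eta>) \<union> (\<eta> - \<epsilon>)) = A \<otimes> B"
      unfolding A_def B_def using fin by (intro finprod_Un_disjoint cl) auto
    have "finprod G g ((\<eta> - \<epsilon>) \<union> (\<eta> \<inter> \<epsilon>)) = B \<otimes> C"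
      unfolding B_def C_def using fin by (intro finprod_Un_disjoint cl) auto
    moreover have "(\<eta> - \<epsilon>) \<union> (\<eta> \<inter> \<epsilon>) = \<eta>" by blast
    ultimately have 2: "finprod G g \<eta> = B \<otimes> C" by simp
    have "finprod G g' ((\<epsilon> - \<eta>) \<union> (\<eta> \<inter> \<epsilon>)) = finprod G g' (\<epsilon> - \<eta>) \<otimes> C'"
      unfolding C'_def using fin by (intro finprod_Un_disjoint cl') auto
    moreover have "finprod G g' (\<epsilon> - \<eta>) = A"
      unfolding A_def by (rule finprod_cong') (use cl[of "\<epsilon> - \<eta>"] in \<open>auto simp: g'_def\<close>)
    moreover have "(\<epsilon> - \<eta>) \<union> (\<eta> \<inter> \<epsilon>) = \<epsilon>" by blast
    ultimately have 3: "finprod G g' \<epsilon> = A \<otimes> C'" by simp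
    have clC: "g \<in> \<eta> \<inter> \<epsilon> \<rightarrow> carrier G" by (rule cl) blast
    have "C' \<otimes> C = finprod G (\<lambda>i. g' i \<otimes> g i) (\<eta> \<inter> \<epsilon>)"
      unfolding C_def C'_def by (intro finprod_multf[symmetric] cl cl') auto
    also have "\<dots> = \<one>"
      using clC by (intro finprod_one_eqI) (auto simp: g'_def Pi_iff)
    finally have 4: "C' \<otimes> C = \<one>" .
    have "(A \<otimes> C') \<otimes> (B \<otimes> C) = A \<otimes> B \<otimes> (C' \<otimes> C)"
      using ABC by (simp add: m_ac)
    then have "A \<otimes> B = (A \<otimes> C') \<otimes> (B \<otimes> C)" using ABC 4 by simp
    then show "f ((\<epsilon> - \<eta>) \<union> (\<eta> - \<epsilon>)) = face_elt n g' \<epsilon> \<otimes> cube_diag n (finprod G g \<eta>) \<epsilon>"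
      using e cube_symdiff[OF e \<eta>] by (simp add: g(2) face_elt_def cube_diag_def 1 2 3)
  qed
  moreover have "finprod G g \<eta> \<in> carrier G" using g(1) \<eta> by (intro finprod_vertex_closed)
  ultimately show ?thesis using that face_elt_in_Face[OF g'] by blast
qed

end

section \<open>The action on cubes\<close>

declare carrier_product_group [simp del] mult_product_group [simp del] one_product_group [simp del]
  topspace_product_topology [simp del]

text \<open>The \<open>\<epsilon>\<close>-coordinate of the image of p in the cube of the
  compactification of T. An ultrafilter acts on cubes through these coordinates alone, by
  \<open>bact_eq\<close>.\<close>

definition coord :: "nat set \<Rightarrow> (nat set \<Rightarrow> 't) filter \<Rightarrow> 't filter" where
  "coord \<epsilon> p = filtermap (\<lambda>t. t \<epsilon>) p"

lemma cube_diag_nth [simp]: "\<epsilon> \<in> cube n \<Longrightarrow> cube_diag n x \<epsilon> = x"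
  by (simp add: cube_diag_def)

lemma cube_act_nth [simp]: "\<epsilon> \<in> cube n \<Longrightarrow> cube_act n \<phi> f y \<epsilon> = \<phi> (f \<epsilon>) (y \<epsilon>)"
  by (simp add: cube_act_def)

lemma cube_point_iff:
  "y \<in> topspace (cube_top n X) \<longleftrightarrow> y \<in> extensional (cube n) \<and> (\<forall>\<epsilon>\<in>cube n. y \<epsilon> \<in> topspace X)"
  by (auto simp: topspace_product_topology PiE_iff)

lemma cube_point_nth: "y \<in> topspace (cube_top n X) \<Longrightarrow> \<epsilon> \<in> cube n \<Longrightarrow> y \<epsilon> \<in> topspace X"
  by (simp add: cube_point_iff)

lemma cube_point_eqI:
  assumes "y \<in> extensional (cube n)" "z \<in> extensional (cube n)" "\<And>\<epsilon>. \<epsilon> \<in> cube n \<Longrightarrow> y \<epsilon> = z \<epsilon>"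
  shows "y = z"
  using assms by (rule extensionalityI)

lemma cube_diag_extensional [simp]: "cube_diag n x \<in> extensional (cube n)"
  by (simp add: cube_diag_def)

lemma cube_act_extensional [simp]: "cube_act n \<phi> f y \<in> extensional (cube n)"
  by (simp add: cube_act_def)

lemma cube_diag_point [simp]: "cube_diag n x \<in> topspace (cube_top n X) \<longleftrightarrow> x \<in> topspace X"
  using cube_empty by (auto simp: cube_point_iff simp del: cube_empty)

lemma cube_group_carrier_iff:
  "h \<in> carrier (cube_group n L) \<longleftrightarrow> h \<in> extensional (cube n) \<and> (\<forall>\<epsilon>\<in>cube n. h \<epsilon> \<in> carrier L)"
  by (auto simp: carrier_product_group PiE_iff)

lemma cube_group_nth: "h \<in> carrier (cube_group n L) \<Longrightarrow> \<epsilon> \<in> cube n \<Longrightarrow> h \<epsilon> \<in> carrier L"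
  by (simp add: cube_group_carrier_iff)

lemma cube_mult_nth [simp]: "\<epsilon> \<in> cube n \<Longrightarrow> (h \<otimes>\<^bsub>cube_group n L\<^esub> h') \<epsilon> = h \<epsilon> \<otimes>\<^bsub>L\<^esub> h' \<epsilon>"
  by (simp add: mult_product_group)

lemma continuous_map_cube_diag: "continuous_map X (cube_top n X) (cube_diag n)"
  unfolding continuous_map_componentwise by (auto simp: continuous_map_id[unfolded id_def])

lemma openin_cube_cylinder:
  assumes "\<And>\<epsilon>. \<epsilon> \<in> cube n \<Longrightarrow> openin X (U \<epsilon>)"
  shows "openin (cube_top n X) (Pi\<^sub>E (cube n) U)"
  using assms by (simp add: openin_PiE_gen)

context dynamical_system
begin

lemma Hausdorff: "Hausdorff_space X"
  by (rule metrizable_imp_Hausdorff_space[OF metrizable])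

sublocale base: compact_action T X \<phi>
proof (intro compact_action.intro compact_action_axioms.intro)
  show "group T" by (rule is_group)
  show "compact_space X" by (rule compact)
  show "Hausdorff_space X" by (rule Hausdorff)
  show "continuous_map X X (\<phi> s)" if "s \<in> carrier T" for s
    by (rule homeomorphic_imp_continuous_map[OF homeomorphism[OF that]])
  show "\<phi> (s \<otimes> t) z = \<phi> s (\<phi> t z)" if "s \<in> carrier T" "t \<in> carrier T" "z \<in> topspace X" for s t z
    using that by (intro composition_rule)
  show "\<phi> \<one> z = z" if "z \<in> topspace X" for z
    using that id_eq_one by (metis restrict_apply')
qed

lemma compact_action_cube: "compact_action (cube_group n T) (cube_top n X) (cube_act n \<phi>)"
proof (intro compact_action.intro compact_action_axioms.intro)
  show "group (cube_group n T)" by simp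
  show "compact_space (cube_top n X)" by (simp add: compact_space_product_topology compact)
  show "Hausdorff_space (cube_top n X)" by (simp add: Hausdorff_space_product_topology Hausdorff)
  show "continuous_map (cube_top n X) (cube_top n X) (cube_act n \<phi> s)"
    if "s \<in> carrier (cube_group n T)" for s
    unfolding continuous_map_componentwise
  proof (intro conjI ballI)
    fix \<epsilon> assume e: "\<epsilon> \<in> cube n"
    have "continuous_map (cube_top n X) X (\<phi> (s \<epsilon>) \<circ> (\<lambda>y. y \<epsilon>))"
      by (rule continuous_map_compose[OF continuous_map_product_projection[OF e]
            base.act_continuous[OF cube_group_nth[OF that e]]])
    then show "continuous_map (cube_top n X) X (\<lambda>y. cube_act n \<phi> s y \<epsilon>)"
      using e by (simp add: o_def)
  qed auto
  show "cube_act n \<phi> (s \<otimes>\<^bsub>cube_group n T\<^esub> t) z = cube_act n \<phi> s (cube_act n \<phi> t z)"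
    if "s \<in> carrier (cube_group n T)" "t \<in> carrier (cube_group n T)" "z \<in> topspace (cube_top n X)" for s t z
    by (rule cube_point_eqI[of _ n])
       (use that in \<open>auto simp: base.act_mult cube_group_carrier_iff cube_point_iff\<close>)
  show "cube_act n \<phi> \<one>\<^bsub>cube_group n T\<^esub> z = z" if "z \<in> topspace (cube_top n X)" for z
    by (rule cube_point_eqI[of _ n])
       (use that in \<open>auto simp: base.act_one one_product_group cube_point_iff\<close>)
qed

sublocale cub: compact_action "cube_group n T" "cube_top n X" "cube_act n \<phi>" for n
  by (rule compact_action_cube)

abbreviation FF :: "nat \<Rightarrow> (nat set \<Rightarrow> 't) set" where
  "FF n \<equiv> carrier (Face n T)"

abbreviation bmult :: "nat \<Rightarrow> (nat set \<Rightarrow> 't) filter \<Rightarrow> (nat set \<Rightarrow> 't) filter \<Rightarrow> (nat set \<Rightarrow> 't) filter" where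
  "bmult n \<equiv> beta_mult (cube_group n T)"

abbreviation bact :: "nat \<Rightarrow> (nat set \<Rightarrow> 't) filter \<Rightarrow> (nat set \<Rightarrow> 'x) \<Rightarrow> nat set \<Rightarrow> 'x" where
  "bact n \<equiv> beta_act (cube_top n X) (cube_act n \<phi>)"

abbreviation act :: "'t filter \<Rightarrow> 'x \<Rightarrow> 'x" where
  "act \<equiv> beta_act X \<phi>"

abbreviation "BF n \<equiv> ultrafilters (carrier (Face n T))"

abbreviation "KK n \<equiv> carrier (cube_group n T)"

abbreviation "BK n \<equiv> ultrafilters (carrier (cube_group n T))"

abbreviation "BT \<equiv> ultrafilters (carrier T)"

abbreviation cube_mult_T :: "(nat set \<Rightarrow> 't) \<Rightarrow> nat \<Rightarrow> (nat set \<Rightarrow> 't) \<Rightarrow> nat set \<Rightarrow> 't"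
    ("(_ \<star>\<^bsub>_\<^esub>/ _)" [70, 0, 71] 70) where
  "f \<star>\<^bsub>n\<^esub> g \<equiv> f \<otimes>\<^bsub>cube_group n T\<^esub> g"

abbreviation "CX n \<equiv> cube_top n X"

abbreviation "cact n \<equiv> cube_act n \<phi>"

abbreviation "bmul \<equiv> beta_mult T"

lemma FF_carrier: "FF n \<subseteq> KK n"
  using subgroup.subset[OF subgroup_Face] .

lemma FF_mult: "f \<in> FF n \<Longrightarrow> f' \<in> FF n \<Longrightarrow> f \<star>\<^bsub>n\<^esub> f' \<in> FF n"
  by (rule subgroup.m_closed[OF subgroup_Face])

lemma BF_carrier: "p \<in> BF n \<Longrightarrow> p \<in> BK n"
  by (rule ultrafilters_mono[OF _ FF_carrier])

lemma BF_mult: "p \<in> BF n \<Longrightarrow> q \<in> BF n \<Longrightarrow> bmult n p q \<in> BF n"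
  by (rule beta_mult_ultrafilters[OF _ _ FF_mult])

lemma coord_ultrafilter:
  assumes "p \<in> BK n" "\<epsilon> \<in> cube n"
  shows "coord \<epsilon> p \<in> BT"
  unfolding coord_def by (rule filtermap_ultrafilters[OF assms(1)]) (use assms(2) in \<open>auto intro: cube_group_nth\<close>)

lemma coord_mult:
  assumes "p \<in> BK n" "q \<in> BK n"
    and "\<epsilon> \<in> cube n"
  shows "coord \<epsilon> (bmult n p q) = bmul (coord \<epsilon> p) (coord \<epsilon> q)"
  unfolding coord_def
  by (rule filtermap_beta_mult[of _ "KK n" _ "KK n"])
     (use assms in \<open>auto simp: ultrafilters_iff\<close>)

lemma coord_empty:
  assumes "p \<in> BF n"
  shows "coord {} p = principal {\<one>}"
proof -
  have "coord {} p \<in> ultrafilters {\<one>}"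
    unfolding coord_def by (rule filtermap_ultrafilters[OF assms]) auto
  then have "coord {} p \<le> principal {\<one>}" "coord {} p \<noteq> bot" by (auto simp: ultrafilters_def)
  then show ?thesis by (intro ultra_minimal) auto
qed

lemma bact_eq:
  assumes p: "p \<in> BK n" and y: "y \<in> topspace (CX n)"
  shows "bact n p y = (\<lambda>\<epsilon>\<in>cube n. act (coord \<epsilon> p) (y \<epsilon>))"
proof (rule cub.beta_act_eqI[OF p])
  show "limitin (CX n) (\<lambda>s. cact n s y) (\<lambda>\<epsilon>\<in>cube n. act (coord \<epsilon> p) (y \<epsilon>)) p"
    unfolding limitin_componentwise
  proof (intro conjI ballI)
    show "\<forall>\<^sub>F s in p. cact n s y \<in> topspace (CX n)"
      using eventually_in_ultrafilter[OF p] by eventually_elim (rule cub.act_closed[OF _ y])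
    fix \<epsilon> assume e: "\<epsilon> \<in> cube n"
    have "limitin X (\<lambda>t. \<phi> t (y \<epsilon>)) (act (coord \<epsilon> p) (y \<epsilon>)) (coord \<epsilon> p)"
      by (rule base.limitin_beta_act[OF coord_ultrafilter[OF p e] cube_point_nth[OF y e]])
    then show "limitin X (\<lambda>s. cact n s y \<epsilon>) ((\<lambda>\<epsilon>\<in>cube n. act (coord \<epsilon> p) (y \<epsilon>)) \<epsilon>) p"
      using e by (simp add: limitin_def coord_def eventually_filtermap)
  qed auto
qed

lemma bact_nth:
  assumes "p \<in> BK n" "y \<in> topspace (CX n)" "\<epsilon> \<in> cube n"
  shows "bact n p y \<epsilon> = act (coord \<epsilon> p) (y \<epsilon>)"
  using assms by (simp add: bact_eq)

lemma bact_closed: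
  assumes "p \<in> BK n" "y \<in> topspace (CX n)"
  shows "bact n p y \<in> topspace (CX n)"
  by (rule cub.beta_act_closed[OF assms])

lemma act_principal_one: "x \<in> topspace X \<Longrightarrow> act (principal {\<one>}) x = x"
  using base.beta_act_principal[of \<one> x] base.act_one by simp

lemma bact_empty:
  assumes "p \<in> BF n" "y \<in> topspace (CX n)"
  shows "bact n p y {} = y {}"
  using bact_nth[OF BF_carrier[OF assms(1)] assms(2) cube_empty] coord_empty[OF assms(1)]
    act_principal_one[OF cube_point_nth[OF assms(2) cube_empty]] by simp

subsection \<open>Dynamical cubes\<close>

text \<open>Face elements are trivial at the vertex {}, so the coordinate there survives their
  action and its limits. For n \<ge> 1 the closure agrees with \<open>Q_cube\<close>.\<close>

definition QF :: "nat \<Rightarrow> (nat set \<Rightarrow> 'x) set" where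
  "QF n = CX n closure_of {cact n f (cube_diag n a) |f a. f \<in> FF n \<and> a \<in> topspace X}"

lemma QF_closed: "closedin (CX n) (QF n)"
  by (simp add: QF_def)

lemma QF_point: "y \<in> QF n \<Longrightarrow> y \<in> topspace (CX n)"
  using closedin_subset[OF QF_closed] by blast

lemma QF_generator:
  assumes "f \<in> FF n" "a \<in> topspace X"
  shows "cact n f (cube_diag n a) \<in> QF n"
proof -
  have "{cact n f (cube_diag n a) |f a. f \<in> FF n \<and> a \<in> topspace X} \<subseteq> topspace (CX n)"
    using FF_carrier by (auto intro!: cub.act_closed)
  then show ?thesis
    unfolding QF_def by (rule subsetD[OF closure_of_subset]) (use assms in blast)
qed

lemma QF_diag: "a \<in> topspace X \<Longrightarrow> cube_diag n a \<in> QF n"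
  using QF_generator[OF subgroup.one_closed[OF subgroup_Face]] cub.act_one by force

text \<open>Closedness of the target reduces invariance to a check on generators.\<close>

lemma QF_map:
  assumes f: "continuous_map (CX n) (cube_top m X) h"
    and g: "\<And>f a. f \<in> FF n \<Longrightarrow> a \<in> topspace X \<Longrightarrow> h (cact n f (cube_diag n a)) \<in> QF m"
    and y: "y \<in> QF n"
  shows "h y \<in> QF m"
proof -
  have "h y \<in> h ` (QF n)" using y by blast
  also have "\<dots> \<subseteq> cube_top m X closure_of
      (h ` {cact n f (cube_diag n a) |f a. f \<in> FF n \<and> a \<in> topspace X})"
    unfolding QF_def by (rule continuous_map_image_closure_subset[OF f])
  also have "\<dots> \<subseteq> QF m"
    by (rule closure_of_minimal[OF _ QF_closed]) (use g in blast)
  finally show ?thesis .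
qed

lemma QF_Face:
  assumes "f \<in> FF n" "y \<in> QF n"
  shows "cact n f y \<in> QF n"
proof (rule QF_map[OF cub.act_continuous _ assms(2)])
  show "f \<in> KK n" using assms(1) FF_carrier by blast
  show "cact n f (cact n f' (cube_diag n a)) \<in> QF n"
    if "f' \<in> FF n" "a \<in> topspace X" for f' a
    using QF_generator[OF FF_mult[OF assms(1) that(1)] that(2)] assms(1) that FF_carrier
    by (subst cub.act_mult[symmetric]) auto
qed

lemma act_diag_commute:
  assumes "t \<in> carrier T" "f \<in> KK n" "y \<in> topspace (CX n)"
  shows "cact n (cube_diag n t) (cact n f y) = cact n f (cact n (cube_diag n t) y)"
  using assms cube_diag_commute[OF assms(1,2)] by (metis cub.act_mult cube_diag_carrier)

lemma act_diag_diag: "cact n (cube_diag n t) (cube_diag n a) = cube_diag n (\<phi> t a)"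
  by (rule cube_point_eqI[of _ n]) auto

lemma QF_act_diag:
  assumes t: "t \<in> carrier T" and y: "y \<in> QF n"
  shows "cact n (cube_diag n t) y \<in> QF n"
proof (rule QF_map[OF cub.act_continuous _ y])
  show "cube_diag n t \<in> KK n" using t by simp
  show "cact n (cube_diag n t) (cact n f (cube_diag n a)) \<in> QF n"
    if "f \<in> FF n" "a \<in> topspace X" for f a
    using that t FF_carrier by (subst act_diag_commute) (auto simp: act_diag_diag base.act_closed intro: QF_generator)
qed

lemma QF_bact:
  assumes "p \<in> BF n" "y \<in> QF n"
  shows "bact n p y \<in> QF n"
  by (rule cub.beta_act_in_closed[OF assms(1) FF_carrier QF_point[OF assms(2)] QF_closed])
     (rule QF_Face[OF _ assms(2)])

lemma diag_filter:
  assumes "p \<in> BT"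
  shows "filtermap (cube_diag n) p \<in> ultrafilters (cube_diag n ` carrier T)"
    and "\<epsilon> \<in> cube n \<Longrightarrow> coord \<epsilon> (filtermap (cube_diag n) p) = p"
  using assms by (auto simp: coord_def filtermap_filtermap intro: filtermap_ultrafilters)

text \<open>Pushed forward to the diagonal of the cube group, p becomes an ultrafilter all of whose
  coordinates are p, and diagonal translations preserve \<open>QF n\<close>.\<close>

lemma QF_bact_diag:
  assumes p: "p \<in> BT" and y: "y \<in> QF n"
  shows "(\<lambda>\<epsilon>\<in>cube n. act p (y \<epsilon>)) \<in> QF n"
proof -
  have sub: "cube_diag n ` carrier T \<subseteq> KK n" by auto
  have "bact n (filtermap (cube_diag n) p) y \<in> QF n"
    by (rule cub.beta_act_in_closed[OF diag_filter(1)[OF p] sub QF_point[OF y] QF_closed])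
       (use y QF_act_diag in auto)
  moreover have "bact n (filtermap (cube_diag n) p) y = (\<lambda>\<epsilon>\<in>cube n. act p (y \<epsilon>))"
    using bact_eq[OF ultrafilters_mono[OF diag_filter(1)[OF p] sub] QF_point[OF y]]
    by (simp add: diag_filter(2)[OF p] cong: restrict_cong)
  ultimately show ?thesis by simp
qed

text \<open>The diagonal factor of a Host-Kra element only moves the base point, so both groups
  yield the same generators.\<close>

lemma Q_cube_eq_QF:
  assumes "n \<ge> 1"
  shows "Q_cube n T X \<phi> = QF n"
proof -
  have "{cact n t (cube_diag n x) |t x. t \<in> carrier (HK n T) \<and> x \<in> topspace X}
      = {cact n f (cube_diag n a) |f a. f \<in> FF n \<and> a \<in> topspace X}" (is "?A = ?B")
  proof
    show "?B \<subseteq> ?A" using Face_subset_HK by blast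
    show "?A \<subseteq> ?B"
    proof
      fix z assume "z \<in> ?A"
      then obtain t x where tx: "t \<in> carrier (HK n T)" "x \<in> topspace X"
          "z = cact n t (cube_diag n x)" by blast
      obtain a f where af: "a \<in> carrier T" "f \<in> FF n" "t = f \<star>\<^bsub>n\<^esub> cube_diag n a"
        using HK_decompose[OF assms tx(1)] .
      have "z = cact n f (cube_diag n (\<phi> a x))"
        using tx(2) af(1,2) FF_carrier unfolding tx(3) af(3)
        by (subst cub.act_mult) (auto simp: act_diag_diag)
      then show "z \<in> ?B" using af tx base.act_closed by blast
    qed
  qed
  then show ?thesis by (simp add: Q_cube_def QF_def)
qed

lemma QF_HK:
  assumes "n \<ge> 1" "h \<in> carrier (HK n T)" "y \<in> QF n"
  shows "cact n h y \<in> QF n"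
proof -
  obtain a f where af: "a \<in> carrier T" "f \<in> FF n" "h = f \<star>\<^bsub>n\<^esub> cube_diag n a"
    using HK_decompose[OF assms(1,2)] .
  have "cact n h y = cact n f (cact n (cube_diag n a) y)"
    using af(1,2) FF_carrier QF_point[OF assms(3)] unfolding af(3) by (intro cub.act_mult) auto
  then show ?thesis using af assms by (simp add: QF_Face QF_act_diag)
qed

lemma continuous_map_restrict_cube:
  "continuous_map (CX (Suc n)) (CX n) (\<lambda>y. restrict y (cube n))"
  unfolding continuous_map_componentwise
  by (auto intro: continuous_map_product_projection cube_Suc_lower)

lemma QF_lower:
  assumes "y \<in> QF (Suc n)"
  shows "restrict y (cube n) \<in> QF n"
proof (rule QF_map[OF continuous_map_restrict_cube _ assms])
  fix f a assume f: "f \<in> FF (Suc n)" and a: "a \<in> topspace X"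
  have "restrict (cact (Suc n) f (cube_diag (Suc n) a)) (cube n)
      = cact n (restrict f (cube n)) (cube_diag n a)"
    by (rule cube_point_eqI[of _ n]) (auto simp: cube_Suc_lower)
  then show "restrict (cact (Suc n) f (cube_diag (Suc n) a)) (cube n) \<in> QF n"
    using QF_generator[OF Face_restrict[OF f] a] by simp
qed

lemma continuous_map_cube_refl:
  assumes "\<eta> \<in> cube n"
  shows "continuous_map (CX n) (CX n) (cube_refl n \<eta>)"
  unfolding continuous_map_componentwise cube_refl_def
  using assms by (auto intro: continuous_map_product_projection cube_symdiff)

lemma QF_refl:
  assumes \<eta>: "\<eta> \<in> cube n" and y: "y \<in> QF n"
  shows "cube_refl n \<eta> y \<in> QF n"
proof (rule QF_map[OF continuous_map_cube_refl[OF \<eta>] _ y])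
  fix f a assume f: "f \<in> FF n" and a: "a \<in> topspace X"
  obtain b f' where bf: "b \<in> carrier T" "f' \<in> FF n"
      "cube_refl n \<eta> f = f' \<star>\<^bsub>n\<^esub> cube_diag n b"
    using Face_refl[OF f \<eta>] .
  have "cube_refl n \<eta> (cact n f (cube_diag n a)) = cact n (cube_refl n \<eta> f) (cube_diag n a)"
    using \<eta> by (intro cube_point_eqI[of _ n]) (auto simp: cube_refl_def cube_symdiff)
  also have "\<dots> = cact n f' (cube_diag n (\<phi> b a))"
    using a bf(1,2) FF_carrier unfolding bf(3) by (subst cub.act_mult) (auto simp: act_diag_diag)
  finally show "cube_refl n \<eta> (cact n f (cube_diag n a)) \<in> QF n"
    using QF_generator[OF bf(2) base.act_closed[OF bf(1) a]] by simp
qed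

lemma dup_filter:
  assumes "p \<in> BF n"
  shows "filtermap (cube_dup n) p \<in> BF (Suc n)"
    and "\<epsilon> \<in> cube (Suc n) \<Longrightarrow> coord \<epsilon> (filtermap (cube_dup n) p) = coord (\<epsilon> - {Suc n}) p"
proof -
  show "filtermap (cube_dup n) p \<in> BF (Suc n)"
    by (rule filtermap_ultrafilters[OF assms]) (use Face_dup in blast)
  show "coord \<epsilon> (filtermap (cube_dup n) p) = coord (\<epsilon> - {Suc n}) p" if "\<epsilon> \<in> cube (Suc n)"
    using that by (simp add: coord_def filtermap_filtermap cube_dup_def)
qed

end

section \<open>Minimal systems and recurrence under the face group\<close>

locale minimal_cube_system = dynamical_system T X \<phi>
  for T :: "('t, 'm) monoid_scheme" (structure) and X :: "'x topology" and \<phi> +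
  fixes M :: "'t filter set"
  assumes minimal: "minimal_action T X \<phi>"
    and M_ideal: "minimal_left_ideal (beta T) M"
begin

sublocale ideal: minimal_ideal T M
  by unfold_locales (rule M_ideal)

lemma dense_orbit:
  assumes "x \<in> topspace X" "y \<in> topspace X"
  shows "y \<in> X closure_of ((\<lambda>t. \<phi> t x) ` carrier T)"
proof -
  have "orbit T \<phi> x = (\<lambda>t. \<phi> t x) ` carrier T" by (auto simp: orbit_def)
  moreover have "X closure_of (orbit T \<phi> x) = topspace X"
    using minimal assms(1) by (simp add: minimal_action_def)
  ultimately show ?thesis using assms(2) by simp
qed

lemma orbit_meets:
  assumes "x \<in> topspace X" "y \<in> topspace X" "openin X U" "y \<in> U"
  obtains t where "t \<in> carrier T" "\<phi> t x \<in> U"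
  using dense_orbit[OF assms(1,2)] assms(3,4) unfolding in_closure_of by auto

lemma idempotent_fixing_point:
  assumes "x \<in> topspace X"
  obtains u where "u \<in> M" "bmul u u = u" "act u x = x"
  using base.idempotent_fixing[OF M_ideal assms dense_orbit[OF _ assms]] .

lemma coord_in_M:
  assumes "p \<in> BK n" "q \<in> BK n"
    and "\<epsilon> \<in> cube n" "coord \<epsilon> q \<in> M"
  shows "coord \<epsilon> (bmult n p q) \<in> M"
  using assms by (simp add: coord_mult coord_ultrafilter ideal.ideal_closed)

text \<open>Multiply the duplicate of q on the right by u placed on the new upper facet. The
  coordinates are u u or 1 u at vertices containing n + 1, and u 1 or 1 1 at the others, the last
  only at {}.\<close>

lemma face_idempotent_exists:
  assumes u: "u \<in> M" "bmul u u = u"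
  shows "\<exists>q \<in> BF n. \<forall>\<epsilon>\<in>cube n - {{}}. coord \<epsilon> q = u"
proof (induction n)
  case 0
  have "principal {\<one>\<^bsub>cube_group 0 T\<^esub>} \<in> BF 0"
    using subgroup.one_closed[OF subgroup_Face] by simp
  moreover have "cube 0 - {{}} = {}" by (auto simp: cube_def)
  ultimately show ?case by (metis empty_iff)
next
  case (Suc n)
  then obtain q where q: "q \<in> BF n" "\<And>\<epsilon>. \<epsilon> \<in> cube n - {{}} \<Longrightarrow> coord \<epsilon> q = u"
    by blast
  have u': "u \<in> BT" "u \<le> principal (carrier T)"
    using u(1) ideal.ideal_mem by (auto simp: ultrafilters_iff)
  define j where "j t = face_element (Suc n) T t {\<epsilon> \<in> cube (Suc n). Suc n \<in> \<epsilon>}" for t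
  define r where "r = bmult (Suc n) (filtermap (cube_dup n) q) (filtermap j u)"
  have j: "filtermap j u \<in> BF (Suc n)"
    by (rule filtermap_ultrafilters[OF u'(1)]) (auto simp: j_def face_element_top_in_Face)
  have coord_j: "coord \<epsilon> (filtermap j u) = (if Suc n \<in> \<epsilon> then u else principal {\<one>})"
    if e: "\<epsilon> \<in> cube (Suc n)" for \<epsilon>
  proof (cases "Suc n \<in> \<epsilon>")
    case True
    then show ?thesis using e by (simp add: coord_def filtermap_filtermap j_def face_element_def)
  next
    case False
    have "filtermap (\<lambda>_. \<one>) u = principal {\<one>}"
      using u'(1) by (intro filtermap_const) (simp add: ultrafilters_def)
    then show ?thesis using e False by (simp add: coord_def filtermap_filtermap j_def face_element_def)
  qed
  have "r \<in> BF (Suc n)"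
    unfolding r_def by (rule BF_mult[OF dup_filter(1)[OF q(1)] j])
  moreover have "coord \<epsilon> r = u" if e: "\<epsilon> \<in> cube (Suc n) - {{}}" for \<epsilon>
  proof -
    have "coord \<epsilon> r = bmul (coord (\<epsilon> - {Suc n}) q) (if Suc n \<in> \<epsilon> then u else principal {\<one>})"
      using e coord_j[of \<epsilon>] dup_filter(2)[OF q(1), of \<epsilon>] unfolding r_def
      by (simp add: coord_mult[OF BF_carrier[OF dup_filter(1)[OF q(1)]] BF_carrier[OF j]])
    also have "\<dots> = u"
    proof (cases "\<epsilon> - {Suc n} = {}")
      case True
      then have "Suc n \<in> \<epsilon>" using e by blast
      then show ?thesis
        using coord_empty[OF q(1)] beta_left_one[OF u'(2)] unfolding True by simp
    next
      case False
      then have "coord (\<epsilon> - {Suc n}) q = u" using e cube_Suc_Diff by (intro q(2)) auto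
      then show ?thesis using u(2) beta_right_one[OF u'(2)] by simp
    qed
    finally show ?thesis .
  qed
  ultimately show ?case by blast
qed

lemma monoid_cube_group: "monoid (cube_group n T)"
  by (rule group.is_monoid) simp

text \<open>In dynamical terms, \<open>y\<close> has a minimal orbit closure under the face group.\<close>

lemma face_return:
  assumes u: "u \<in> M" "bmul u u = u" and y: "y \<in> topspace (CX n)"
    and fix_y: "\<And>\<epsilon>. \<epsilon> \<in> cube n - {{}} \<Longrightarrow> act u (y \<epsilon>) = y \<epsilon>"
    and p: "p \<in> BF n"
  obtains p' where "p' \<in> BF n" "bact n p' (bact n p y) = y"
proof -
  obtain q where q: "q \<in> BF n" "\<And>\<epsilon>. \<epsilon> \<in> cube n - {{}} \<Longrightarrow> coord \<epsilon> q = u"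
    using face_idempotent_exists[OF u, of n] by blast
  have pq: "bmult n p q \<in> BF n" by (rule BF_mult[OF p q(1)])
  have FFp: "bmult n (principal (FF n)) (principal (FF n)) \<le> principal (FF n)"
    by (rule beta_mult_le_principal) (auto intro: FF_mult)
  \<comment> \<open>One b makes b p q idempotent in all coordinates at once; q b will then undo p on
    y.\<close>
  obtain b where b: "ultra b" "b \<le> principal (FF n)"
      "bmult n (bmult n b (bmult n p q)) (bmult n b (bmult n p q)) = bmult n b (bmult n p q)"
    using monoid.idempotent_in_left_ideal[OF monoid_cube_group _ _ _ FFp] pq FF_carrier
    unfolding ultrafilters_iff by (metis principal_le_iff)
  have bF: "b \<in> BF n" using b by (simp add: ultrafilters_iff)
  note car = BF_carrier[OF p] BF_carrier[OF q(1)] BF_carrier[OF bF] BF_carrier[OF pq]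
  have "bact n (bmult n q b) (bact n p y) = y"
  proof (rule cube_point_eqI[of _ n])
    show "bact n (bmult n q b) (bact n p y) \<in> extensional (cube n)"
      using bact_closed[OF BF_carrier[OF BF_mult[OF q(1) bF]] bact_closed[OF car(1) y]]
      by (simp add: cube_point_iff)
    show "y \<in> extensional (cube n)" using y by (simp add: cube_point_iff)
    fix \<epsilon> assume e: "\<epsilon> \<in> cube n"
    show "bact n (bmult n q b) (bact n p y) \<epsilon> = y \<epsilon>"
    proof (cases "\<epsilon> = {}")
      case True
      then show ?thesis
        using bact_empty[OF BF_mult[OF q(1) bF] bact_closed[OF car(1) y]] bact_empty[OF p y] by simp
    next
      case False
      then have e': "\<epsilon> \<in> cube n - {{}}" using e by simp
      define b' where "b' = coord \<epsilon> b"
      define p' where "p' = coord \<epsilon> p"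
      have bp: "b' \<in> BT" "p' \<in> BT" "u \<in> BT"
        using coord_ultrafilter car e u by (auto simp: b'_def p'_def)
      \<comment> \<open>As w is an idempotent of M, u w = u. Since u fixes the coordinate of y,
        applying u b' p' to it is applying u w = u.\<close>
      define w where "w = bmul b' (bmul p' u)"
      have wM: "w \<in> M" unfolding w_def using bp u(1) by (intro ideal.ideal_closed)
      have cw: "coord \<epsilon> (bmult n b (bmult n p q)) = w"
        using car e q(2)[OF e'] by (simp add: coord_mult w_def b'_def p'_def)
      then have "bmul w w = w"
        using b(3) coord_mult[OF BF_carrier[OF BF_mult[OF bF pq]] BF_carrier[OF BF_mult[OF bF pq]] e] by simp
      then have uw: "bmul u w = u" by (rule ideal.idempotent_right_identity[OF wM _ u(1)])
      have ye: "y \<epsilon> \<in> topspace X" by (rule cube_point_nth[OF y e])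
      have "bact n (bmult n q b) (bact n p y) \<epsilon> = act (bmul u b') (act p' (act u (y \<epsilon>)))"
        using bact_nth[OF BF_carrier[OF BF_mult[OF q(1) bF]] bact_closed[OF car(1) y] e]
          bact_nth[OF car(1) y e] coord_mult[OF car(2,3) e] q(2)[OF e'] fix_y[OF e']
        by (simp add: b'_def p'_def)
      also have "\<dots> = act (bmul u w) (y \<epsilon>)"
        unfolding w_def using bp ye by (simp add: base.beta_act_mult beta_closed beta_assoc)
      also have "\<dots> = y \<epsilon>" using uw fix_y[OF e'] by simp
      finally show ?thesis .
    qed
  qed
  then show ?thesis using that BF_mult[OF q(1) bF] by blast
qed

subsection \<open>Limits along a fixed filter of face elements\<close>

definition face_hits :: "nat \<Rightarrow> (nat set \<Rightarrow> 'x) set \<Rightarrow> (nat set \<Rightarrow> 't) set" where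
  "face_hits n W = {f \<in> FF n. \<exists>a\<in>topspace X. cact n f (cube_diag n a) \<in> W}"

text \<open>Its sets consist of face elements sending some diagonal point close to y; the base point
  may depend on the element and on the neighbourhood.\<close>

definition face_filter :: "nat \<Rightarrow> (nat set \<Rightarrow> 'x) \<Rightarrow> (nat set \<Rightarrow> 't) filter" where
  "face_filter n y = nbhd_pull (CX n) y (face_hits n)"

lemma face_hitsI:
  "f \<in> FF n \<Longrightarrow> a \<in> topspace X \<Longrightarrow> cact n f (cube_diag n a) \<in> W \<Longrightarrow> f \<in> face_hits n W"
  by (auto simp: face_hits_def)

lemma face_hits_mono: "W \<subseteq> W' \<Longrightarrow> face_hits n W \<subseteq> face_hits n W'"
  by (auto simp: face_hits_def)

lemma le_face_filter:
  "r \<le> face_filter n y \<longleftrightarrow>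
    (\<forall>W. openin (CX n) W \<longrightarrow> y \<in> W \<longrightarrow> (\<forall>\<^sub>F f in r. f \<in> face_hits n W))"
  by (simp add: face_filter_def le_nbhd_pull)

lemma face_filter_le_FF:
  assumes "y \<in> topspace (CX n)"
  shows "face_filter n y \<le> principal (FF n)"
proof -
  have "\<forall>\<^sub>F f in face_filter n y. f \<in> face_hits n (topspace (CX n))"
    using order_refl[of "face_filter n y"] assms unfolding le_face_filter by blast
  then show ?thesis unfolding le_principal by eventually_elim (simp add: face_hits_def)
qed

lemma face_filter_not_bot:
  assumes "y \<in> QF n"
  shows "face_filter n y \<noteq> bot"
  unfolding face_filter_def
proof (rule nbhd_pull_not_bot[OF QF_point[OF assms] face_hits_mono])
  show "face_hits n W \<noteq> {}" if W: "openin (CX n) W" "y \<in> W" for W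
  proof -
    obtain z where "z \<in> {cact n f (cube_diag n a) |f a. f \<in> FF n \<and> a \<in> topspace X}" "z \<in> W"
      using assms[unfolded QF_def in_closure_of, THEN conjunct2, rule_format, OF conjI[OF W(2,1)]] by auto
    then show ?thesis unfolding face_hits_def by blast
  qed
qed

text \<open>By minimality some t carries x close to a. If f b^[n] is close to x^[n], then f (t
  b)^[n], which is the diagonal translate of f b^[n] by t, is close to a^[n].\<close>

lemma face_filter_diag_le:
  assumes r: "r \<le> face_filter n (cube_diag n x)" and x: "x \<in> topspace X" and a: "a \<in> topspace X"
  shows "r \<le> face_filter n (cube_diag n a)"
  unfolding le_face_filter
proof (intro allI impI)
  fix W assume W: "openin (CX n) W" "cube_diag n a \<in> W"
  have "openin X {b \<in> topspace X. cube_diag n b \<in> W}"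
    by (rule openin_continuous_map_preimage[OF continuous_map_cube_diag W(1)])
  then obtain t where t: "t \<in> carrier T" "\<phi> t x \<in> {b \<in> topspace X. cube_diag n b \<in> W}"
    using orbit_meets[OF x a] a W(2) by blast
  have dt: "cube_diag n t \<in> KK n" using t by simp
  let ?V = "{z \<in> topspace (CX n). cact n (cube_diag n t) z \<in> W}"
  have "openin (CX n) ?V" by (rule cub.openin_act_vimage[OF dt W(1)])
  moreover have "cube_diag n x \<in> ?V" using t x by (simp add: act_diag_diag)
  ultimately have "\<forall>\<^sub>F f in r. f \<in> face_hits n ?V" using r unfolding le_face_filter by blast
  then show "\<forall>\<^sub>F f in r. f \<in> face_hits n W"
  proof eventually_elim
    case (elim f)
    then obtain b where b: "f \<in> FF n" "b \<in> topspace X"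
        "cact n (cube_diag n t) (cact n f (cube_diag n b)) \<in> W"
      by (auto simp: face_hits_def)
    moreover have "cact n (cube_diag n t) (cact n f (cube_diag n b))
        = cact n f (cube_diag n (\<phi> t b))"
      using act_diag_commute[OF t(1) subsetD[OF FF_carrier b(1)], of "cube_diag n b"] b(2)
      by (simp add: act_diag_diag)
    ultimately show ?case
      using base.act_closed[OF t(1) b(2)] by (auto simp: face_hits_def)
  qed
qed

lemma face_hits_mult:
  assumes f: "f \<in> FF n" and W: "openin (CX n) W"
    and z: "z \<in> topspace (CX n)" "cact n f z \<in> W" and t: "t \<le> face_filter n z"
  shows "\<forall>\<^sub>F g in t. f \<star>\<^bsub>n\<^esub> g \<in> face_hits n W"
proof -
  have fK: "f \<in> KK n" using f FF_carrier by blast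
  let ?V = "{z \<in> topspace (CX n). cact n f z \<in> W}"
  have "openin (CX n) ?V" by (rule cub.openin_act_vimage[OF fK W])
  moreover have "z \<in> ?V" using z by simp
  ultimately have "\<forall>\<^sub>F g in t. g \<in> face_hits n ?V" using t unfolding le_face_filter by blast
  then show ?thesis
  proof eventually_elim
    case (elim g)
    then obtain b where b: "g \<in> FF n" "b \<in> topspace X" "cact n f (cact n g (cube_diag n b)) \<in> W"
      by (auto simp: face_hits_def)
    moreover have "cact n (f \<star>\<^bsub>n\<^esub> g) (cube_diag n b)
        = cact n f (cact n g (cube_diag n b))"
      using b(2) by (intro cub.act_mult[OF fK subsetD[OF FF_carrier b(1)]]) simp
    ultimately show ?case using FF_mult[OF f b(1)] by (intro face_hitsI[of _ n b]) simp_all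
  qed
qed

text \<open>If f a^[n] is close to y, so is f g b^[n] whenever g b^[n] is close enough to a^[n], and
  g achieves this for every a by \<open>face_filter_diag_le\<close>. At a diagonal point this is
  closure under multiplication.\<close>

lemma face_filter_mult:
  assumes s: "s \<le> face_filter n y" "y \<in> topspace (CX n)"
    and t: "t \<le> face_filter n (cube_diag n x)" "x \<in> topspace X"
  shows "bmult n s t \<le> face_filter n y"
  unfolding le_face_filter eventually_beta_mult
proof (intro allI impI)
  fix W assume W: "openin (CX n) W" "y \<in> W"
  have "\<forall>\<^sub>F f in s. f \<in> face_hits n W" using s(1) W unfolding le_face_filter by blast
  then show "\<forall>\<^sub>F f in s. \<forall>\<^sub>F g in t. f \<star>\<^bsub>n\<^esub> g \<in> face_hits n W"
  proof eventually_elim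
    case (elim f)
    then obtain a where f: "f \<in> FF n" and a: "a \<in> topspace X" "cact n f (cube_diag n a) \<in> W"
      by (auto simp: face_hits_def)
    show ?case
      by (rule face_hits_mult[OF f W(1) _ a(2) face_filter_diag_le[OF t a(1)]]) (simp add: a(1))
  qed
qed

text \<open>Left factors move the limit point by their action, while the right factors of
  \<open>face_filter_mult\<close> preserve it.\<close>

lemma face_filter_act:
  assumes q: "q \<in> BF n" and r: "r \<le> face_filter n y"
    and y: "y \<in> topspace (CX n)"
  shows "bmult n q r \<le> face_filter n (bact n q y)"
  unfolding le_face_filter eventually_beta_mult
proof (intro allI impI)
  fix W assume W: "openin (CX n) W" "bact n q y \<in> W"
  have "\<forall>\<^sub>F f in q. cact n f y \<in> W"
    by (rule cub.eventually_beta_act[OF BF_carrier[OF q] y W])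
  then show "\<forall>\<^sub>F f in q. \<forall>\<^sub>F g in r. f \<star>\<^bsub>n\<^esub> g \<in> face_hits n W"
    using eventually_in_ultrafilter[OF q]
    by eventually_elim (rule face_hits_mult[OF _ W(1) y _ r])
qed

lemma face_filter_dup:
  assumes "r \<le> face_filter n (cube_diag n x)"
  shows "filtermap (cube_dup n) r \<le> face_filter (Suc n) (cube_diag (Suc n) x)"
  unfolding le_face_filter eventually_filtermap
proof (intro allI impI)
  fix W assume W: "openin (CX (Suc n)) W" "cube_diag (Suc n) x \<in> W"
  have cont: "continuous_map (CX n) (CX (Suc n)) (cube_dup n)"
    unfolding continuous_map_componentwise cube_dup_def
    by (auto intro: continuous_map_product_projection cube_Suc_Diff)
  have dup_diag: "cube_dup n (cube_diag n a) = cube_diag (Suc n) a" for a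
    by (rule cube_point_eqI[of _ "Suc n"]) (auto simp: cube_dup_def cube_Suc_Diff)
  let ?V = "{z \<in> topspace (CX n). cube_dup n z \<in> W}"
  have x: "x \<in> topspace X" using openin_subset[OF W(1)] W(2) by auto
  have "openin (CX n) ?V" by (rule openin_continuous_map_preimage[OF cont W(1)])
  moreover have "cube_diag n x \<in> ?V" using x W(2) by (simp add: dup_diag)
  ultimately have "\<forall>\<^sub>F f in r. f \<in> face_hits n ?V" using assms unfolding le_face_filter by blast
  then show "\<forall>\<^sub>F f in r. cube_dup n f \<in> face_hits (Suc n) W"
  proof eventually_elim
    case (elim f)
    then obtain a where a: "f \<in> FF n" "a \<in> topspace X" "cube_dup n (cact n f (cube_diag n a)) \<in> W"
      by (auto simp: face_hits_def)
    moreover have "cube_dup n (cact n f (cube_diag n a)) = cact (Suc n) (cube_dup n f) (cube_diag (Suc n) a)"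
      by (rule cube_point_eqI[of _ "Suc n"]) (auto simp: cube_dup_def cube_Suc_Diff)
    ultimately show ?case using Face_dup[OF a(1)] by (auto simp: face_hits_def)
  qed
qed

lemma face_filter_restrict:
  assumes r: "r \<le> face_filter (Suc n) y" and y: "y \<in> topspace (CX (Suc n))"
  shows "filtermap (\<lambda>f. restrict f (cube n)) r \<le> face_filter n (restrict y (cube n))"
  unfolding le_face_filter eventually_filtermap
proof (intro allI impI)
  fix W assume W: "openin (CX n) W" "restrict y (cube n) \<in> W"
  let ?V = "{z \<in> topspace (CX (Suc n)). restrict z (cube n) \<in> W}"
  have "openin (CX (Suc n)) ?V"
    by (rule openin_continuous_map_preimage[OF continuous_map_restrict_cube W(1)])
  then have "\<forall>\<^sub>F f in r. f \<in> face_hits (Suc n) ?V" using r y W(2) unfolding le_face_filter by blast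
  then show "\<forall>\<^sub>F f in r. restrict f (cube n) \<in> face_hits n W"
  proof eventually_elim
    case (elim f)
    then obtain a where a: "f \<in> FF (Suc n)" "a \<in> topspace X"
        "restrict (cact (Suc n) f (cube_diag (Suc n) a)) (cube n) \<in> W"
      by (auto simp: face_hits_def)
    moreover have "restrict (cact (Suc n) f (cube_diag (Suc n) a)) (cube n)
        = cact n (restrict f (cube n)) (cube_diag n a)"
      by (rule cube_point_eqI[of _ n]) (auto simp: cube_Suc_lower)
    ultimately show ?case using Face_restrict[OF a(1)] by (auto simp: face_hits_def)
  qed
qed


lemma face_filter_reach:
  assumes p: "p \<in> BF n" and x: "x \<in> topspace X"
  shows "p \<le> face_filter n (bact n p (cube_diag n x))"
  unfolding le_face_filter
proof (intro allI impI)
  fix W assume W: "openin (CX n) W" "bact n p (cube_diag n x) \<in> W"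
  have "\<forall>\<^sub>F f in p. cact n f (cube_diag n x) \<in> W"
    using x by (intro cub.eventually_beta_act[OF BF_carrier[OF p] _ W]) simp
  then show "\<forall>\<^sub>F f in p. f \<in> face_hits n W"
    using eventually_in_ultrafilter[OF p] by eventually_elim (rule face_hitsI[OF _ x])
qed

lemma bact_idempotent:
  assumes q: "q \<in> BF n" "\<And>\<epsilon>. \<epsilon> \<in> cube n - {{}} \<Longrightarrow> coord \<epsilon> q = u"
    and y: "y \<in> topspace (CX n)" and e: "\<epsilon> \<in> cube n" and fix_y: "act u (y \<epsilon>) = y \<epsilon>"
  shows "bact n q y \<epsilon> = y \<epsilon>"
proof (cases "\<epsilon> = {}")
  case True
  then show ?thesis using bact_empty[OF q(1) y] by simp
next
  case False
  then show ?thesis using bact_nth[OF BF_carrier[OF q(1)] y e] q(2) e fix_y by simp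
qed

text \<open>If the limit of face elements is \<open>u\<close> on the whole lower facet, then the base points can be
  taken to be \<open>x\<close> there, and the upper facet is reached by correcting the last face element.\<close>

lemma closure_of_face_orbit:
  assumes x: "x \<in> topspace X" and u: "u \<in> BT" "act u x = x"
    and s: "s \<in> BF (Suc n)" "s \<le> face_filter (Suc n) y"
    and coord_s: "\<And>\<epsilon>. \<epsilon> \<in> cube n - {{}} \<Longrightarrow> coord \<epsilon> s = u"
    and y: "y \<in> topspace (CX (Suc n))" "\<And>\<epsilon>. \<epsilon> \<in> cube n \<Longrightarrow> y \<epsilon> = x"
  shows "y \<in> CX (Suc n) closure_of
    ((\<lambda>f. cact (Suc n) f (cube_diag (Suc n) x)) ` FF (Suc n))"
  unfolding in_closure_of
proof (intro conjI allI impI y(1))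
  fix W assume W: "y \<in> W \<and> openin (CX (Suc n)) W"
  then obtain U where U: "\<And>\<epsilon>. \<epsilon> \<in> cube (Suc n) \<Longrightarrow> openin X (U \<epsilon>)"
      "y \<in> Pi\<^sub>E (cube (Suc n)) U" "Pi\<^sub>E (cube (Suc n)) U \<subseteq> W"
    unfolding openin_product_topology_alt by meson
  let ?P = "Pi\<^sub>E (cube (Suc n)) U"
  have open_P: "openin (CX (Suc n)) ?P" by (rule openin_cube_cylinder[OF U(1)])
  have "\<forall>\<^sub>F f in s. f \<in> face_hits (Suc n) ?P"
    using s(2) open_P U(2) unfolding le_face_filter by blast
  moreover have "\<forall>\<^sub>F f in s. \<forall>\<epsilon>\<in>cube n. \<phi> (f \<epsilon>) x \<in> U \<epsilon>"
  proof (rule eventually_ball_finite[OF finite_cube], rule ballI)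
    fix \<epsilon> assume e: "\<epsilon> \<in> cube n"
    have xU: "x \<in> U \<epsilon>" using PiE_mem[OF U(2) cube_Suc_lower[OF e]] y(2)[OF e] by simp
    show "\<forall>\<^sub>F f in s. \<phi> (f \<epsilon>) x \<in> U \<epsilon>"
    proof (cases "\<epsilon> = {}")
      case True
      show ?thesis
        using eventually_in_ultrafilter[OF s(1)]
        by eventually_elim (use True xU x in \<open>simp add: base.act_one\<close>)
    next
      case False
      have "\<forall>\<^sub>F t in u. \<phi> t x \<in> U \<epsilon>"
        using base.eventually_beta_act[OF u(1) x U(1)[OF cube_Suc_lower[OF e]]] u(2) xU by simp
      then have "\<forall>\<^sub>F t in coord \<epsilon> s. \<phi> t x \<in> U \<epsilon>" using coord_s False e by simp
      then show ?thesis by (simp add: coord_def eventually_filtermap)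
    qed
  qed
  ultimately have "\<forall>\<^sub>F f in s. f \<in> face_hits (Suc n) ?P \<and> (\<forall>\<epsilon>\<in>cube n. \<phi> (f \<epsilon>) x \<in> U \<epsilon>)"
    by (rule eventually_conj)
  moreover have "s \<noteq> bot" using s(1) by (simp add: ultrafilters_def)
  ultimately obtain f where f: "f \<in> face_hits (Suc n) ?P" "\<And>\<epsilon>. \<epsilon> \<in> cube n \<Longrightarrow> \<phi> (f \<epsilon>) x \<in> U \<epsilon>"
    using eventually_happens by blast
  then obtain a where fF: "f \<in> FF (Suc n)" and a: "a \<in> topspace X"
      "cact (Suc n) f (cube_diag (Suc n) a) \<in> ?P"
    by (auto simp: face_hits_def)
  have fK: "f \<in> KK (Suc n)" using fF FF_carrier by blast
  let ?V = "{b \<in> topspace X. cact (Suc n) f (cube_diag (Suc n) b) \<in> ?P}"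
  have open_V: "openin X ?V"
    using openin_continuous_map_preimage[OF continuous_map_compose[OF continuous_map_cube_diag
          cub.act_continuous[OF fK]] open_P] by (simp add: o_def)
  have "a \<in> ?V" using a by simp
  then obtain t where "t \<in> carrier T" "\<phi> t x \<in> ?V"
    by (rule orbit_meets[OF x a(1) open_V])
  then have t: "t \<in> carrier T" "cact (Suc n) f (cube_diag (Suc n) (\<phi> t x)) \<in> ?P" by simp_all
  \<comment> \<open>On the upper facet f' applied to x gives f (t x), where f is known to land in
    the cylinder. On the lower facet it gives f x, already near y by the condition on the
    coordinates of s.\<close>
  define f' where "f' = f \<star>\<^bsub>Suc n\<^esub>
    face_element (Suc n) T t {\<epsilon> \<in> cube (Suc n). Suc n \<in> \<epsilon>}"
  have "f' \<in> FF (Suc n)"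
    unfolding f'_def by (rule FF_mult[OF fF face_element_top_in_Face[OF t(1)]])
  moreover have "cact (Suc n) f' (cube_diag (Suc n) x) \<in> ?P"
  proof (rule PiE_I)
    fix \<epsilon> assume e: "\<epsilon> \<in> cube (Suc n)"
    have fe: "f \<epsilon> \<in> carrier T" by (rule cube_group_nth[OF fK e])
    show "cact (Suc n) f' (cube_diag (Suc n) x) \<epsilon> \<in> U \<epsilon>"
    proof (cases "Suc n \<in> \<epsilon>")
      case True
      then show ?thesis
        using e PiE_mem[OF t(2) e] base.act_mult[OF fe t(1) x] by (simp add: f'_def face_element_def)
    next
      case False
      then have "\<epsilon> \<in> cube n" using cube_Suc_Diff[OF e] by simp
      then show ?thesis using e f(2) fe False by (simp add: f'_def face_element_def)
    qed
  qed (auto simp: cube_act_def)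
  ultimately show "\<exists>z. z \<in> (\<lambda>f. cact (Suc n) f (cube_diag (Suc n) x)) ` FF (Suc n) \<and> z \<in> W"
    using U(3) by blast
qed

text \<open>Let \<open>y\<close> be a limit of \<open>f a\<^sup>[\<^sup>n\<^sup>+\<^sup>1\<^sup>]\<close> as \<open>f \<rightarrow> r\<close>. The ultrafilters below \<open>E\<close> form a closed semigroup, and
  multiplying \<open>r\<close> on the right by the duplicate of one of them does not lose \<open>y\<close>. A suitable factor
  makes the coordinates on the lower facet idempotent, and a factor on the left turns them into \<open>u\<close>.\<close>

lemma contract_upper_facet:
  assumes y: "y \<in> QF (Suc n)" "\<And>\<epsilon>. \<epsilon> \<in> cube n \<Longrightarrow> y \<epsilon> = x" and x: "x \<in> topspace X"
  obtains p where "p \<in> BF (Suc n)" "bact (Suc n) p y = cube_diag (Suc n) x"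
proof -
  obtain u where u: "u \<in> M" "bmul u u = u" "act u x = x"
    by (rule idempotent_fixing_point[OF x])
  have u': "u \<in> BT" using u(1) by (rule ideal.ideal_mem)
  have yp: "y \<in> topspace (CX (Suc n))" by (rule QF_point[OF y(1)])
  let ?D = "cube_diag n x"
  have D: "?D \<in> topspace (CX n)" using x by simp
  define E where "E = face_filter n ?D"
  have EF: "E \<le> principal (FF n)" unfolding E_def by (rule face_filter_le_FF[OF D])
  have E_mult: "bmult n s t \<le> E" if "s \<le> E" "t \<le> E" for s t
    using that unfolding E_def by (intro face_filter_mult[OF _ D _ x])
  obtain r where r: "ultra r" "r \<le> face_filter (Suc n) y"
    using ultra_exists[OF face_filter_not_bot[OF y(1)]] .
  have rF: "r \<in> BF (Suc n)"
    using r face_filter_le_FF[OF yp] by (simp add: ultrafilters_iff)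
  define r' where "r' = filtermap (\<lambda>f. restrict f (cube n)) r"
  have r'F: "r' \<in> BF n"
    unfolding r'_def by (rule filtermap_ultrafilters[OF rF]) (use Face_restrict in blast)
  have coord_r': "coord \<epsilon> r' = coord \<epsilon> r" if "\<epsilon> \<in> cube n" for \<epsilon>
    using that by (simp add: r'_def coord_def filtermap_filtermap)
  have "restrict y (cube n) = ?D"
    by (rule cube_point_eqI[of _ n]) (auto simp: y(2))
  then have r'E: "r' \<le> E"
    using face_filter_restrict[OF r(2) yp] by (simp add: E_def r'_def)
  obtain q where q: "q \<in> BF n" "\<And>\<epsilon>. \<epsilon> \<in> cube n - {{}} \<Longrightarrow> coord \<epsilon> q = u"
    using face_idempotent_exists[OF u(1,2), of n] by blast
  have qE: "q \<le> E"
  proof -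
    have "bact n q ?D = ?D"
    proof (rule cube_point_eqI[of _ n])
      show "bact n q ?D \<in> extensional (cube n)"
        using bact_closed[OF BF_carrier[OF q(1)] D] by (simp add: cube_point_iff)
      show "bact n q ?D \<epsilon> = ?D \<epsilon>" if "\<epsilon> \<in> cube n" for \<epsilon>
        using bact_idempotent[OF q D that] that u(3) by simp
    qed simp
    then show ?thesis using face_filter_reach[OF q(1) x] by (simp add: E_def)
  qed
  \<comment> \<open>The left ideal E q contains p, so some e in it makes e p idempotent. After
    \<open>idempotent_swap\<close> this e serves as a factor on the right.\<close>
  define \<psi> where "\<psi> = bmult n E q"
  define p where "p = bmult n r' q"
  have pF: "p \<in> BF n" unfolding p_def by (rule BF_mult[OF r'F q(1)])
  have car: "E \<le> principal (KK n)" "q \<le> principal (KK n)"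
    using order_trans[OF EF] BF_carrier[OF q(1)] FF_carrier by (auto simp: ultrafilters_iff)
  have \<psi>E: "\<psi> \<le> E" unfolding \<psi>_def by (rule E_mult[OF order_refl qE])
  have "bmult n \<psi> \<psi> \<le> bmult n E \<psi>" by (rule beta_mult_mono[OF \<psi>E order_refl])
  also have "\<dots> = bmult n (bmult n E E) q"
    unfolding \<psi>_def using car by (simp add: monoid.beta_mult_assoc[OF monoid_cube_group])
  also have "\<dots> \<le> \<psi>"
    unfolding \<psi>_def by (rule beta_mult_mono[OF E_mult[OF order_refl order_refl] order_refl])
  finally have \<psi>\<psi>: "bmult n \<psi> \<psi> \<le> \<psi>" .
  have "p \<le> \<psi>" unfolding p_def \<psi>_def by (rule beta_mult_mono[OF r'E order_refl])
  then obtain e where e: "ultra e" "e \<le> \<psi>" "bmult n (bmult n e p) (bmult n e p) = bmult n e p"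
    using monoid.idempotent_in_left_ideal[OF monoid_cube_group ultraD[OF pF] _ _ \<psi>\<psi>]
      order_trans[OF \<psi>E car(1)] by blast
  have eE: "e \<le> E" using e(2) \<psi>E by simp
  have eF: "e \<in> BF n" using e(1) eE EF by (simp add: ultrafilters_iff)
  \<comment> \<open>Factoring e through q shows that its coordinates at nonempty vertices lie in M,
    as the swap requires.\<close>
  obtain e' where e': "ultra e'" "e' \<le> E" "bmult n e' q = e"
    using beta_mult_factor[OF e(1) e(2)[unfolded \<psi>_def] ultraD[OF q(1)]] .
  have e'F: "e' \<in> BF n" using e' EF by (simp add: ultrafilters_iff)
  \<comment> \<open>The additional q supplies the u between the coordinates of r' and e, giving r' u
    e = a b in the notation below.\<close>
  define e1 where "e1 = bmult n q e"
  have e1F: "e1 \<in> BF n" unfolding e1_def by (rule BF_mult[OF q(1) eF])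
  have e1E: "e1 \<le> E" unfolding e1_def by (rule E_mult[OF qE eE])
  define d where "d = filtermap (cube_dup n) e1"
  have dF: "d \<in> BF (Suc n)" unfolding d_def by (rule dup_filter(1)[OF e1F])
  obtain q' where q': "q' \<in> BF (Suc n)" "\<And>\<epsilon>. \<epsilon> \<in> cube (Suc n) - {{}} \<Longrightarrow> coord \<epsilon> q' = u"
    using face_idempotent_exists[OF u(1,2), of "Suc n"] by blast
  \<comment> \<open>The right factor d keeps the limit y and makes the lower coordinates idempotents
    a b. The left factor q' turns these into u (a b) = u; it moves y to y', which is still x on the
    lower facet.\<close>
  define s where "s = bmult (Suc n) q' (bmult (Suc n) r d)"
  have rdF: "bmult (Suc n) r d \<in> BF (Suc n)" by (rule BF_mult[OF rF dF])
  have sF: "s \<in> BF (Suc n)" unfolding s_def by (rule BF_mult[OF q'(1) rdF])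
  define y' where "y' = bact (Suc n) q' y"
  have y'p: "y' \<in> topspace (CX (Suc n))"
    unfolding y'_def by (rule bact_closed[OF BF_carrier[OF q'(1)] yp])
  have "d \<le> face_filter (Suc n) (cube_diag (Suc n) x)"
    unfolding d_def by (rule face_filter_dup[OF e1E[unfolded E_def]])
  then have "bmult (Suc n) r d \<le> face_filter (Suc n) y"
    by (rule face_filter_mult[OF r(2) yp _ x])
  then have s_le: "s \<le> face_filter (Suc n) y'"
    unfolding s_def y'_def by (rule face_filter_act[OF q'(1) _ yp])
  have y'_lower: "y' \<epsilon> = x" if "\<epsilon> \<in> cube n" for \<epsilon>
    unfolding y'_def using bact_idempotent[OF q' yp cube_Suc_lower[OF that]] y(2)[OF that] u(3) by simp
  have coord_s: "coord \<epsilon> s = u" if \<epsilon>: "\<epsilon> \<in> cube n - {{}}" for \<epsilon>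
  proof -
    have \<epsilon>n: "\<epsilon> \<in> cube n" and \<epsilon>Sn: "\<epsilon> \<in> cube (Suc n)" "\<epsilon> \<in> cube (Suc n) - {{}}"
      using \<epsilon> cube_Suc_lower by auto
    define a where "a = bmul (coord \<epsilon> r') u"
    define b where "b = coord \<epsilon> e"
    have cr': "coord \<epsilon> r' \<in> BT" by (rule coord_ultrafilter[OF BF_carrier[OF r'F] \<epsilon>n])
    have aM: "a \<in> M" unfolding a_def by (rule ideal.ideal_closed[OF cr' u(1)])
    have bM: "b \<in> M"
      unfolding b_def e'(3)[symmetric]
      by (rule coord_in_M[OF BF_carrier[OF e'F] BF_carrier[OF q(1)] \<epsilon>n]) (simp add: q(2)[OF \<epsilon>] u(1))
    have "coord \<epsilon> p = a"
      unfolding p_def a_def by (simp add: coord_mult[OF BF_carrier[OF r'F] BF_carrier[OF q(1)] \<epsilon>n] q(2)[OF \<epsilon>])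
    then have "coord \<epsilon> (bmult n e p) = bmul b a"
      by (simp add: coord_mult[OF BF_carrier[OF eF] BF_carrier[OF pF] \<epsilon>n] b_def)
    then have "bmul (bmul b a) (bmul b a) = bmul b a"
      using e(3) coord_mult[OF BF_carrier[OF BF_mult[OF eF pF]] BF_carrier[OF BF_mult[OF eF pF]] \<epsilon>n] by simp
    then have idem: "bmul (bmul a b) (bmul a b) = bmul a b"
      by (rule ideal.idempotent_swap[OF u(1,2) aM bM])
    have abM: "bmul a b \<in> M" by (rule ideal.ideal_closed[OF ideal.ideal_mem[OF aM] bM])
    have "coord \<epsilon> d = bmul u b"
    proof -
      have "\<epsilon> - {Suc n} = \<epsilon>" using cube_Suc_notin[OF \<epsilon>n] by blast
      then have "coord \<epsilon> d = coord \<epsilon> e1"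
        unfolding d_def using dup_filter(2)[OF e1F \<epsilon>Sn(1)] by simp
      then show ?thesis
        unfolding e1_def b_def
        by (simp add: coord_mult[OF BF_carrier[OF q(1)] BF_carrier[OF eF] \<epsilon>n] q(2)[OF \<epsilon>])
    qed
    then have "coord \<epsilon> s = bmul u (bmul (coord \<epsilon> r') (bmul u b))"
      unfolding s_def
      by (simp add: coord_mult[OF BF_carrier[OF q'(1)] BF_carrier[OF rdF] \<epsilon>Sn(1)]
          coord_mult[OF BF_carrier[OF rF] BF_carrier[OF dF] \<epsilon>Sn(1)] q'(2)[OF \<epsilon>Sn(2)] coord_r'[OF \<epsilon>n])
    also have "\<dots> = bmul u (bmul a b)"
      unfolding a_def by (simp add: beta_assoc[OF cr' u' ideal.ideal_mem[OF bM]])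
    also have "\<dots> = u" by (rule ideal.idempotent_right_identity[OF abM idem u(1)])
    finally show ?thesis .
  qed
  have "y' \<in> CX (Suc n) closure_of
    ((\<lambda>f. cact (Suc n) f (cube_diag (Suc n) x)) ` FF (Suc n))"
    by (rule closure_of_face_orbit[OF x u' u(3) sF s_le coord_s y'p y'_lower])
  then obtain p1 where p1: "p1 \<in> BF (Suc n)" "bact (Suc n) p1 (cube_diag (Suc n) x) = y'"
    by (rule cub.closure_of_orbit_imp_beta_act[OF FF_carrier])
  \<comment> \<open>Since y' is reached from x^[n+1] with a constant base point,
    \<open>face_return\<close> leads back.\<close>
  obtain p2 where p2: "p2 \<in> BF (Suc n)"
      "bact (Suc n) p2 (bact (Suc n) p1 (cube_diag (Suc n) x)) = cube_diag (Suc n) x"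
    using face_return[OF u(1,2) _ _ p1(1), of "cube_diag (Suc n) x"] x u(3) by auto
  have "bact (Suc n) (bmult (Suc n) p2 q') y = cube_diag (Suc n) x"
    using cub.beta_act_mult[OF BF_carrier[OF p2(1)] BF_carrier[OF q'(1)] yp] p1(2) p2(2)
    by (simp add: y'_def)
  then show ?thesis using that BF_mult[OF p2(1) q'(1)] by blast
qed

text \<open>The contraction of the lower facet is duplicated so that it acts as a face element on
  the whole cube; the upper facet is then the remaining case of
  \<open>contract_upper_facet\<close>.\<close>

theorem QF_contract:
  "y \<in> QF n \<Longrightarrow> \<exists>p\<in>BF n. bact n p y = cube_diag n (y {})"
proof (induction n arbitrary: y)
  case 0
  have yp: "y \<in> topspace (CX 0)" by (rule QF_point[OF 0])
  have "y = cube_diag 0 (y {})"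
  proof (rule cube_point_eqI[of _ 0])
    show "y \<in> extensional (cube 0)" using yp by (simp add: cube_point_iff)
    fix \<epsilon> assume "\<epsilon> \<in> cube 0"
    moreover from this have "\<epsilon> = {}" by (auto simp: cube_def)
    ultimately show "y \<epsilon> = cube_diag 0 (y {}) \<epsilon>" by simp
  qed simp
  moreover have "bact 0 (principal {\<one>\<^bsub>cube_group 0 T\<^esub>}) y = y"
    using cub.beta_act_principal[OF _ yp, of "\<one>\<^bsub>cube_group 0 T\<^esub>"] cub.act_one[OF yp]
      monoid.one_closed[OF monoid_cube_group] by simp
  moreover have "principal {\<one>\<^bsub>cube_group 0 T\<^esub>} \<in> BF 0"
    using subgroup.one_closed[OF subgroup_Face] by simp
  ultimately show ?case by metis
next
  case (Suc n)
  have yp: "y \<in> topspace (CX (Suc n))" by (rule QF_point[OF Suc.prems])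
  have lp: "restrict y (cube n) \<in> topspace (CX n)" by (rule QF_point[OF QF_lower[OF Suc.prems]])
  obtain p where p: "p \<in> BF n" "bact n p (restrict y (cube n)) = cube_diag n (y {})"
    using Suc.IH[OF QF_lower[OF Suc.prems], unfolded restrict_apply'[OF cube_empty]] by blast
  define d where "d = filtermap (cube_dup n) p"
  have dF: "d \<in> BF (Suc n)" unfolding d_def by (rule dup_filter(1)[OF p(1)])
  have x: "y {} \<in> topspace X" by (rule cube_point_nth[OF yp cube_empty])
  have lower: "bact (Suc n) d y \<epsilon> = y {}" if \<epsilon>: "\<epsilon> \<in> cube n" for \<epsilon>
  proof -
    have "\<epsilon> - {Suc n} = \<epsilon>" using cube_Suc_notin[OF \<epsilon>] by blast
    then have "bact (Suc n) d y \<epsilon> = act (coord \<epsilon> p) (y \<epsilon>)"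
      using bact_nth[OF BF_carrier[OF dF] yp cube_Suc_lower[OF \<epsilon>]]
        dup_filter(2)[OF p(1) cube_Suc_lower[OF \<epsilon>]] by (simp add: d_def)
    also have "\<dots> = bact n p (restrict y (cube n)) \<epsilon>"
      using bact_nth[OF BF_carrier[OF p(1)] lp \<epsilon>] \<epsilon> by simp
    finally show ?thesis using p(2) \<epsilon> by simp
  qed
  obtain p' where p': "p' \<in> BF (Suc n)"
      "bact (Suc n) p' (bact (Suc n) d y) = cube_diag (Suc n) (y {})"
    using contract_upper_facet[OF QF_bact[OF dF Suc.prems] lower x] .
  have "bact (Suc n) (bmult (Suc n) p' d) y = cube_diag (Suc n) (y {})"
    using cub.beta_act_mult[OF BF_carrier[OF p'(1)] BF_carrier[OF dF] yp] p'(2) by simp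
  then show ?case using BF_mult[OF p'(1) dF] by blast
qed

end

section \<open>Regional proximality\<close>

definition corner :: "nat \<Rightarrow> 'x \<Rightarrow> 'x \<Rightarrow> nat set \<Rightarrow> 'x" where
  "corner n x y = (\<lambda>\<epsilon>\<in>cube n. if \<epsilon> = {} then x else y)"

definition cube_join :: "nat \<Rightarrow> (nat set \<Rightarrow> 'x) \<Rightarrow> (nat set \<Rightarrow> 'x) \<Rightarrow> nat set \<Rightarrow> 'x" where
  "cube_join n z w = (\<lambda>\<epsilon>\<in>cube (Suc n). if Suc n \<in> \<epsilon> then w (\<epsilon> - {Suc n}) else z \<epsilon>)"

lemma corner_nth: "\<epsilon> \<in> cube n \<Longrightarrow> corner n x y \<epsilon> = (if \<epsilon> = {} then x else y)"
  by (simp add: corner_def)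

lemma corner_same: "corner n x x = cube_diag n x"
  by (simp add: corner_def cube_diag_def)

lemma cube_insert: "\<epsilon> \<in> cube n \<Longrightarrow> insert (Suc n) \<epsilon> \<in> cube (Suc n)"
  by (auto simp: cube_def)

context minimal_cube_system
begin

lemma cube_join_dup:
  assumes "f \<in> KK n" "t \<in> carrier T" "a \<in> topspace X"
  shows "cube_join n (cact n f (cube_diag n a)) (cact n f (cube_diag n (\<phi> t a)))
    = cact (Suc n) (cube_dup n f \<star>\<^bsub>Suc n\<^esub>
        face_element (Suc n) T t {\<epsilon> \<in> cube (Suc n). Suc n \<in> \<epsilon>}) (cube_diag (Suc n) a)"
proof (rule cube_point_eqI[of _ "Suc n"])
  fix \<epsilon> assume e: "\<epsilon> \<in> cube (Suc n)"
  have e': "\<epsilon> - {Suc n} \<in> cube n" by (rule cube_Suc_Diff[OF e])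
  have fe: "f (\<epsilon> - {Suc n}) \<in> carrier T" by (rule cube_group_nth[OF assms(1) e'])
  show "cube_join n (cact n f (cube_diag n a)) (cact n f (cube_diag n (\<phi> t a))) \<epsilon>
    = cact (Suc n) (cube_dup n f \<star>\<^bsub>Suc n\<^esub>
        face_element (Suc n) T t {\<epsilon> \<in> cube (Suc n). Suc n \<in> \<epsilon>}) (cube_diag (Suc n) a) \<epsilon>"
    using e e' fe assms(2,3)
    by (cases "Suc n \<in> \<epsilon>") (simp_all add: cube_join_def cube_dup_def face_element_def base.act_mult)
qed (auto simp: cube_join_def)

text \<open>For b = t a the join is one face element applied to a^[n+1], with t on the upper facet.
  Other b follow by minimality, as the join is continuous in b and \<open>QF\<close> is
  closed.\<close>

lemma cube_join_in_QF:
  assumes f: "f \<in> FF n" and a: "a \<in> topspace X" and b: "b \<in> topspace X"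
  shows "cube_join n (cact n f (cube_diag n a)) (cact n f (cube_diag n b)) \<in> QF (Suc n)"
proof -
  let ?J = "\<lambda>b. cube_join n (cact n f (cube_diag n a)) (cact n f (cube_diag n b))"
  have fK: "f \<in> KK n" using f FF_carrier by blast
  have "continuous_map X (CX (Suc n)) ?J"
    unfolding continuous_map_componentwise
  proof (intro conjI ballI)
    fix \<epsilon> assume e: "\<epsilon> \<in> cube (Suc n)"
    have e': "\<epsilon> - {Suc n} \<in> cube n" by (rule cube_Suc_Diff[OF e])
    show "continuous_map X X (\<lambda>b. ?J b \<epsilon>)"
    proof (cases "Suc n \<in> \<epsilon>")
      case True
      then show ?thesis
        using e e' base.act_continuous[OF cube_group_nth[OF fK e']] by (simp add: cube_join_def)
    next
      case False
      then show ?thesis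
        using e e' a base.act_closed[OF cube_group_nth[OF fK e']] by (simp add: cube_join_def)
    qed
  qed (auto simp: cube_join_def)
  then have "?J ` (X closure_of ((\<lambda>t. \<phi> t a) ` carrier T))
      \<subseteq> CX (Suc n) closure_of (?J ` ((\<lambda>t. \<phi> t a) ` carrier T))"
    by (rule continuous_map_image_closure_subset)
  also have "\<dots> \<subseteq> QF (Suc n)"
  proof (rule closure_of_minimal[OF _ QF_closed], clarify)
    fix t assume t: "t \<in> carrier T"
    show "?J (\<phi> t a) \<in> QF (Suc n)"
      unfolding cube_join_dup[OF fK t a]
      by (intro QF_generator[OF FF_mult[OF Face_dup[OF f] face_element_top_in_Face[OF t]] a])
  qed
  finally show ?thesis using dense_orbit[OF a b] by blast
qed

text \<open>The two limit cubes join to a point of \<open>QF (Suc d)\<close>. Contracting the cube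
  with y at {} and duplicating the contraction sends every coordinate to y except the one at {},
  which stays x.\<close>

lemma RP_imp_corner:
  assumes "(x, y) \<in> RP d T X \<phi>"
  shows "corner (Suc d) x y \<in> QF (Suc d)"
proof -
  obtain F :: "((nat set \<Rightarrow> 't) \<times> 'x \<times> 'x) filter" and w
    where x: "x \<in> topspace X" and y: "y \<in> topspace X" and F: "F \<noteq> bot"
      and FF: "F \<le> principal (FF d \<times> topspace X \<times> topspace X)"
      and l1: "limitin (CX d) (\<lambda>(f, a, b). cact d f (cube_diag d a)) (w({} := x)) F"
      and l2: "limitin (CX d) (\<lambda>(f, a, b). cact d f (cube_diag d b)) (w({} := y)) F"
    using assms unfolding RP_def by blast
  define z where "z = cube_join d (w({} := x)) (w({} := y))"
  have ev: "\<forall>\<^sub>F c in F. c \<in> FF d \<times> topspace X \<times> topspace X" using FF by (simp add: le_principal)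
  have "z \<in> QF (Suc d)"
  proof (rule limitin_closedin[OF _ QF_closed _ F])
    let ?J = "\<lambda>(f, a, b). cube_join d (cact d f (cube_diag d a)) (cact d f (cube_diag d b))"
    show evJ: "\<forall>\<^sub>F c in F. ?J c \<in> QF (Suc d)"
      using ev by eventually_elim (auto intro: cube_join_in_QF)
    show "limitin (CX (Suc d)) ?J z F"
      unfolding limitin_componentwise
    proof (intro conjI ballI)
      show "\<forall>\<^sub>F c in F. ?J c \<in> topspace (CX (Suc d))"
        using evJ by eventually_elim (rule QF_point)
      fix \<epsilon> assume e: "\<epsilon> \<in> cube (Suc d)"
      have e': "\<epsilon> - {Suc d} \<in> cube d" by (rule cube_Suc_Diff[OF e])
      show "limitin X (\<lambda>c. ?J c \<epsilon>) (z \<epsilon>) F"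
      proof (cases "Suc d \<in> \<epsilon>")
        case True
        have "limitin X (\<lambda>c. (\<lambda>(f, a, b). cact d f (cube_diag d b)) c (\<epsilon> - {Suc d}))
            ((w({} := y)) (\<epsilon> - {Suc d})) F"
          using l2 e' unfolding limitin_componentwise by blast
        then show ?thesis
          using True e by (simp add: z_def cube_join_def case_prod_beta)
      next
        case False
        then have e'': "\<epsilon> \<in> cube d" using e' by simp
        have "limitin X (\<lambda>c. (\<lambda>(f, a, b). cact d f (cube_diag d a)) c \<epsilon>) ((w({} := x)) \<epsilon>) F"
          using l1 e'' unfolding limitin_componentwise by blast
        then show ?thesis
          using False e by (simp add: z_def cube_join_def case_prod_beta)
      qed
    qed (simp add: z_def cube_join_def)
  qed
  have zp: "z \<in> topspace (CX (Suc d))" by (rule QF_point[OF \<open>z \<in> QF (Suc d)\<close>])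
  have w: "w({} := y) \<in> QF d"
  proof (rule limitin_closedin[OF l2 QF_closed _ F])
    show "\<forall>\<^sub>F c in F. (\<lambda>(f, a, b). cact d f (cube_diag d b)) c \<in> QF d"
      using ev by eventually_elim (auto intro: QF_generator)
  qed
  obtain p where p: "p \<in> BF d" "bact d p (w({} := y)) = cube_diag d y"
    using QF_contract[OF w] by auto
  have act_w: "act (coord \<epsilon> p) ((w({} := y)) \<epsilon>) = y" if "\<epsilon> \<in> cube d" for \<epsilon>
    using bact_nth[OF BF_carrier[OF p(1)] QF_point[OF w] that] p(2) that by simp
  define q where "q = filtermap (cube_dup d) p"
  have q: "q \<in> BF (Suc d)" unfolding q_def by (rule dup_filter(1)[OF p(1)])
  have "bact (Suc d) q z = corner (Suc d) x y"
  proof (rule cube_point_eqI[of _ "Suc d"])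
    show "bact (Suc d) q z \<in> extensional (cube (Suc d))"
      using bact_closed[OF BF_carrier[OF q] zp] by (simp add: cube_point_iff)
    fix \<epsilon> assume e: "\<epsilon> \<in> cube (Suc d)"
    have e': "\<epsilon> - {Suc d} \<in> cube d" by (rule cube_Suc_Diff[OF e])
    show "bact (Suc d) q z \<epsilon> = corner (Suc d) x y \<epsilon>"
    proof (cases "\<epsilon> = {}")
      case True
      then show ?thesis using bact_empty[OF q zp] by (simp add: corner_nth z_def cube_join_def)
    next
      case False
      have "bact (Suc d) q z \<epsilon> = act (coord (\<epsilon> - {Suc d}) p) (z \<epsilon>)"
        using bact_nth[OF BF_carrier[OF q] zp e] dup_filter(2)[OF p(1) e] by (simp add: q_def)
      \<comment> \<open>The limit cubes differ at {} alone, so away from {} the join does not see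
        which facet the vertex is on.\<close>
      moreover have "z \<epsilon> = (w({} := y)) (\<epsilon> - {Suc d})"
        using e False by (auto simp: z_def cube_join_def)
      ultimately show ?thesis using act_w[OF e'] e False by (simp add: corner_nth)
    qed
  qed (simp add: corner_def)
  then show ?thesis using QF_bact[OF q \<open>z \<in> QF (Suc d)\<close>] by simp
qed

text \<open>The required filter consists of triples (f, a, b) whose joins approach the corner;
  generators of \<open>QF (Suc d)\<close> provide them with b = t a. The two facets of the corner
  share the constant value y off {}.\<close>

lemma corner_imp_RP:
  assumes c: "corner (Suc d) x y \<in> QF (Suc d)" and x: "x \<in> topspace X" and y: "y \<in> topspace X"
  shows "(x, y) \<in> RP d T X \<phi>"
proof -
  let ?Z = "CX (Suc d)"
  let ?J = "\<lambda>(f, a, b). cube_join d (cact d f (cube_diag d a)) (cact d f (cube_diag d b))"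
  define D where "D W = {c \<in> FF d \<times> topspace X \<times> topspace X. ?J c \<in> W}" for W
  define F where "F = nbhd_pull ?Z (corner (Suc d) x y) D"
  define w where "w = (\<lambda>\<epsilon>\<in>cube d. y)"
  have cZ: "corner (Suc d) x y \<in> topspace ?Z" by (rule QF_point[OF c])
  have D: "\<forall>\<^sub>F s in F. s \<in> D W" if "openin ?Z W" "corner (Suc d) x y \<in> W" for W
    using order_refl[of F] that unfolding F_def le_nbhd_pull by blast
  have "F \<noteq> bot"
    unfolding F_def
  proof (rule nbhd_pull_not_bot[OF cZ])
    show "D W \<subseteq> D W'" if "W \<subseteq> W'" for W W' using that by (auto simp: D_def)
    show "D W \<noteq> {}" if W: "openin ?Z W" "corner (Suc d) x y \<in> W" for W
    proof -
      obtain z where "z \<in> {cact (Suc d) f (cube_diag (Suc d) a) |f a. f \<in> FF (Suc d) \<and> a \<in> topspace X}"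
          "z \<in> W"
        using c[unfolded QF_def in_closure_of, THEN conjunct2, rule_format, OF conjI[OF W(2,1)]] by auto
      then obtain f a where f: "f \<in> FF (Suc d)" and a: "a \<in> topspace X"
          "cact (Suc d) f (cube_diag (Suc d) a) \<in> W" by blast
      obtain t where t: "t \<in> carrier T" "f = cube_dup d (restrict f (cube d)) \<star>\<^bsub>Suc d\<^esub>
          face_element (Suc d) T t {\<epsilon> \<in> cube (Suc d). Suc d \<in> \<epsilon>}"
        using Face_Suc_decompose[OF f] .
      have r: "restrict f (cube d) \<in> FF d" by (rule Face_restrict[OF f])
      have "?J (restrict f (cube d), a, \<phi> t a) = cact (Suc d) f (cube_diag (Suc d) a)"
        using cube_join_dup[OF subsetD[OF FF_carrier r] t(1) a(1)] t(2) by simp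
      then have "(restrict f (cube d), a, \<phi> t a) \<in> D W"
        using r a base.act_closed[OF t(1) a(1)] unfolding D_def by simp
      then show ?thesis by blast
    qed
  qed
  moreover have "F \<le> principal (FF d \<times> topspace X \<times> topspace X)"
    unfolding le_principal using D[OF openin_topspace cZ] by eventually_elim (simp add: D_def)
  moreover have "limitin (CX d) (\<lambda>(f, a, b). cact d f (cube_diag d a)) (w({} := x)) F"
    unfolding limitin_def
  proof (intro conjI allI impI)
    have lower: "restrict (corner (Suc d) x y) (cube d) = w({} := x)"
      using cube_empty by (fastforce simp: w_def corner_def cube_Suc_lower)
    show "w({} := x) \<in> topspace (CX d)"
      using x y by (auto simp: cube_point_iff w_def extensional_def)
    fix W assume W: "openin (CX d) W \<and> w({} := x) \<in> W"
    let ?V = "{z \<in> topspace ?Z. restrict z (cube d) \<in> W}"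
    have "openin ?Z ?V"
      by (rule openin_continuous_map_preimage[OF continuous_map_restrict_cube conjunct1[OF W]])
    moreover have "corner (Suc d) x y \<in> ?V" using cZ W lower by simp
    ultimately have "\<forall>\<^sub>F s in F. s \<in> D ?V" by (rule D)
    then show "\<forall>\<^sub>F c in F. (\<lambda>(f, a, b). cact d f (cube_diag d a)) c \<in> W"
    proof eventually_elim
      case (elim c)
      obtain f a b where c: "c = (f, a, b)" by (cases c) auto
      have "restrict (?J c) (cube d) = cact d f (cube_diag d a)"
        by (rule cube_point_eqI[of _ d]) (auto simp: c cube_join_def cube_Suc_lower cube_Suc_notin)
      then show ?case using elim unfolding D_def c by auto
    qed
  qed
  moreover have "limitin (CX d) (\<lambda>(f, a, b). cact d f (cube_diag d b)) (w({} := y)) F"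
    unfolding limitin_def
  proof (intro conjI allI impI)
    let ?up = "\<lambda>z. \<lambda>\<epsilon>\<in>cube d. z (insert (Suc d) \<epsilon>)"
    have cont: "continuous_map ?Z (CX d) ?up"
      unfolding continuous_map_componentwise
      by (auto intro: continuous_map_product_projection cube_insert)
    have upper: "?up (corner (Suc d) x y) = w({} := y)"
      using cube_empty by (fastforce simp: w_def corner_def cube_insert)
    show "w({} := y) \<in> topspace (CX d)"
      using x y by (auto simp: cube_point_iff w_def extensional_def)
    fix W assume W: "openin (CX d) W \<and> w({} := y) \<in> W"
    let ?V = "{z \<in> topspace ?Z. ?up z \<in> W}"
    have "openin ?Z ?V"
      by (rule openin_continuous_map_preimage[OF cont conjunct1[OF W]])
    moreover have "corner (Suc d) x y \<in> ?V" using cZ W upper by simp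
    ultimately have "\<forall>\<^sub>F s in F. s \<in> D ?V" by (rule D)
    then show "\<forall>\<^sub>F c in F. (\<lambda>(f, a, b). cact d f (cube_diag d b)) c \<in> W"
    proof eventually_elim
      case (elim c)
      obtain f a b where c: "c = (f, a, b)" by (cases c) auto
      have "?up (?J c) = cact d f (cube_diag d b)"
        by (rule cube_point_eqI[of _ d]) (auto simp: c cube_join_def cube_insert cube_Suc_notin)
      then show ?case using elim unfolding D_def c by auto
    qed
  qed
  ultimately show ?thesis using x y unfolding RP_def by blast
qed

lemma RP_iff_corner:
  "(x, y) \<in> RP d T X \<phi> \<longleftrightarrow> x \<in> topspace X \<and> y \<in> topspace X \<and> corner (Suc d) x y \<in> QF (Suc d)"
proof -
  have "x \<in> topspace X \<and> y \<in> topspace X" if "(x, y) \<in> RP d T X \<phi>"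
    using that by (simp add: RP_def)
  then show ?thesis using RP_imp_corner corner_imp_RP by blast
qed

section \<open>Regional proximality as a closed invariant equivalence relation\<close>

text \<open>Reachability of the corner from x^[n]. It composes by multiplying ultrafilters and is
  reversed by \<open>face_return\<close>, which gives transitivity and symmetry.\<close>

definition face_reach :: "nat \<Rightarrow> 'x \<Rightarrow> 'x \<Rightarrow> bool" where
  "face_reach n x y \<longleftrightarrow> (\<exists>p\<in>BF n. \<forall>\<epsilon>\<in>cube n - {{}}. act (coord \<epsilon> p) x = y)"

lemma face_reach_sym:
  assumes "face_reach n x y" and x: "x \<in> topspace X"
  shows "face_reach n y x"
proof -
  obtain p where p: "p \<in> BF n" "\<And>\<epsilon>. \<epsilon> \<in> cube n - {{}} \<Longrightarrow> act (coord \<epsilon> p) x = y"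
    using assms(1) by (auto simp: face_reach_def)
  obtain u where u: "u \<in> M" "bmul u u = u" "act u x = x"
    by (rule idempotent_fixing_point[OF x])
  have D: "cube_diag n x \<in> topspace (CX n)" using x by simp
  obtain q where q: "q \<in> BF n" "bact n q (bact n p (cube_diag n x)) = cube_diag n x"
    using face_return[OF u(1,2) D _ p(1)] u(3) by auto
  have "act (coord \<epsilon> q) y = x" if e: "\<epsilon> \<in> cube n - {{}}" for \<epsilon>
  proof -
    have e': "\<epsilon> \<in> cube n" using e by simp
    have "bact n q (bact n p (cube_diag n x)) \<epsilon> = act (coord \<epsilon> q) (act (coord \<epsilon> p) x)"
      using bact_nth[OF BF_carrier[OF q(1)] bact_closed[OF BF_carrier[OF p(1)] D] e']
        bact_nth[OF BF_carrier[OF p(1)] D e'] e' by simp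
    then show ?thesis using q(2) p(2)[OF e] e' by simp
  qed
  then show ?thesis using q(1) by (auto simp: face_reach_def)
qed

lemma face_reach_trans:
  assumes "face_reach n x y" "face_reach n y z" and x: "x \<in> topspace X"
  shows "face_reach n x z"
proof -
  obtain p where p: "p \<in> BF n" "\<And>\<epsilon>. \<epsilon> \<in> cube n - {{}} \<Longrightarrow> act (coord \<epsilon> p) x = y"
    using assms(1) by (auto simp: face_reach_def)
  obtain q where q: "q \<in> BF n" "\<And>\<epsilon>. \<epsilon> \<in> cube n - {{}} \<Longrightarrow> act (coord \<epsilon> q) y = z"
    using assms(2) by (auto simp: face_reach_def)
  have "act (coord \<epsilon> (bmult n q p)) x = z" if e: "\<epsilon> \<in> cube n - {{}}" for \<epsilon>
  proof -
    have e': "\<epsilon> \<in> cube n" using e by simp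
    show ?thesis
      using p(2)[OF e] q(2)[OF e] x coord_ultrafilter[OF BF_carrier[OF p(1)] e']
        coord_ultrafilter[OF BF_carrier[OF q(1)] e']
      by (simp add: coord_mult[OF BF_carrier[OF q(1)] BF_carrier[OF p(1)] e'] base.beta_act_mult)
  qed
  then show ?thesis using BF_mult[OF q(1) p(1)] by (auto simp: face_reach_def)
qed

text \<open>Contracting the corner carries y to x at the nonempty vertices, which is reachability in
  the opposite direction.\<close>

lemma corner_iff_face_reach:
  assumes x: "x \<in> topspace X" and y: "y \<in> topspace X"
  shows "corner n x y \<in> QF n \<longleftrightarrow> face_reach n x y"
proof
  assume c: "corner n x y \<in> QF n"
  obtain p where p: "p \<in> BF n" "bact n p (corner n x y) = cube_diag n x"
    using QF_contract[OF c] by (auto simp: corner_nth)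
  have "act (coord \<epsilon> p) y = x" if "\<epsilon> \<in> cube n - {{}}" for \<epsilon>
    using bact_nth[OF BF_carrier[OF p(1)] QF_point[OF c], of \<epsilon>] p(2) that by (simp add: corner_nth)
  then have "face_reach n y x" using p(1) by (auto simp: face_reach_def)
  then show "face_reach n x y" by (rule face_reach_sym[OF _ y])
next
  assume "face_reach n x y"
  then obtain p where p: "p \<in> BF n" "\<And>\<epsilon>. \<epsilon> \<in> cube n - {{}} \<Longrightarrow> act (coord \<epsilon> p) x = y"
    by (auto simp: face_reach_def)
  have D: "cube_diag n x \<in> topspace (CX n)" using x by simp
  have "bact n p (cube_diag n x) = corner n x y"
  proof (rule cube_point_eqI[of _ n])
    show "bact n p (cube_diag n x) \<in> extensional (cube n)"
      using bact_closed[OF BF_carrier[OF p(1)] D] by (simp add: cube_point_iff)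
    fix \<epsilon> assume e: "\<epsilon> \<in> cube n"
    show "bact n p (cube_diag n x) \<epsilon> = corner n x y \<epsilon>"
      using bact_empty[OF p(1) D] bact_nth[OF BF_carrier[OF p(1)] D e] p(2)[of \<epsilon>] e
      by (cases "\<epsilon> = {}") (auto simp: corner_nth)
  qed (simp add: corner_def)
  then show "corner n x y \<in> QF n" using QF_bact[OF p(1) QF_diag[OF x]] by simp
qed

theorem equiv_RP: "equiv (topspace X) (RP d T X \<phi>)"
proof -
  have iff: "(x, y) \<in> RP d T X \<phi> \<longleftrightarrow> x \<in> topspace X \<and> y \<in> topspace X \<and> face_reach (Suc d) x y" for x y
    using corner_iff_face_reach by (auto simp: RP_iff_corner)
  show ?thesis
  proof (rule equivI)
    show "RP d T X \<phi> \<subseteq> topspace X \<times> topspace X" by (auto simp: RP_def)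
    show "refl_on (topspace X) (RP d T X \<phi>)"
      by (rule refl_onI) (simp add: RP_iff_corner corner_same QF_diag)
    show "sym (RP d T X \<phi>)"
      by (rule symI) (use iff face_reach_sym in blast)
    show "trans (RP d T X \<phi>)"
      by (rule transI) (use iff face_reach_trans in blast)
  qed
qed

lemma corner_act:
  "cact n (cube_diag n t) (corner n x y) = corner n (\<phi> t x) (\<phi> t y)"
  by (rule cube_point_eqI[of _ n]) (auto simp: corner_def)

lemma RP_act:
  assumes "(x, y) \<in> RP d T X \<phi>" "t \<in> carrier T"
  shows "(\<phi> t x, \<phi> t y) \<in> RP d T X \<phi>"
  using assms QF_act_diag[of t "corner (Suc d) x y" "Suc d"]
  by (simp add: RP_iff_corner corner_act base.act_closed)

lemma closedin_RP: "closedin (prod_topology X X) (RP d T X \<phi>)"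
proof -
  have "continuous_map (prod_topology X X) (CX (Suc d)) (\<lambda>z. corner (Suc d) (fst z) (snd z))"
    unfolding continuous_map_componentwise
    by (auto simp: corner_def continuous_map_fst continuous_map_snd)
  then have "closedin (prod_topology X X)
      {z \<in> topspace (prod_topology X X). corner (Suc d) (fst z) (snd z) \<in> QF (Suc d)}"
    by (rule closedin_continuous_map_preimage[OF _ QF_closed])
  moreover have "{z \<in> topspace (prod_topology X X). corner (Suc d) (fst z) (snd z) \<in> QF (Suc d)} = RP d T X \<phi>"
    by (auto simp: RP_iff_corner)
  ultimately show ?thesis by simp
qed

end

section \<open>Metrizability of compact Hausdorff images\<close>

text \<open>\<open>dynamical_system\<close> demands metrizability, so it must be proved for the
  quotient; second countability is the form in which it passes to compact Hausdorff images. Here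
  finite covers by balls of radius 1/(k+1) form a base.\<close>

lemma compact_metrizable_imp_second_countable:
  assumes "compact_space X" "metrizable_space X"
  shows "second_countable X"
proof -
  obtain M d where M: "Metric_space M d" and X: "X = Metric_space.mtopology M d"
    using assms(2) by (auto simp: metrizable_space_def)
  interpret Metric_space M d by (rule M)
  have top: "topspace X = M" by (simp add: X)
  have "\<exists>F. finite F \<and> F \<subseteq> M \<and> M \<subseteq> (\<Union>c\<in>F. mball c (1 / Suc k))" for k
  proof -
    have "\<exists>\<F>. finite \<F> \<and> \<F> \<subseteq> (\<lambda>c. mball c (1 / Suc k)) ` M \<and> M \<subseteq> \<Union>\<F>"
    proof (rule compactinD)
      show "compactin X M" using assms(1) top by (simp add: compact_space_def)
      show "M \<subseteq> \<Union>((\<lambda>c. mball c (1 / Suc k)) ` M)" by auto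
    qed (auto simp: X)
    then show ?thesis by (metis finite_subset_image)
  qed
  then obtain F where F: "\<And>k. finite (F k)" "\<And>k. F k \<subseteq> M" "\<And>k. M \<subseteq> (\<Union>c\<in>F k. mball c (1 / Suc k))"
    by metis
  define \<B> where "\<B> = (\<Union>k. (\<lambda>c. mball c (1 / Suc k)) ` F k)"
  show ?thesis
    unfolding second_countable_def
  proof (intro exI[of _ \<B>] conjI ballI allI impI)
    show "countable \<B>" using F(1) by (simp add: \<B>_def countable_finite)
    show "openin X V" if "V \<in> \<B>" for V using that by (auto simp: \<B>_def X)
    fix U x assume U: "openin X U \<and> x \<in> U"
    then obtain r where r: "r > 0" "mball x r \<subseteq> U" by (auto simp: X openin_mtopology)
    have xM: "x \<in> M" using U openin_subset top by blast
    \<comment> \<open>A ball of radius below r / 2 containing x stays within distance r of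
      x.\<close>
    obtain k where k: "1 / Suc k < r / 2" using r(1) nat_approx_posE[of "r / 2"] by auto
    obtain c where c: "c \<in> F k" "x \<in> mball c (1 / Suc k)" using F(3)[of k] xM by blast
    have "mball c (1 / Suc k) \<subseteq> mball x r"
    proof
      fix y assume y: "y \<in> mball c (1 / Suc k)"
      have "d x y \<le> d x c + d c y" using c(2) y by (intro triangle) auto
      also have "\<dots> < r" using c(2) y k by (simp add: commute)
      finally show "y \<in> mball x r" using xM y by simp
    qed
    then show "\<exists>V\<in>\<B>. x \<in> V \<and> V \<subseteq> U" using c r(2) unfolding \<B>_def by blast
  qed
qed

lemma second_countable_base:
  assumes "second_countable X"
  obtains \<B> where "countable \<B>" "\<forall>V\<in>\<B>. openin X V"
    "\<forall>U x. openin X U \<longrightarrow> x \<in> U \<longrightarrow> (\<exists>V\<in>\<B>. x \<in> V \<and> V \<subseteq> U)"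
proof -
  obtain \<B> where \<B>: "countable \<B> \<and> (\<forall>V\<in>\<B>. openin X V) \<and>
      (\<forall>U x. openin X U \<and> x \<in> U \<longrightarrow> (\<exists>V\<in>\<B>. x \<in> V \<and> V \<subseteq> U))"
    using assms unfolding second_countable_def by (rule exE)
  show ?thesis by (rule that[of \<B>]) (use \<B> in simp_all)
qed

text \<open>A compact fibre inside an open set is covered by finitely many basic sets inside it.
  Since f is closed, the points whose whole fibre lies in such a finite union form an open set, and
  there are countably many finite unions.\<close>

lemma second_countable_compact_image:
  assumes X: "compact_space X" "second_countable X" and Y: "Hausdorff_space Y"
    and f: "continuous_map X Y f" "f ` topspace X = topspace Y"
  shows "second_countable Y"
proof -
  obtain \<B> where base: "countable \<B>" "\<forall>V\<in>\<B>. openin X V"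
      "\<forall>U x. openin X U \<longrightarrow> x \<in> U \<longrightarrow> (\<exists>V\<in>\<B>. x \<in> V \<and> V \<subseteq> U)"
    using second_countable_base[OF X(2)] .
  note \<B> = base(1) base(2)[rule_format] base(3)[rule_format]
  have closed: "closed_map X Y f" by (rule continuous_imp_closed_map[OF f(1) X(1) Y])
  define core where "core \<U> = topspace Y - f ` (topspace X - \<Union>\<U>)" for \<U>
  show ?thesis
    unfolding second_countable_def
  proof (intro exI[of _ "core ` {\<U>. finite \<U> \<and> \<U> \<subseteq> \<B>}"] conjI ballI allI impI)
    show "countable (core ` {\<U>. finite \<U> \<and> \<U> \<subseteq> \<B>})"
      by (intro countable_image countable_Collect_finite_subset \<B>(1))
    show "openin Y V" if V: "V \<in> core ` {\<U>. finite \<U> \<and> \<U> \<subseteq> \<B>}" for V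
    proof -
      obtain \<U> where "\<U> \<subseteq> \<B>" "V = core \<U>" using V by blast
      moreover have "closedin X (topspace X - \<Union>\<U>)"
        using \<open>\<U> \<subseteq> \<B>\<close> \<B>(2) by (intro closedin_diff closedin_topspace openin_Union) blast
      ultimately show ?thesis
        using closed by (auto simp: core_def closed_map_def)
    qed
    fix V y assume V: "openin Y V \<and> y \<in> V"
    let ?K = "{x \<in> topspace X. f x = y}"
    let ?V = "{x \<in> topspace X. f x \<in> V}"
    have openV: "openin X ?V" using V by (intro openin_continuous_map_preimage[OF f(1)]) blast
    have yY: "y \<in> topspace Y" using V openin_subset by blast
    have "closedin X {x \<in> topspace X. f x \<in> {y}}"
      using closedin_Hausdorff_singleton[OF Y yY] by (rule closedin_continuous_map_preimage[OF f(1)])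
    then have K: "compactin X ?K" using closedin_compact_space[OF X(1)] by simp
    have cover: "?K \<subseteq> \<Union>{B \<in> \<B>. B \<subseteq> ?V}"
    proof
      fix x assume "x \<in> ?K"
      then have "x \<in> ?V" using V by simp
      then show "x \<in> \<Union>{B \<in> \<B>. B \<subseteq> ?V}" using \<B>(3)[OF openV] by blast
    qed
    obtain \<U> where \<U>: "finite \<U>" "\<U> \<subseteq> {B \<in> \<B>. B \<subseteq> ?V}" "?K \<subseteq> \<Union>\<U>"
      using compactinD[OF K _ cover] \<B>(2) by auto
    have "y \<in> core \<U>" using \<U>(3) yY by (auto simp: core_def)
    moreover have "core \<U> \<subseteq> V"
    proof
      fix z assume z: "z \<in> core \<U>"
      then obtain x where x: "x \<in> topspace X" "z = f x" using f(2) by (auto simp: core_def)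
      then have "x \<in> \<Union>\<U>" using z by (auto simp: core_def)
      then show "z \<in> V" using \<U>(2) x(2) by blast
    qed
    ultimately show "\<exists>W\<in>core ` {\<U>. finite \<U> \<and> \<U> \<subseteq> \<B>}. y \<in> W \<and> W \<subseteq> V"
      using \<U>(1,2) by blast
  qed
qed

text \<open>Urysohn metrization: one separating function for each pair of basic sets with disjoint
  closures embeds the space in a countable power of the reals.\<close>

lemma compact_Hausdorff_second_countable_imp_metrizable:
  assumes Y: "compact_space Y" "Hausdorff_space Y" "second_countable Y"
  shows "metrizable_space Y"
proof -
  obtain \<B> where base: "countable \<B>" "\<forall>V\<in>\<B>. openin Y V"
      "\<forall>U x. openin Y U \<longrightarrow> x \<in> U \<longrightarrow> (\<exists>V\<in>\<B>. x \<in> V \<and> V \<subseteq> U)"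
    using second_countable_base[OF Y(3)] .
  note \<B> = base(1) base(2)[rule_format] base(3)[rule_format]
  have normal: "normal_space Y"
    using Y by (intro compact_Hausdorff_or_regular_imp_normal_space) auto
  have regular: "regular_space Y" by (rule compact_Hausdorff_imp_regular_space[OF Y(1,2)])
  define P where "P = {(U, V). U \<in> \<B> \<and> V \<in> \<B> \<and> disjnt (Y closure_of U) (Y closure_of V)}"
  have "\<exists>g. continuous_map Y euclideanreal g \<and> g ` (Y closure_of fst p) \<subseteq> {0} \<and> g ` (Y closure_of snd p) \<subseteq> {1}"
    if "p \<in> P" for p
  proof -
    have "disjnt (Y closure_of fst p) (Y closure_of snd p)" using that by (auto simp: P_def)
    then obtain g where "continuous_map Y euclideanreal g" "g ` (Y closure_of fst p) \<subseteq> {0}"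
        "g ` (Y closure_of snd p) \<subseteq> {1}"
      by (rule Urysohn_lemma_alt[OF normal closedin_closure_of closedin_closure_of])
    then show ?thesis by blast
  qed
  then obtain g where g: "\<And>p. p \<in> P \<Longrightarrow> continuous_map Y euclideanreal (g p)"
      "\<And>p. p \<in> P \<Longrightarrow> g p ` (Y closure_of fst p) \<subseteq> {0}" "\<And>p. p \<in> P \<Longrightarrow> g p ` (Y closure_of snd p) \<subseteq> {1}"
    by metis
  define h where "h y = (\<lambda>p\<in>P. g p y)" for y
  let ?Q = "product_topology (\<lambda>_. euclideanreal) P"
  have P: "countable P"
    by (rule countable_subset[of _ "\<B> \<times> \<B>"]) (auto simp: P_def \<B>(1))
  have "continuous_map Y ?Q h"
    unfolding continuous_map_componentwise h_def using g(1) by auto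
  moreover have "inj_on h (topspace Y)"
  proof (rule inj_onI, rule ccontr)
    fix y z assume yz: "y \<in> topspace Y" "z \<in> topspace Y" "h y = h z" "y \<noteq> z"
    then obtain A B where AB: "openin Y A" "openin Y B" "y \<in> A" "z \<in> B" "disjnt A B"
      using Y(2) unfolding Hausdorff_space_def by blast
    have shrink: "\<exists>V\<in>\<B>. w \<in> V \<and> Y closure_of V \<subseteq> W" if W: "openin Y W" "w \<in> W" for W w
    proof -
      obtain U C where UC: "openin Y U" "closedin Y C" "w \<in> U" "U \<subseteq> C" "C \<subseteq> W"
        using regular[folded neighbourhood_base_of_closedin, unfolded neighbourhood_base_of, rule_format,
            OF conjI[OF W]] by auto
      obtain V where "V \<in> \<B>" "w \<in> V" "V \<subseteq> U" using \<B>(3)[OF UC(1,3)] by blast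
      moreover have "Y closure_of V \<subseteq> C" using \<open>V \<subseteq> U\<close> UC by (intro closure_of_minimal) auto
      ultimately show ?thesis using UC(5) by blast
    qed
    obtain U V where UV: "U \<in> \<B>" "y \<in> U" "Y closure_of U \<subseteq> A" "V \<in> \<B>" "z \<in> V" "Y closure_of V \<subseteq> B"
      using shrink[OF AB(1,3)] shrink[OF AB(2,4)] by blast
    have p: "(U, V) \<in> P" using UV AB(5) by (auto simp: P_def disjnt_def)
    have "y \<in> Y closure_of U" "z \<in> Y closure_of V"
      using closure_of_subset[OF openin_subset[OF \<B>(2)[OF UV(1)]]]
        closure_of_subset[OF openin_subset[OF \<B>(2)[OF UV(4)]]] UV(2,5) by auto
    then have "g (U, V) y = 0" "g (U, V) z = 1"
      using g(2)[OF p] g(3)[OF p] by auto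
    moreover have "h y (U, V) = h z (U, V)" using yz(3) by simp
    ultimately show False using p by (simp add: h_def)
  qed
  moreover have "Hausdorff_space ?Q" by (simp add: Hausdorff_space_product_topology)
  ultimately have "embedding_map Y ?Q h"
    using Y(1) by (intro continuous_imp_embedding_map)
  then have "Y homeomorphic_space subtopology ?Q (h ` topspace Y)"
    by (rule embedding_map_imp_homeomorphic_space)
  moreover have "metrizable_space ?Q"
    unfolding metrizable_space_product_topology
    using countable_subset[OF _ P] by (simp add: metrizable_space_euclidean)
  then have "metrizable_space (subtopology ?Q (h ` topspace Y))"
    by (rule metrizable_space_subtopology)
  ultimately show ?thesis by (simp add: homeomorphic_metrizable_space)
qed

lemma metrizable_compact_image:
  assumes "compact_space X" "metrizable_space X" "Hausdorff_space Y"
    and "continuous_map X Y f" "f ` topspace X = topspace Y"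
  shows "metrizable_space Y"
proof (rule compact_Hausdorff_second_countable_imp_metrizable[OF _ assms(3)])
  show "compact_space Y"
    using image_compactin[OF _ assms(4), of "topspace X"] assms(1,5) by (simp add: compact_space_def)
  show "second_countable Y"
    by (rule second_countable_compact_image[OF assms(1) compact_metrizable_imp_second_countable assms(3-5)])
       (rule assms(1,2))+
qed

section \<open>The quotient system\<close>

lemma topspace_quotient_top [simp]: "topspace (quotient_top X R) = topspace X // R"
proof -
  have "openin (quotient_top X R) (topspace X // R)"
  proof -
    have "{x \<in> topspace X. quotient_proj X R x \<in> topspace X // R} = topspace X"
      by (auto simp: quotient_proj_def quotientI)
    then show ?thesis by (simp add: openin_quotient_top)
  qed
  moreover have "topspace (quotient_top X R) \<subseteq> topspace X // R"
    using openin_quotient_top[of X R "topspace (quotient_top X R)"] by simp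
  ultimately show ?thesis using openin_subset by blast
qed

lemma quotient_map_quotient_proj: "quotient_map X (quotient_top X R) (quotient_proj X R)"
  unfolding quotient_map_def
proof (intro conjI allI impI)
  show "quotient_proj X R ` topspace X = topspace (quotient_top X R)"
    by (auto simp: quotient_proj_def quotient_def)
qed (simp add: openin_quotient_top)

text \<open>The saturation of C is the projection of R \<inter> (C \<times> X), and projection along
  a compact factor is closed.\<close>

lemma closed_map_quotient_proj:
  assumes X: "compact_space X" and R: "equiv (topspace X) R" "closedin (prod_topology X X) R"
  shows "closed_map X (quotient_top X R) (quotient_proj X R)"
  unfolding closed_map_def
proof (intro allI impI)
  fix C assume C: "closedin X C"
  have CX: "C \<subseteq> topspace X" by (rule closedin_subset[OF C])
  let ?\<pi> = "quotient_proj X R"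
  have sub: "?\<pi> ` C \<subseteq> topspace (quotient_top X R)"
    using CX by (auto simp: quotient_proj_def quotientI)
  have "{x \<in> topspace X. ?\<pi> x \<in> ?\<pi> ` C} = snd ` (R \<inter> (C \<times> topspace X))"
  proof (intro equalityI subsetI)
    fix x assume "x \<in> {x \<in> topspace X. ?\<pi> x \<in> ?\<pi> ` C}"
    then obtain c where c: "x \<in> topspace X" "c \<in> C" "?\<pi> x = ?\<pi> c" by blast
    then have "(c, x) \<in> R"
      using CX eq_equiv_class[OF _ R(1), of c x] by (auto simp: quotient_proj_def)
    then show "x \<in> snd ` (R \<inter> (C \<times> topspace X))" using c by force
  next
    fix x assume "x \<in> snd ` (R \<inter> (C \<times> topspace X))"
    then obtain c where c: "(c, x) \<in> R" "c \<in> C" "x \<in> topspace X" by auto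
    then have "?\<pi> x = ?\<pi> c"
      using CX equiv_class_eq[OF R(1) c(1)] by (auto simp: quotient_proj_def)
    then show "x \<in> {x \<in> topspace X. ?\<pi> x \<in> ?\<pi> ` C}" using c by blast
  qed
  moreover have "closedin X (snd ` (R \<inter> (C \<times> topspace X)))"
  proof -
    have "closedin (prod_topology X X) (R \<inter> (C \<times> topspace X))"
      by (rule closedin_Int[OF R(2)]) (simp add: closedin_prod_Times_iff C)
    then show ?thesis
      using closed_map_snd[OF X, of X] unfolding closed_map_def by blast
  qed
  ultimately have "closedin X {x \<in> topspace X. ?\<pi> x \<in> ?\<pi> ` C}" by simp
  then show "closedin (quotient_top X R) (?\<pi> ` C)"
    using sub quotient_map_quotient_proj[of X R] unfolding quotient_map_closedin by blast
qed

lemma quotient_top_compact_metrizable: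
  assumes X: "compact_space X" "metrizable_space X"
    and R: "equiv (topspace X) R" "closedin (prod_topology X X) R"
  shows "compact_space (quotient_top X R)" "metrizable_space (quotient_top X R)"
proof -
  let ?\<pi> = "quotient_proj X R"
  have cont: "continuous_map X (quotient_top X R) ?\<pi>"
    and surj: "?\<pi> ` topspace X = topspace (quotient_top X R)"
    by (rule quotient_imp_continuous_map[OF quotient_map_quotient_proj],
        rule quotient_imp_surjective_map[OF quotient_map_quotient_proj])
  show "compact_space (quotient_top X R)"
    using image_compactin[OF _ cont, of "topspace X"] surj X(1) by (simp add: compact_space_def)
  have "Hausdorff_space (quotient_top X R)"
    using normal_Hausdorff_space_closed_continuous_map_image[OF metrizable_imp_normal_space[OF X(2)]
        metrizable_imp_Hausdorff_space[OF X(2)] closed_map_quotient_proj[OF X(1) R] cont surj] by blast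
  then show "metrizable_space (quotient_top X R)"
    by (rule metrizable_compact_image[OF X _ cont surj])
qed

context minimal_cube_system
begin

text \<open>Classes are moved by taking images. The image of a class is a full class because the
  relation is invariant under the inverse of t as well.\<close>

lemma quotient_act_proj:
  assumes t: "t \<in> carrier T" and x: "x \<in> topspace X"
  shows "quotient_act X (RP d T X \<phi>) \<phi> t (quotient_proj X (RP d T X \<phi>) x)
    = quotient_proj X (RP d T X \<phi>) (\<phi> t x)"
proof -
  let ?R = "RP d T X \<phi>"
  have "\<phi> t ` (?R `` {x}) = ?R `` {\<phi> t x}"
  proof (intro equalityI subsetI)
    fix z assume "z \<in> \<phi> t ` (?R `` {x})"
    then show "z \<in> ?R `` {\<phi> t x}" using RP_act[OF _ t] by auto
  next
    fix z assume "z \<in> ?R `` {\<phi> t x}"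
    then have z: "(\<phi> t x, z) \<in> ?R" by simp
    then have zX: "z \<in> topspace X" by (simp add: RP_iff_corner)
    have "(x, \<phi> (inv t) z) \<in> ?R"
      using RP_act[OF z inv_closed[OF t]] base.act_inv(1)[OF t x] by simp
    moreover have "z = \<phi> t (\<phi> (inv t) z)" using base.act_inv(2)[OF t zX] by simp
    ultimately show "z \<in> \<phi> t ` (?R `` {x})" by blast
  qed
  then show ?thesis
    using x base.act_closed[OF t x] by (simp add: quotient_act_def quotient_proj_def quotientI)
qed

theorem extension_quotient:
  "extension T X \<phi> (quotient_top X (RP d T X \<phi>)) (quotient_act X (RP d T X \<phi>) \<phi>)
    (quotient_proj X (RP d T X \<phi>))"
proof -
  let ?R = "RP d T X \<phi>"
  let ?Y = "quotient_top X ?R"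
  let ?\<pi> = "quotient_proj X ?R"
  let ?\<psi> = "quotient_act X ?R \<phi>"
  have cont: "continuous_map X ?Y ?\<pi>" and surj: "?\<pi> ` topspace X = topspace ?Y"
    by (rule quotient_imp_continuous_map[OF quotient_map_quotient_proj],
        rule quotient_imp_surjective_map[OF quotient_map_quotient_proj])
  have closed: "?\<psi> t C \<in> topspace ?Y" if t: "t \<in> carrier T" and C: "C \<in> topspace ?Y" for t C
  proof -
    obtain x where x: "x \<in> topspace X" "C = ?\<pi> x" using C unfolding surj[symmetric] by blast
    have "?\<psi> t C = ?\<pi> (\<phi> t x)" unfolding x(2) by (rule quotient_act_proj[OF t x(1)])
    then show ?thesis unfolding surj[symmetric] using base.act_closed[OF t x(1)] by simp
  qed
  have mult: "?\<psi> (s \<otimes> t) C = ?\<psi> s (?\<psi> t C)"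
    if st: "s \<in> carrier T" "t \<in> carrier T" and C: "C \<in> topspace ?Y" for s t C
  proof -
    obtain x where "x \<in> topspace X" "C = ?\<pi> x" using C unfolding surj[symmetric] by blast
    then show ?thesis
      using st by (simp add: quotient_act_proj base.act_closed base.act_mult)
  qed
  have one: "?\<psi> \<one> C = C" if C: "C \<in> topspace ?Y" for C
  proof -
    obtain x where "x \<in> topspace X" "C = ?\<pi> x" using C unfolding surj[symmetric] by blast
    then show ?thesis by (simp add: quotient_act_proj base.act_one)
  qed
  have inv: "?\<psi> (inv t) (?\<psi> t C) = C" "?\<psi> t (?\<psi> (inv t) C) = C"
    if "t \<in> carrier T" "C \<in> topspace ?Y" for t C
    using that mult[of "inv t" t C] mult[of t "inv t" C] one[of C] by simp_all
  have ext: "?\<psi> t \<in> extensional (topspace ?Y)" for t by (simp add: quotient_act_def)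
  have contt: "continuous_map ?Y ?Y (?\<psi> t)" if t: "t \<in> carrier T" for t
  proof (rule continuous_compose_quotient_map[OF quotient_map_quotient_proj])
    show "continuous_map X ?Y (?\<psi> t \<circ> ?\<pi>)"
      by (rule continuous_map_eq[OF continuous_map_compose[OF base.act_continuous[OF t] cont]])
         (simp add: quotient_act_proj t)
  qed
  have bij: "?\<psi> t \<in> Bij (topspace ?Y)" if t: "t \<in> carrier T" for t
  proof -
    have "bij_betw (?\<psi> t) (topspace ?Y) (topspace ?Y)"
    proof (rule bij_betw_byWitness[where f' = "?\<psi> (inv t)"])
      show "\<forall>C\<in>topspace ?Y. ?\<psi> (inv t) (?\<psi> t C) = C" "\<forall>C\<in>topspace ?Y. ?\<psi> t (?\<psi> (inv t) C) = C"
        using inv[OF t] by blast+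
      show "?\<psi> t ` topspace ?Y \<subseteq> topspace ?Y" "?\<psi> (inv t) ` topspace ?Y \<subseteq> topspace ?Y"
        using closed t inv_closed by blast+
    qed
    then show ?thesis using ext by (simp add: Bij_def)
  qed
  have "?\<psi> (s \<otimes> t) = compose (topspace ?Y) (?\<psi> s) (?\<psi> t)" if "s \<in> carrier T" "t \<in> carrier T" for s t
    using mult[OF that] ext[of "s \<otimes> t"]
    by (intro extensionalityI[of _ "topspace ?Y"]) (auto simp: compose_def)
  then have "?\<psi> \<in> hom T (BijGroup (topspace ?Y))"
    using bij by (intro homI) (auto simp: BijGroup_def)
  then have "group_action T (topspace ?Y) ?\<psi>"
    using is_group by (intro group_action.intro group_hom.intro group_BijGroup group_hom_axioms.intro)
  moreover have "dynamical_system_axioms T ?Y ?\<psi>"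
  proof
    show "compact_space ?Y" "metrizable_space ?Y"
      using quotient_top_compact_metrizable[OF compact metrizable equiv_RP closedin_RP] by blast+
    show "homeomorphic_map ?Y ?Y (?\<psi> t)" if t: "t \<in> carrier T" for t
    proof (rule homeomorphic_maps_imp_map)
      show "homeomorphic_maps ?Y ?Y (?\<psi> t) (?\<psi> (inv t))"
        unfolding homeomorphic_maps_def
        using contt[OF t] contt[OF inv_closed[OF t]] inv[OF t] by blast
    qed
  qed
  ultimately have "dynamical_system T ?Y ?\<psi>"
    by (intro dynamical_system.intro comm_group_axioms)
  then show ?thesis
    unfolding extension_def
    using dynamical_system_axioms cont surj by (intro conjI ballI) (simp_all only: quotient_act_proj)
qed

lemma quotient_proj_eq_iff:
  assumes "x \<in> topspace X" "y \<in> topspace X"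
  shows "quotient_proj X (RP d T X \<phi>) x = quotient_proj X (RP d T X \<phi>) y \<longleftrightarrow> (x, y) \<in> RP d T X \<phi>"
  using eq_equiv_class_iff[OF equiv_RP assms] assms by (simp add: quotient_proj_def)

theorem proximal_extension_quotient_iff:
  "proximal_extension T X \<phi> (quotient_top X (RP d T X \<phi>)) (quotient_act X (RP d T X \<phi>) \<phi>)
      (quotient_proj X (RP d T X \<phi>))
    \<longleftrightarrow> (\<forall>(x, y) \<in> RP d T X \<phi>. proximal T X \<phi> x y)"
proof
  assume "proximal_extension T X \<phi> (quotient_top X (RP d T X \<phi>)) (quotient_act X (RP d T X \<phi>) \<phi>)
      (quotient_proj X (RP d T X \<phi>))"
  then have prox: "\<forall>x\<in>topspace X. \<forall>y\<in>topspace X.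
      quotient_proj X (RP d T X \<phi>) x = quotient_proj X (RP d T X \<phi>) y \<longrightarrow> proximal T X \<phi> x y"
    by (simp add: proximal_extension_def)
  show "\<forall>(x, y) \<in> RP d T X \<phi>. proximal T X \<phi> x y"
  proof clarify
    fix x y assume xy: "(x, y) \<in> RP d T X \<phi>"
    then have "x \<in> topspace X" "y \<in> topspace X" by (simp_all add: RP_iff_corner)
    then show "proximal T X \<phi> x y" using prox xy by (simp add: quotient_proj_eq_iff)
  qed
next
  assume prox: "\<forall>(x, y) \<in> RP d T X \<phi>. proximal T X \<phi> x y"
  show "proximal_extension T X \<phi> (quotient_top X (RP d T X \<phi>)) (quotient_act X (RP d T X \<phi>) \<phi>)
      (quotient_proj X (RP d T X \<phi>))"
    unfolding proximal_extension_def
  proof (intro conjI extension_quotient ballI impI)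
    fix x y assume "x \<in> topspace X" "y \<in> topspace X"
      "quotient_proj X (RP d T X \<phi>) x = quotient_proj X (RP d T X \<phi>) y"
    then have "(x, y) \<in> RP d T X \<phi>" by (simp add: quotient_proj_eq_iff)
    then show "proximal T X \<phi> x y" using prox by blast
  qed
qed

end

section \<open>The topology of the compactification\<close>

lemma openin_beta_top_basic:
  "A \<subseteq> S \<Longrightarrow> openin (beta_top S) {p \<in> ultrafilters S. \<forall>\<^sub>F s in p. s \<in> A}"
  unfolding beta_top_def by (rule topology_generated_by_Basis) blast

lemma Hausdorff_space_beta_top: "Hausdorff_space (beta_top S)"
  unfolding Hausdorff_space_def
proof (intro allI impI)
  fix p q assume pq: "p \<in> topspace (beta_top S) \<and> q \<in> topspace (beta_top S) \<and> p \<noteq> q"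
  then have p: "p \<in> ultrafilters S" and q: "q \<in> ultrafilters S" by simp_all
  have "\<not> p \<le> q"
  proof
    assume "p \<le> q"
    then have "p = q" using p q by (intro ultra_minimal) (auto simp: ultrafilters_iff ultra_def)
    then show False using pq by simp
  qed
  then obtain P where P: "eventually P q" "\<not> eventually P p" by (auto simp: le_filter_def)
  define A where "A = {s \<in> S. P s}"
  let ?U = "\<lambda>A. {p \<in> ultrafilters S. \<forall>\<^sub>F s in p. s \<in> A}"
  have "\<forall>\<^sub>F s in q. s \<in> A"
    using P(1) eventually_in_ultrafilter[OF q] by eventually_elim (simp add: A_def)
  moreover have "\<forall>\<^sub>F s in p. s \<in> S - A"
    using P(2)[unfolded ultra_not_eventually[OF ultraD[OF p]]] eventually_in_ultrafilter[OF p]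
    by eventually_elim (simp add: A_def)
  moreover have "disjnt (?U (S - A)) (?U A)"
  proof -
    have False if r: "r \<in> ultrafilters S" "\<forall>\<^sub>F s in r. s \<in> S - A" "\<forall>\<^sub>F s in r. s \<in> A" for r
    proof -
      have "\<forall>\<^sub>F s in r. False" using r(2,3) by eventually_elim simp
      then show False using r(1) by (simp add: ultrafilters_def)
    qed
    then show ?thesis unfolding disjnt_def by blast
  qed
  moreover have "openin (beta_top S) (?U (S - A))" "openin (beta_top S) (?U A)"
    by (rule openin_beta_top_basic; auto simp: A_def)+
  ultimately show "\<exists>U V. openin (beta_top S) U \<and> openin (beta_top S) V \<and> p \<in> U \<and> q \<in> V \<and> disjnt U V"
    using p q by (intro exI[of _ "?U (S - A)"] exI[of _ "?U A"]) simp
qed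

text \<open>The preimage of the basic clopen set of A is the basic clopen set of those s for which s
  t lies in A for q-almost all t.\<close>

lemma (in monoid) continuous_map_beta_mult:
  assumes q: "q \<in> ultrafilters (carrier G)"
  shows "continuous_map (beta_top (carrier G)) (beta_top (carrier G)) (\<lambda>p. beta_mult G p q)"
proof -
  let ?S = "carrier G"
  show ?thesis
    unfolding beta_top_def[of ?S]
  proof (rule continuous_on_generated_topo, fold beta_top_def)
    fix U assume "U \<in> {{p \<in> ultrafilters ?S. \<forall>\<^sub>F s in p. s \<in> A} |A. A \<subseteq> ?S}"
    then obtain A where A: "A \<subseteq> ?S" "U = {p \<in> ultrafilters ?S. \<forall>\<^sub>F s in p. s \<in> A}" by blast
    let ?B = "{s \<in> ?S. \<forall>\<^sub>F t in q. s \<otimes> t \<in> A}"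
    have mem: "p \<in> (\<lambda>p. beta_mult G p q) -` U \<inter> topspace (beta_top ?S)
        \<longleftrightarrow> p \<in> {p \<in> ultrafilters ?S. \<forall>\<^sub>F s in p. s \<in> ?B}" for p
    proof (cases "p \<in> ultrafilters ?S")
      case True
      have "(\<forall>\<^sub>F s in p. \<forall>\<^sub>F t in q. s \<otimes> t \<in> A) \<longleftrightarrow> (\<forall>\<^sub>F s in p. s \<in> ?B)"
        by (rule eventually_cong[OF eventually_in_ultrafilter[OF True]]) simp
      then show ?thesis
        using True beta_closed[OF True q] by (simp add: A(2) eventually_beta_mult)
    qed simp
    have eq: "(\<lambda>p. beta_mult G p q) -` U \<inter> topspace (beta_top ?S)
        = {p \<in> ultrafilters ?S. \<forall>\<^sub>F s in p. s \<in> ?B}" by (rule Set.set_eqI, rule mem)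
    show "openin (beta_top ?S) ((\<lambda>p. beta_mult G p q) -` U \<inter> topspace (beta_top ?S))"
      unfolding eq by (rule openin_beta_top_basic) blast
  next
    have "\<Union>{{p \<in> ultrafilters ?S. \<forall>\<^sub>F s in p. s \<in> A} |A. A \<subseteq> ?S} = ultrafilters ?S"
      using topspace_beta_top[of ?S] unfolding beta_top_def topology_generated_by_topspace .
    then show "(\<lambda>p. beta_mult G p q) ` topspace (beta_top ?S)
        \<subseteq> \<Union>{{p \<in> ultrafilters ?S. \<forall>\<^sub>F s in p. s \<in> A} |A. A \<subseteq> ?S}"
      using beta_closed[OF _ q] by (simp add: image_subset_iff)
  qed
qed

text \<open>Regularity provides a closed neighbourhood C inside W. Ultrafilters containing the set
  of s with s z in a smaller open set U have their limit in C.\<close>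

lemma (in compact_action) continuous_map_beta_act:
  assumes z: "z \<in> topspace Z"
  shows "continuous_map (beta_top (carrier S)) Z (\<lambda>p. beta_act Z act p z)"
  unfolding continuous_map_def
proof (intro conjI allI impI)
  show "(\<lambda>p. beta_act Z act p z) \<in> topspace (beta_top (carrier S)) \<rightarrow> topspace Z" using z by simp
  fix W assume W: "openin Z W"
  let ?V = "{p \<in> topspace (beta_top (carrier S)). beta_act Z act p z \<in> W}"
  have regular: "regular_space Z" by (rule compact_Hausdorff_imp_regular_space[OF Z_compact Z_Hausdorff])
  show "openin (beta_top (carrier S)) ?V"
  proof (subst openin_subopen, intro ballI)
    fix p assume "p \<in> ?V"
    then have p: "p \<in> ultrafilters (carrier S)" "beta_act Z act p z \<in> W" by auto
    obtain U C where UC: "openin Z U" "closedin Z C" "beta_act Z act p z \<in> U" "U \<subseteq> C" "C \<subseteq> W"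
      using regular[folded neighbourhood_base_of_closedin, unfolded neighbourhood_base_of, rule_format,
          OF conjI[OF W p(2)]] by auto
    define A where "A = {s \<in> carrier S. act s z \<in> U}"
    let ?N = "{q \<in> ultrafilters (carrier S). \<forall>\<^sub>F s in q. s \<in> A}"
    have "\<forall>\<^sub>F s in p. s \<in> A"
      using eventually_beta_act[OF p(1) z UC(1,3)] eventually_in_ultrafilter[OF p(1)]
      by eventually_elim (simp add: A_def)
    moreover have "?N \<subseteq> ?V"
    proof
      fix q assume "q \<in> ?N"
      then have q: "q \<in> ultrafilters (carrier S)" "q \<in> ultrafilters A"
        by (auto simp: ultrafilters_iff le_principal)
      have "beta_act Z act q z \<in> C"
        by (rule beta_act_in_closed[OF q(2) _ z UC(2)]) (use UC(4) in \<open>auto simp: A_def\<close>)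
      then show "q \<in> ?V" using q(1) UC(5) by auto
    qed
    moreover have "openin (beta_top (carrier S)) ?N"
      by (rule openin_beta_top_basic) (auto simp: A_def)
    ultimately show "\<exists>N. openin (beta_top (carrier S)) N \<and> p \<in> N \<and> N \<subseteq> ?V"
      using p(1) by (intro exI[of _ ?N]) simp
  qed
qed

text \<open>An iterated limit expressed as one filter on pairs, as \<open>circle\<close> demands;
  \<open>beta_mult\<close> is its image under multiplication.\<close>

definition iter_filter :: "'a filter \<Rightarrow> 'b filter \<Rightarrow> ('a \<times> 'b) filter" where
  "iter_filter p q = Abs_filter (\<lambda>P. \<forall>\<^sub>F s in p. \<forall>\<^sub>F t in q. P (s, t))"

lemma eventually_iter_filter:
  "eventually P (iter_filter p q) \<longleftrightarrow> (\<forall>\<^sub>F s in p. \<forall>\<^sub>F t in q. P (s, t))"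
  unfolding iter_filter_def
proof (rule eventually_Abs_filter, unfold_locales)
  show "\<forall>\<^sub>F s in p. \<forall>\<^sub>F t in q. P (s, t) \<and> Q (s, t)"
    if "\<forall>\<^sub>F s in p. \<forall>\<^sub>F t in q. P (s, t)" "\<forall>\<^sub>F s in p. \<forall>\<^sub>F t in q. Q (s, t)" for P Q
    using that by (auto simp: eventually_conj_iff)
  show "\<forall>\<^sub>F s in p. \<forall>\<^sub>F t in q. Q (s, t)"
    if "\<forall>x. P x \<longrightarrow> Q x" "\<forall>\<^sub>F s in p. \<forall>\<^sub>F t in q. P (s, t)" for P Q
    using that(2) by (rule eventually_mono) (use that(1) in \<open>auto elim: eventually_mono\<close>)
qed auto

lemma iter_filter_not_bot: "p \<noteq> bot \<Longrightarrow> q \<noteq> bot \<Longrightarrow> iter_filter p q \<noteq> bot"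
  unfolding trivial_limit_def eventually_iter_filter by simp

section \<open>The group \<open>G\<close>\<close>

locale tau_system = minimal_cube_system T X \<phi> M
  for T :: "('t, 'm) monoid_scheme" (structure) and X :: "'x topology" and \<phi> M +
  fixes n :: nat and u :: "'t filter" and v :: "(nat set \<Rightarrow> 't) filter"
  assumes n: "n \<ge> 1" and u: "u \<in> M" "bmul u u = u"
    and v: "v \<in> ultrafilters (carrier (HK n T))" and v_u: "beta_cube n T v = cube_diag n u"
begin

abbreviation "G \<equiv> G_group T M u"

lemma HK_carrier: "carrier (HK n T) \<subseteq> KK n"
  by (rule subgroup.subset[OF subgroup_HK])

lemma BHK_carrier: "p \<in> ultrafilters (carrier (HK n T)) \<Longrightarrow> p \<in> BK n"
  by (rule ultrafilters_mono[OF _ HK_carrier])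

text \<open>The tuple of projections of v is a limit of the inclusion along v, and limits in the
  Hausdorff product are unique.\<close>

lemma coord_v:
  assumes e: "\<epsilon> \<in> cube n"
  shows "coord \<epsilon> v = u"
proof -
  have "limitin (cube_top n (beta_top (carrier T))) (\<lambda>t. \<lambda>\<epsilon>\<in>cube n. principal {t \<epsilon>})
      (\<lambda>\<epsilon>\<in>cube n. coord \<epsilon> v) v"
    unfolding limitin_componentwise
  proof (intro conjI ballI)
    show "\<forall>\<^sub>F t in v. (\<lambda>\<epsilon>\<in>cube n. principal {t \<epsilon>}) \<in> topspace (cube_top n (beta_top (carrier T)))"
      using eventually_in_ultrafilter[OF BHK_carrier[OF v]]
      by eventually_elim (simp add: cube_point_iff cube_group_nth)
    fix \<epsilon> assume e: "\<epsilon> \<in> cube n"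
    have "limitin (beta_top (carrier T)) (\<lambda>s. principal {s}) (coord \<epsilon> v) (coord \<epsilon> v)"
      by (rule limitin_beta_top_principal[OF coord_ultrafilter[OF BHK_carrier[OF v] e]])
    then show "limitin (beta_top (carrier T)) (\<lambda>t. (\<lambda>\<epsilon>\<in>cube n. principal {t \<epsilon>}) \<epsilon>)
        ((\<lambda>\<epsilon>\<in>cube n. coord \<epsilon> v) \<epsilon>) v"
      using e by (simp add: limitin_def coord_def eventually_filtermap)
  qed simp
  moreover have "Hausdorff_space (cube_top n (beta_top (carrier T)))"
    by (simp add: Hausdorff_space_product_topology Hausdorff_space_beta_top)
  moreover have "v \<noteq> bot" using v by (simp add: ultrafilters_def)
  ultimately have "beta_cube n T v = (\<lambda>\<epsilon>\<in>cube n. coord \<epsilon> v)"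
    unfolding beta_cube_def by (intro beta_ext_eqI)
  then have "(\<lambda>\<epsilon>\<in>cube n. coord \<epsilon> v) = cube_diag n u" using v_u by simp
  then have "(\<lambda>\<epsilon>\<in>cube n. coord \<epsilon> v) \<epsilon> = cube_diag n u \<epsilon>" by simp
  then show ?thesis using e by simp
qed

lemma G_simps [simp]: "mult G = bmul" "one G = u"
  by (simp_all add: G_group_def)

lemma u_beta: "u \<in> BT"
  by (rule ideal.ideal_mem[OF u(1)])

lemma carrier_G_iff: "p \<in> carrier G \<longleftrightarrow> p \<in> M \<and> bmul u p = p"
proof
  assume "p \<in> carrier G"
  then obtain q where q: "q \<in> M" "p = bmul u q" by (auto simp: G_group_def)
  then show "p \<in> M \<and> bmul u p = p"
    using ideal.ideal_closed[OF u_beta q(1)] beta_assoc[OF u_beta u_beta ideal.ideal_mem[OF q(1)]] u(2)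
    by simp
next
  assume "p \<in> M \<and> bmul u p = p"
  then have "p \<in> M" "p = bmul u p" by simp_all
  then show "p \<in> carrier G" by (simp add: G_group_def)
qed

lemma G_mem:
  assumes "p \<in> carrier G"
  shows "p \<in> M" "p \<in> BT" "bmul u p = p"
  using assms by (simp_all add: carrier_G_iff)

lemma group_G: "group G"
proof (rule groupI)
  show "x \<otimes>\<^bsub>G\<^esub> y \<in> carrier G" if xy: "x \<in> carrier G" "y \<in> carrier G" for x y
    using G_mem[OF xy(1)] G_mem[OF xy(2)]
    by (simp add: carrier_G_iff ideal.ideal_closed beta_assoc[OF u_beta, symmetric])
  show "\<one>\<^bsub>G\<^esub> \<in> carrier G" using u by (simp add: carrier_G_iff)
  show "x \<otimes>\<^bsub>G\<^esub> y \<otimes>\<^bsub>G\<^esub> z = x \<otimes>\<^bsub>G\<^esub> (y \<otimes>\<^bsub>G\<^esub> z)"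
    if "x \<in> carrier G" "y \<in> carrier G" "z \<in> carrier G" for x y z
    using that G_mem(2) by (simp add: beta_assoc)
  show "\<one>\<^bsub>G\<^esub> \<otimes>\<^bsub>G\<^esub> x = x" if "x \<in> carrier G" for x
    using G_mem(3)[OF that] by simp
  show "\<exists>y\<in>carrier G. y \<otimes>\<^bsub>G\<^esub> x = \<one>\<^bsub>G\<^esub>" if x: "x \<in> carrier G" for x
  proof -
    obtain r where "r \<in> M" "bmul u r = r" "bmul r x = u"
      using ideal.right_inverse[OF u G_mem(1)[OF x]] by metis
    then show ?thesis by (intro bexI[of _ r]) (simp_all add: carrier_G_iff)
  qed
qed

text \<open>Principal ultrafilters are central because T is abelian, so t u = u t lies in u M and
  the map is multiplicative.\<close>

definition emb :: "'t \<Rightarrow> 't filter" where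
  "emb t = bmul (principal {t}) u"

lemma principal_commute:
  assumes t: "t \<in> carrier T" and p: "p \<in> BT"
  shows "bmul (principal {t}) p = bmul p (principal {t})"
  unfolding filter_eq_iff eventually_beta_mult eventually_principal
proof
  fix P
  have "(\<forall>\<^sub>F s in p. P (t \<otimes> s)) \<longleftrightarrow> (\<forall>\<^sub>F s in p. P (s \<otimes> t))"
    by (rule eventually_cong[OF eventually_in_ultrafilter[OF p]]) (simp add: m_comm[OF t])
  then show "(\<forall>s\<in>{t}. \<forall>\<^sub>F x in p. P (s \<otimes> x)) \<longleftrightarrow> (\<forall>\<^sub>F s in p. \<forall>x\<in>{t}. P (s \<otimes> x))" by simp
qed

lemma principal_mult:
  "s \<in> carrier T \<Longrightarrow> t \<in> carrier T \<Longrightarrow> bmul (principal {s}) (principal {t}) = principal {s \<otimes> t}"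
  unfolding filter_eq_iff eventually_beta_mult eventually_principal by simp

lemma emb_in_G:
  assumes t: "t \<in> carrier T"
  shows "emb t \<in> carrier G"
proof -
  have tb: "principal {t} \<in> BT" using t by simp
  have "bmul u (emb t) = bmul (bmul u (principal {t})) u"
    unfolding emb_def using beta_assoc[OF u_beta tb u_beta] by simp
  also have "\<dots> = bmul (principal {t}) (bmul u u)"
    using principal_commute[OF t u_beta] beta_assoc[OF tb u_beta u_beta] by simp
  finally show ?thesis
    using ideal.ideal_closed[OF tb u(1)] u(2) by (simp add: carrier_G_iff emb_def)
qed

lemma emb_mult:
  assumes s: "s \<in> carrier T" and t: "t \<in> carrier T"
  shows "bmul (emb s) (emb t) = emb (s \<otimes> t)"
proof -
  have b: "principal {s} \<in> BT" "principal {t} \<in> BT"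
    using s t by simp_all
  have "bmul (emb s) (emb t) = bmul (principal {s}) (bmul u (emb t))"
    unfolding emb_def[of s] by (rule beta_assoc[OF b(1) u_beta G_mem(2)[OF emb_in_G[OF t]]])
  also have "\<dots> = emb (s \<otimes> t)"
    unfolding G_mem(3)[OF emb_in_G[OF t]] unfolding emb_def
    by (simp add: beta_assoc[OF b u_beta, symmetric] principal_mult s t)
  finally show ?thesis .
qed

lemma emb_one: "emb \<one> = u"
  unfolding emb_def using u_beta by (intro beta_left_one) (simp add: ultrafilters_iff)

text \<open>Facet generators go to facet generators, since the identity of T is sent to u, the
  identity of G.\<close>

lemma emb_HK:
  assumes "h \<in> carrier (HK n T)"
  shows "(\<lambda>\<epsilon>\<in>cube n. emb (h \<epsilon>)) \<in> carrier (HK n G)"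
proof -
  interpret G: group G by (rule group_G)
  have gen: "(\<lambda>\<epsilon>\<in>cube n. emb (face_element n T t \<alpha> \<epsilon>)) \<in> carrier (HK n G)"
    if t: "t \<in> carrier T" and "facet n \<alpha>" for t \<alpha>
  proof -
    have "(\<lambda>\<epsilon>\<in>cube n. emb (face_element n T t \<alpha> \<epsilon>)) = face_element n G (emb t) \<alpha>"
      unfolding face_element_def by (rule restrict_ext) (simp add: emb_one)
    moreover have "face_element n G (emb t) \<alpha> \<in> carrier (HK n G)"
      unfolding HK_def carrier_subgroup_generated
      using G.face_element_carrier[OF emb_in_G[OF t]] emb_in_G[OF t] \<open>facet n \<alpha>\<close>
      by (intro generate.incl) blast
    ultimately show ?thesis by simp
  qed
  have HK_T: "h1 \<in> carrier (HK n T)"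
    if "h1 \<in> generate (cube_group n T) (KK n \<inter> {face_element n T g \<alpha> |g \<alpha>. g \<in> carrier T \<and> facet n \<alpha>})" for h1
    using that by (simp add: HK_def carrier_subgroup_generated)
  show ?thesis
    using assms unfolding HK_def[of n T] carrier_subgroup_generated
  proof (induction rule: generate.induct)
    case one
    have "(\<lambda>\<epsilon>\<in>cube n. emb (\<one>\<^bsub>cube_group n T\<^esub> \<epsilon>)) = \<one>\<^bsub>cube_group n G\<^esub>"
      unfolding one_product_group by (rule restrict_ext) (simp add: emb_one)
    then show ?case by (simp only: HK_def carrier_subgroup_generated generate.one)
  next
    case (incl h)
    then obtain t \<alpha> where t: "t \<in> carrier T" "facet n \<alpha>" and h: "h = face_element n T t \<alpha>" by auto
    show ?case unfolding h by (rule gen[OF t])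
  next
    case (inv h)
    then obtain t \<alpha> where t: "t \<in> carrier T" "facet n \<alpha>" and h: "h = face_element n T t \<alpha>" by auto
    show ?case unfolding h inv_face_element[OF t(1)] by (rule gen[OF inv_closed[OF t(1)] t(2)])
  next
    case (eng h1 h2)
    have h: "h1 \<in> KK n" "h2 \<in> KK n"
      using subsetD[OF HK_carrier HK_T[OF eng.hyps(1)]] subsetD[OF HK_carrier HK_T[OF eng.hyps(2)]] by auto
    have "(\<lambda>\<epsilon>\<in>cube n. emb ((h1 \<star>\<^bsub>n\<^esub> h2) \<epsilon>))
        = (\<lambda>\<epsilon>\<in>cube n. emb (h1 \<epsilon>)) \<otimes>\<^bsub>cube_group n G\<^esub> (\<lambda>\<epsilon>\<in>cube n. emb (h2 \<epsilon>))"
      unfolding mult_product_group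
      by (rule restrict_ext) (simp add: emb_mult cube_group_nth[OF h(1)] cube_group_nth[OF h(2)])
    moreover have "(\<lambda>\<epsilon>\<in>cube n. emb (h1 \<epsilon>)) \<otimes>\<^bsub>cube_group n G\<^esub> (\<lambda>\<epsilon>\<in>cube n. emb (h2 \<epsilon>))
        \<in> carrier (HK n G)"
      by (rule subgroup.m_closed[OF G.subgroup_HK eng.IH])
    ultimately show ?case by (simp only:)
  qed
qed


section \<open>The \<open>\<tau>\<close>-closure of the Host-Kra group of \<open>G\<close>\<close>

text \<open>Along the iterated filter t s tends to v p, whose coordinate is u times that of p; right
  multiplication by u is continuous.\<close>

lemma emb_iterated_limit:
  assumes p: "p \<in> ultrafilters (carrier (HK n T))" and e: "\<epsilon> \<in> cube n"
  shows "limitin (beta_top (carrier T)) (\<lambda>(t, s). bmul (principal {t \<epsilon>}) (emb (s \<epsilon>)))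
    (bmul (bmul u (coord \<epsilon> p)) u) (iter_filter v p)"
proof -
  let ?x = "bmul u (coord \<epsilon> p)"
  have vK: "v \<in> BK n" and pK: "p \<in> BK n"
    using BHK_carrier v p by blast+
  have x: "?x \<in> BT"
    by (rule beta_closed[OF u_beta coord_ultrafilter[OF pK e]])
  have "coord \<epsilon> (bmult n v p) = ?x" by (simp add: coord_mult[OF vK pK e] coord_v[OF e])
  moreover have "coord \<epsilon> (bmult n v p) = filtermap (\<lambda>(t, s). t \<epsilon> \<otimes> s \<epsilon>) (iter_filter v p)"
    unfolding filter_eq_iff coord_def eventually_filtermap eventually_beta_mult eventually_iter_filter
    using e by simp
  ultimately have fx: "filtermap (\<lambda>(t, s). t \<epsilon> \<otimes> s \<epsilon>) (iter_filter v p) = ?x" by simp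
  have "limitin (beta_top (carrier T)) ((\<lambda>q. bmul q u) \<circ> (\<lambda>r. principal {r})) (bmul ?x u) ?x"
    by (rule continuous_map_limit[OF continuous_map_beta_mult[OF u_beta] limitin_beta_top_principal[OF x]])
  then have "limitin (beta_top (carrier T)) (\<lambda>(t, s). bmul (principal {t \<epsilon> \<otimes> s \<epsilon>}) u)
      (bmul ?x u) (iter_filter v p)"
    unfolding limitin_def eventually_filtermap[of _ _ "iter_filter v p", folded fx] comp_def
    by (subst (asm) fx[symmetric]) (simp add: eventually_filtermap case_prod_beta)
  moreover have "\<forall>\<^sub>F c in iter_filter v p. (\<lambda>(t, s). bmul (principal {t \<epsilon> \<otimes> s \<epsilon>}) u) c
      = (\<lambda>(t, s). bmul (principal {t \<epsilon>}) (emb (s \<epsilon>))) c"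
    unfolding eventually_iter_filter
    using eventually_in_ultrafilter[OF vK]
  proof eventually_elim
    case (elim t)
    then have t: "t \<epsilon> \<in> carrier T" by (rule cube_group_nth[OF _ e])
    show ?case
      using eventually_in_ultrafilter[OF pK]
    proof eventually_elim
      case (elim s)
      then have s: "s \<epsilon> \<in> carrier T" by (rule cube_group_nth[OF _ e])
      then show ?case
        using t u_beta by (simp add: emb_def beta_assoc[symmetric] principal_mult)
    qed
  qed
  ultimately show ?thesis by (rule limitin_transform_eventually[rotated])
qed

text \<open>The group \<open>T\<close> embeds in \<open>G\<close> by \<open>t \<mapsto> t u\<close>, and the orbit of \<open>u\<close> is dense; hence the closure
  is already everything.\<close>

lemma tau_closure_contains:
  assumes p: "p \<in> ultrafilters (carrier (HK n T))"
  shows "(\<lambda>\<epsilon>\<in>cube n. bmul (bmul u (coord \<epsilon> p)) u)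
    \<in> tau_closure n T M u v (carrier (HK n G))"
proof -
  define w where "w = (\<lambda>\<epsilon>\<in>cube n. bmul (bmul u (coord \<epsilon> p)) u)"
  define a where "a s = (\<lambda>\<epsilon>\<in>cube n. emb (s \<epsilon>))" for s :: "nat set \<Rightarrow> 't"
  define F where "F = filtermap (\<lambda>(t, s). (t, a s)) (iter_filter v p)"
  have ev: "eventually P F \<longleftrightarrow> (\<forall>\<^sub>F t in v. \<forall>\<^sub>F s in p. P (t, a s))" for P
    by (simp add: F_def eventually_filtermap eventually_iter_filter)
  have pK: "p \<in> BK n" by (rule BHK_carrier[OF p])
  have evK: "\<forall>\<^sub>F t in v. \<forall>\<^sub>F s in p. t \<in> carrier (HK n T) \<and> s \<in> carrier (HK n T)"
    using eventually_in_ultrafilter[OF v]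
    by eventually_elim (use eventually_in_ultrafilter[OF p] in \<open>auto elim: eventually_mono\<close>)
  have wM: "w \<epsilon> \<in> M" if e: "\<epsilon> \<in> cube n" for \<epsilon>
    using ideal.ideal_closed[OF beta_closed[OF u_beta coord_ultrafilter[OF pK e]] u(1)] e
    by (simp add: w_def)
  have "w \<in> circle n T M v (carrier (HK n G))"
    unfolding circle_def mem_Collect_eq
  proof (intro exI[of _ F] conjI)
    have "iter_filter v p \<noteq> bot"
      using v p by (intro iter_filter_not_bot) (auto simp: ultrafilters_def)
    then show "F \<noteq> bot" by (simp add: F_def filtermap_bot_iff)
    show "F \<le> principal (carrier (HK n T) \<times> carrier (HK n G))"
      unfolding le_principal ev using evK
      by eventually_elim (erule eventually_mono, simp add: a_def emb_HK)
    show "limitin (beta_top (carrier (HK n T))) (\<lambda>(t, a). principal {t}) v F"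
      unfolding limitin_def ev
      using limitin_beta_top_principal[OF v] p by (simp add: limitin_def ultrafilters_def)
    show "limitin (cube_top n (subtopology (beta_top (carrier T)) M))
        (\<lambda>(t, a). cube_act n (\<lambda>s p. principal {s} \<otimes>\<^bsub>beta T\<^esub> p) t a) w F"
      unfolding limitin_componentwise
    proof (intro conjI ballI)
      show "w \<in> extensional (cube n)" by (simp add: w_def)
      have inM: "bmul (principal {t \<epsilon>}) (emb (s \<epsilon>)) \<in> M"
        if "t \<in> carrier (HK n T)" "s \<in> carrier (HK n T)" "\<epsilon> \<in> cube n" for t s \<epsilon>
      proof -
        have "t \<epsilon> \<in> carrier T" "s \<epsilon> \<in> carrier T"
          using that HK_carrier by (auto intro: cube_group_nth)
        then show ?thesis using G_mem(1)[OF emb_in_G] by (intro ideal.ideal_closed) auto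
      qed
      show "\<forall>\<^sub>F c in F. (\<lambda>(t, a). cube_act n (\<lambda>s p. principal {s} \<otimes>\<^bsub>beta T\<^esub> p) t a) c
          \<in> topspace (cube_top n (subtopology (beta_top (carrier T)) M))"
        unfolding ev using evK
        by eventually_elim (erule eventually_mono, simp add: cube_point_iff a_def inM)
      fix \<epsilon> assume e: "\<epsilon> \<in> cube n"
      have "limitin (beta_top (carrier T)) (\<lambda>c. (\<lambda>(t, a). cube_act n (\<lambda>s p. principal {s} \<otimes>\<^bsub>beta T\<^esub> p) t a) c \<epsilon>) (w \<epsilon>) F"
        using emb_iterated_limit[OF p e] e
        by (simp add: limitin_def F_def eventually_filtermap case_prod_beta w_def a_def)
      moreover have "\<forall>\<^sub>F c in F. (\<lambda>(t, a). cube_act n (\<lambda>s p. principal {s} \<otimes>\<^bsub>beta T\<^esub> p) t a) c \<epsilon> \<in> M"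
        unfolding ev using evK
        by eventually_elim (erule eventually_mono, simp add: e a_def inM)
      ultimately show "limitin (subtopology (beta_top (carrier T)) M)
          (\<lambda>c. (\<lambda>(t, a). cube_act n (\<lambda>s p. principal {s} \<otimes>\<^bsub>beta T\<^esub> p) t a) c \<epsilon>) (w \<epsilon>) F"
        using wM[OF e] by (simp add: limitin_subtopology)
    qed
  qed
  \<comment> \<open>Every coordinate of w begins with the idempotent u, so the last multiplication
    of the closure changes nothing.\<close>
  moreover have "cube_diag n u \<otimes>\<^bsub>cube_group n (beta T)\<^esub> w = w"
  proof (rule cube_point_eqI[of _ n])
    fix \<epsilon> assume e: "\<epsilon> \<in> cube n"
    have c: "coord \<epsilon> p \<in> BT" by (rule coord_ultrafilter[OF pK e])
    show "(cube_diag n u \<otimes>\<^bsub>cube_group n (beta T)\<^esub> w) \<epsilon> = w \<epsilon>"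
      using e u_beta c u(2)
      by (simp add: w_def beta_assoc[symmetric] beta_closed)
  qed (simp_all add: w_def mult_product_group)
  ultimately show ?thesis unfolding tau_closure_def w_def[symmetric] by force
qed

section \<open>Orbits of the closure in the dynamical cubes\<close>

lemma QF_BHK:
  assumes p: "p \<in> ultrafilters (carrier (HK n T))" and y: "y \<in> QF n"
  shows "bact n p y \<in> QF n"
  by (rule cub.beta_act_in_closed[OF p HK_carrier QF_point[OF y] QF_closed])
     (rule QF_HK[OF n _ y])

text \<open>A generator f a^[n] is approximated by f (t x)^[n], and the diagonal element of t
  belongs to the Host-Kra group, so a single diagonal point suffices.\<close>

lemma HK_orbit_dense:
  assumes x: "x \<in> topspace X" and y: "y \<in> QF n"
  obtains p where "p \<in> ultrafilters (carrier (HK n T))" "bact n p (cube_diag n x) = y"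
proof -
  let ?O = "(\<lambda>h. cact n h (cube_diag n x)) ` carrier (HK n T)"
  have "y \<in> CX n closure_of ?O"
    unfolding in_closure_of
  proof (intro conjI allI impI QF_point[OF y])
    fix W assume W: "y \<in> W \<and> openin (CX n) W"
    obtain z where "z \<in> {cact n f (cube_diag n a) |f a. f \<in> FF n \<and> a \<in> topspace X}" "z \<in> W"
      using y[unfolded QF_def in_closure_of, THEN conjunct2, rule_format, OF W] by auto
    then obtain f a where f: "f \<in> FF n" and a: "a \<in> topspace X" "cact n f (cube_diag n a) \<in> W"
      by blast
    have fK: "f \<in> KK n" using f FF_carrier by blast
    let ?V = "{b \<in> topspace X. cact n f (cube_diag n b) \<in> W}"
    have open_V: "openin X ?V"
      using openin_continuous_map_preimage[OF continuous_map_compose[OF continuous_map_cube_diag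
            cub.act_continuous[OF fK]] conjunct2[OF W]] by (simp add: o_def)
    have "a \<in> ?V" using a by simp
    then obtain t where "t \<in> carrier T" "\<phi> t x \<in> ?V"
      by (rule orbit_meets[OF x a(1) open_V])
    then have t: "t \<in> carrier T" "cact n f (cube_diag n (\<phi> t x)) \<in> W" by simp_all
    have "f \<star>\<^bsub>n\<^esub> cube_diag n t \<in> carrier (HK n T)"
      using f Face_subset_HK by (intro subgroup.m_closed[OF subgroup_HK] cube_diag_in_HK n t) blast
    moreover have "cact n (f \<star>\<^bsub>n\<^esub> cube_diag n t) (cube_diag n x)
        = cact n f (cube_diag n (\<phi> t x))"
      using cub.act_mult[OF fK, of "cube_diag n t" "cube_diag n x"] t x by (simp add: act_diag_diag)
    ultimately have "cact n f (cube_diag n (\<phi> t x)) \<in> ?O" by (metis image_eqI)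
    then show "\<exists>z. z \<in> ?O \<and> z \<in> W" using t(2) by blast
  qed
  then show ?thesis by (rule cub.closure_of_orbit_imp_beta_act[OF HK_carrier]) (rule that)
qed

lemma act_u_idem: "x \<in> topspace X \<Longrightarrow> act u (act u x) = act u x"
  using base.beta_act_mult[OF u_beta u_beta] u(2) by simp

text \<open>A facet generator over G has u, not 1, off the facet. Pushing g forward to facet
  elements over T gives an ultrafilter with coordinates g and 1; acting afterwards by u on the
  diagonal turns these into u g = g and u.\<close>

lemma HK_G_QF:
  assumes "a \<in> carrier (HK n G)" "x \<in> QF n"
  shows "cube_act n act a x \<in> QF n"
proof -
  interpret G: group G by (rule group_G)
  have gen: "cube_act n act (face_element n G g \<alpha>) x \<in> QF n"
    if g: "g \<in> carrier G" and \<alpha>: "facet n \<alpha>" and x: "x \<in> QF n" for g \<alpha> x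
  proof -
    let ?j = "\<lambda>t. face_element n T t \<alpha>"
    let ?p = "filtermap ?j g"
    have gb: "g \<in> BT" by (rule G_mem(2)[OF g])
    have xp: "x \<in> topspace (CX n)" by (rule QF_point[OF x])
    have p: "?p \<in> ultrafilters (carrier (HK n T))"
      by (rule filtermap_ultrafilters[OF gb]) (use face_element_in_HK \<alpha> in blast)
    have coord_p: "coord \<epsilon> ?p = (if \<epsilon> \<in> \<alpha> then g else principal {\<one>})" if e: "\<epsilon> \<in> cube n" for \<epsilon>
    proof (cases "\<epsilon> \<in> \<alpha>")
      case True
      then show ?thesis using e by (simp add: coord_def filtermap_filtermap face_element_def)
    next
      case False
      have "filtermap (\<lambda>_. \<one>) g = principal {\<one>}"
        using gb by (intro filtermap_const) (simp add: ultrafilters_def)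
      then show ?thesis using e False by (simp add: coord_def filtermap_filtermap face_element_def)
    qed
    have "(\<lambda>\<epsilon>\<in>cube n. act u (bact n ?p x \<epsilon>)) = cube_act n act (face_element n G g \<alpha>) x"
    proof (rule cube_point_eqI[of _ n])
      fix \<epsilon> assume e: "\<epsilon> \<in> cube n"
      have xe: "x \<epsilon> \<in> topspace X" by (rule cube_point_nth[OF xp e])
      show "(\<lambda>\<epsilon>\<in>cube n. act u (bact n ?p x \<epsilon>)) \<epsilon> = cube_act n act (face_element n G g \<alpha>) x \<epsilon>"
        using bact_nth[OF BHK_carrier[OF p] xp e] coord_p[OF e] act_principal_one[OF xe] e
          base.beta_act_mult[OF u_beta gb xe] G_mem(3)[OF g]
        by (simp add: face_element_def)
    qed simp_all
    then show ?thesis using QF_bact_diag[OF u_beta QF_BHK[OF p x]] by simp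
  qed
  have HK_G: "h \<in> carrier (cube_group n G)"
    if "h \<in> generate (cube_group n G) (carrier (cube_group n G) \<inter> {face_element n G g \<alpha> |g \<alpha>. g \<in> carrier G \<and> facet n \<alpha>})" for h
    using that subgroup.mem_carrier[OF G.subgroup_HK[of n]] by (simp add: HK_def carrier_subgroup_generated)
  have "\<forall>x\<in>QF n. cube_act n act a x \<in> QF n"
    using assms(1) unfolding HK_def[of n G] carrier_subgroup_generated
  proof (induction rule: generate.induct)
    case one
    show ?case
    proof
      fix x assume x: "x \<in> QF n"
      have "cube_act n act \<one>\<^bsub>cube_group n G\<^esub> x = (\<lambda>\<epsilon>\<in>cube n. act u (x \<epsilon>))"
        unfolding cube_act_def one_product_group by (rule restrict_ext) simp
      then show "cube_act n act \<one>\<^bsub>cube_group n G\<^esub> x \<in> QF n"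
        using QF_bact_diag[OF u_beta x] by simp
    qed
  next
    case (incl h)
    then obtain g \<alpha> where g: "g \<in> carrier G" "facet n \<alpha>" and h: "h = face_element n G g \<alpha>" by auto
    show ?case unfolding h using gen[OF g] by blast
  next
    case (inv h)
    then obtain g \<alpha> where g: "g \<in> carrier G" "facet n \<alpha>" and h: "h = face_element n G g \<alpha>" by auto
    show ?case unfolding h G.inv_face_element[OF g(1)] using gen[OF G.inv_closed[OF g(1)] g(2)] by blast
  next
    case (eng h1 h2)
    show ?case
    proof
      fix x assume x: "x \<in> QF n"
      have "cube_act n act (h1 \<otimes>\<^bsub>cube_group n G\<^esub> h2) x = cube_act n act h1 (cube_act n act h2 x)"
      proof (rule cube_point_eqI[of _ n])
        fix \<epsilon> assume e: "\<epsilon> \<in> cube n"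
        have "h1 \<epsilon> \<in> BT" "h2 \<epsilon> \<in> BT"
          using G_mem(2)[OF cube_group_nth[OF HK_G[OF eng.hyps(1)] e]]
            G_mem(2)[OF cube_group_nth[OF HK_G[OF eng.hyps(2)] e]] by blast+
        then show "cube_act n act (h1 \<otimes>\<^bsub>cube_group n G\<^esub> h2) x \<epsilon> = cube_act n act h1 (cube_act n act h2 x) \<epsilon>"
          using base.beta_act_mult cube_point_nth[OF QF_point[OF x] e] e by simp
      qed simp_all
      then show "cube_act n act (h1 \<otimes>\<^bsub>cube_group n G\<^esub> h2) x \<in> QF n" using eng.IH x by simp
    qed
  qed
  then show ?thesis using assms(2) by blast
qed

text \<open>Write a = u w with w a limit of t b. Since p \<mapsto> p x is continuous, w x is the
  limit of t (b x), which stays in the closed set \<open>QF n\<close>. The final factor u makes the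
  result fixed by u.\<close>

lemma tau_closure_act:
  assumes a: "a \<in> tau_closure n T M u v (carrier (HK n G))" and x: "x \<in> QF n"
  shows "cube_act n act a x \<in> QF n" and "\<epsilon> \<in> cube n \<Longrightarrow> act u (cube_act n act a x \<epsilon>) = cube_act n act a x \<epsilon>"
proof -
  interpret G: group G by (rule group_G)
  obtain w where w: "w \<in> circle n T M v (carrier (HK n G))"
      and a_w: "a = cube_diag n u \<otimes>\<^bsub>cube_group n (beta T)\<^esub> w"
    using a by (auto simp: tau_closure_def)
  obtain F :: "((nat set \<Rightarrow> 't) \<times> (nat set \<Rightarrow> 't filter)) filter" where F: "F \<noteq> bot"
      "F \<le> principal (carrier (HK n T) \<times> carrier (HK n G))"
      and lim: "limitin (cube_top n (subtopology (beta_top (carrier T)) M))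
        (\<lambda>(t, a). cube_act n (\<lambda>s p. principal {s} \<otimes>\<^bsub>beta T\<^esub> p) t a) w F"
    using w unfolding circle_def by blast
  have evF: "\<forall>\<^sub>F c in F. c \<in> carrier (HK n T) \<times> carrier (HK n G)" using F(2) by (simp add: le_principal)
  have xp: "x \<in> topspace (CX n)" by (rule QF_point[OF x])
  have wM: "w \<epsilon> \<in> M" if "\<epsilon> \<in> cube n" for \<epsilon>
    using cube_point_nth[OF limitin_topspace[OF lim] that] by simp
  define z where "z = cube_act n act w x"
  have "z \<in> QF n"
  proof (rule limitin_closedin[OF _ QF_closed _ F(1)])
    let ?f = "\<lambda>(t, a). cact n t (cube_act n act a x)"
    show evQ: "\<forall>\<^sub>F c in F. ?f c \<in> QF n"
      using evF by eventually_elim (auto intro: QF_HK[OF n] HK_G_QF[OF _ x])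
    show "limitin (CX n) ?f z F"
      unfolding limitin_componentwise
    proof (intro conjI ballI)
      show "z \<in> extensional (cube n)" by (simp add: z_def)
      show "\<forall>\<^sub>F c in F. ?f c \<in> topspace (CX n)"
        using evQ by eventually_elim (rule QF_point)
      fix \<epsilon> assume e: "\<epsilon> \<in> cube n"
      have xe: "x \<epsilon> \<in> topspace X" by (rule cube_point_nth[OF xp e])
      have "limitin (beta_top (carrier T)) (\<lambda>c. (\<lambda>(t, a). cube_act n (\<lambda>s p. principal {s} \<otimes>\<^bsub>beta T\<^esub> p) t a) c \<epsilon>) (w \<epsilon>) F"
        using lim e unfolding limitin_componentwise limitin_subtopology by blast
      then have "limitin X ((\<lambda>p. act p (x \<epsilon>)) \<circ>
          (\<lambda>c. (\<lambda>(t, a). cube_act n (\<lambda>s p. principal {s} \<otimes>\<^bsub>beta T\<^esub> p) t a) c \<epsilon>)) (act (w \<epsilon>) (x \<epsilon>)) F"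
        by (rule continuous_map_limit[OF base.continuous_map_beta_act[OF xe]])
      moreover have "\<forall>\<^sub>F c in F. ((\<lambda>p. act p (x \<epsilon>)) \<circ>
          (\<lambda>c. (\<lambda>(t, a). cube_act n (\<lambda>s p. principal {s} \<otimes>\<^bsub>beta T\<^esub> p) t a) c \<epsilon>)) c = ?f c \<epsilon>"
        using evF
      proof eventually_elim
        case (elim c)
        obtain t b where c: "c = (t, b)" by (cases c)
        have t: "t \<epsilon> \<in> carrier T" using elim HK_carrier c e by (auto intro: cube_group_nth)
        have b: "b \<epsilon> \<in> BT"
          using elim c G_mem(2)[OF cube_group_nth[OF subgroup.mem_carrier[OF G.subgroup_HK] e]] by auto
        show ?case
          using e t b xe base.beta_act_mult[of "principal {t \<epsilon>}" "b \<epsilon>" "x \<epsilon>"]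
            base.beta_act_principal[OF t, of "act (b \<epsilon>) (x \<epsilon>)"] by (simp add: c)
      qed
      ultimately have "limitin X (\<lambda>c. ?f c \<epsilon>) (act (w \<epsilon>) (x \<epsilon>)) F"
        by (rule limitin_transform_eventually[rotated])
      then show "limitin X (\<lambda>c. ?f c \<epsilon>) (z \<epsilon>) F" using e by (simp add: z_def)
    qed
  qed
  have eq: "cube_act n act a x = (\<lambda>\<epsilon>\<in>cube n. act u (z \<epsilon>))"
  proof (rule cube_point_eqI[of _ n])
    fix \<epsilon> assume e: "\<epsilon> \<in> cube n"
    show "cube_act n act a x \<epsilon> = (\<lambda>\<epsilon>\<in>cube n. act u (z \<epsilon>)) \<epsilon>"
      using e base.beta_act_mult[OF u_beta ideal.ideal_mem[OF wM[OF e]] cube_point_nth[OF xp e]]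
      by (simp add: a_w z_def)
  qed simp_all
  show "cube_act n act a x \<in> QF n" unfolding eq by (rule QF_bact_diag[OF u_beta \<open>z \<in> QF n\<close>])
  show "act u (cube_act n act a x \<epsilon>) = cube_act n act a x \<epsilon>" if e: "\<epsilon> \<in> cube n"
    unfolding eq using e act_u_idem[OF cube_point_nth[OF QF_point[OF \<open>z \<in> QF n\<close>] e]] by simp
qed

text \<open>An ultrafilter q below the given filter satisfies q x = q y. As q u lies in M, some r
  has r q u = u, so r undoes q on points fixed by u.\<close>

lemma proximal_fixed_eq:
  assumes prox: "proximal T X \<phi> x y" and fx: "act u x = x" and fy: "act u y = y"
  shows "x = y"
proof -
  obtain F z where x: "x \<in> topspace X" and y: "y \<in> topspace X" and F: "F \<noteq> bot"
      "F \<le> principal (carrier T)" "limitin X (\<lambda>t. \<phi> t x) z F" "limitin X (\<lambda>t. \<phi> t y) z F"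
    using prox unfolding proximal_def by blast
  obtain q where q: "ultra q" "q \<le> F" using ultra_exists[OF F(1)] .
  have qb: "q \<in> BT" using q F(2) by (simp add: ultrafilters_iff)
  have lim: "limitin X f l F \<Longrightarrow> limitin X f l q" for f l
    using filter_leD[OF q(2)] by (auto simp: limitin_def)
  have qxy: "act q x = z" "act q y = z"
    using base.beta_act_eqI[OF qb lim[OF F(3)]] base.beta_act_eqI[OF qb lim[OF F(4)]] by simp_all
  obtain r where r: "r \<in> M" "bmul r (bmul q u) = u"
    using ideal.right_inverse[OF u ideal.ideal_closed[OF qb u(1)]] by metis
  have "act r (act q w) = w" if w: "w \<in> topspace X" "act u w = w" for w
  proof -
    have "act (bmul r (bmul q u)) w = act r (act q (act u w))"
      using base.beta_act_mult[OF ideal.ideal_mem[OF r(1)] beta_closed[OF qb u_beta] w(1)]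
        base.beta_act_mult[OF qb u_beta w(1)] by simp
    then show ?thesis using r(2) w(2) by simp
  qed
  from this[OF x fx] this[OF y fy] show ?thesis using qxy by simp
qed

text \<open>The ultrafilter u is itself a filter along which both points have the same
  limit.\<close>

lemma proximal_of_act_eq:
  assumes "x \<in> topspace X" "y \<in> topspace X" "act u x = act u y"
  shows "proximal T X \<phi> x y"
  unfolding proximal_def
proof (intro conjI exI[of _ u] exI[of _ "act u x"] assms(1,2))
  show "u \<noteq> bot" "u \<le> principal (carrier T)" using u_beta by (auto simp: ultrafilters_def)
  show "limitin X (\<lambda>t. \<phi> t x) (act u x) u" by (rule base.limitin_beta_act[OF u_beta assms(1)])
  show "limitin X (\<lambda>t. \<phi> t y) (act u x) u"
    unfolding assms(3) by (rule base.limitin_beta_act[OF u_beta assms(2)])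
qed

text \<open>Reflect \<open>\<epsilon>\<close> to {}, so that the cubes differ at {} only. A
  contraction of the second cube acts identically on the nonempty coordinates of the first and fixes
  its coordinate at {}, which yields the corner.\<close>

lemma corner_of_common_coordinates:
  assumes y: "y \<in> QF n" and z: "z \<in> QF n" and e: "\<epsilon> \<in> cube n"
    and eq: "\<And>\<eta>. \<eta> \<in> cube n - {\<epsilon>} \<Longrightarrow> y \<eta> = z \<eta>"
  shows "corner n (y \<epsilon>) (z \<epsilon>) \<in> QF n"
proof -
  define y' where "y' = cube_refl n \<epsilon> y"
  define z' where "z' = cube_refl n \<epsilon> z"
  have y': "y' \<in> QF n" and z': "z' \<in> QF n"
    unfolding y'_def z'_def by (rule QF_refl[OF e]; fact)+
  have y'0: "y' {} = y \<epsilon>" and z'0: "z' {} = z \<epsilon>" by (simp_all add: y'_def z'_def cube_refl_def)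
  have eq': "y' \<delta> = z' \<delta>" if \<delta>: "\<delta> \<in> cube n - {{}}" for \<delta>
  proof -
    have "(\<delta> - \<epsilon>) \<union> (\<epsilon> - \<delta>) \<noteq> \<epsilon>" using \<delta> by blast
    then have "y ((\<delta> - \<epsilon>) \<union> (\<epsilon> - \<delta>)) = z ((\<delta> - \<epsilon>) \<union> (\<epsilon> - \<delta>))"
      using \<delta> e by (intro eq) (simp add: cube_symdiff)
    then show ?thesis using \<delta> by (simp add: y'_def z'_def cube_refl_def)
  qed
  obtain p where p: "p \<in> BF n" "bact n p z' = cube_diag n (z' {})"
    using QF_contract[OF z'] by blast
  have "bact n p y' = corner n (y \<epsilon>) (z \<epsilon>)"
  proof (rule cube_point_eqI[of _ n])
    show "bact n p y' \<in> extensional (cube n)"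
      using bact_closed[OF BF_carrier[OF p(1)] QF_point[OF y']] by (simp add: cube_point_iff)
    fix \<delta> assume d: "\<delta> \<in> cube n"
    show "bact n p y' \<delta> = corner n (y \<epsilon>) (z \<epsilon>) \<delta>"
    proof (cases "\<delta> = {}")
      case True
      then show ?thesis using bact_empty[OF p(1) QF_point[OF y']] y'0 by (simp add: corner_nth)
    next
      case False
      have "bact n p y' \<delta> = bact n p z' \<delta>"
        using bact_nth[OF BF_carrier[OF p(1)] QF_point[OF y'] d]
          bact_nth[OF BF_carrier[OF p(1)] QF_point[OF z'] d] eq'[of \<delta>] d False by simp
      then show ?thesis using p(2) z'0 d False by (simp add: corner_nth)
    qed
  qed (simp add: corner_def)
  then show ?thesis using QF_bact[OF p(1) y'] by simp
qed

lemma corner_act_u: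
  assumes "corner n x y \<in> QF n"
  shows "corner n (act u x) (act u y) \<in> QF n"
proof -
  have "(\<lambda>\<epsilon>\<in>cube n. act u (corner n x y \<epsilon>)) = corner n (act u x) (act u y)"
    by (rule cube_point_eqI[of _ n]) (auto simp: corner_def)
  then show ?thesis using QF_bact_diag[OF u_beta assms] by simp
qed

theorem unique_tau_closure_iff:
  "unique_tau_closure n T M u v X \<phi> \<longleftrightarrow>
    (\<forall>x\<in>topspace X. \<forall>y\<in>topspace X. corner n x y \<in> QF n \<longrightarrow> proximal T X \<phi> x y)"
  (is "?L \<longleftrightarrow> ?R")
proof
  let ?C = "tau_closure n T M u v (carrier (HK n G))"
  assume L: ?L
  show ?R
  proof (intro ballI impI)
    fix x y assume x: "x \<in> topspace X" and y: "y \<in> topspace X" and c: "corner n x y \<in> QF n"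
    \<comment> \<open>Points of the orbits under the closure are fixed by u, so the corner is first
      replaced by its image under u. Equality of the images will give proximality of x and
      y.\<close>
    define x' where "x' = act u x"
    define y' where "y' = act u y"
    have x': "x' \<in> topspace X" "act u x' = x'" and y': "y' \<in> topspace X" "act u y' = y'"
      using x y u_beta by (simp_all add: x'_def y'_def act_u_idem)
    have c': "corner n x' y' \<in> QF n" unfolding x'_def y'_def by (rule corner_act_u[OF c])
    \<comment> \<open>Write z = p y'^[n]. As u fixes y' and every coordinate of z, the element u p u
      of the closure also sends y'^[n] to z.\<close>
    have hit: "z \<in> (\<lambda>a. cube_act n act a (cube_diag n y')) ` ?C"
      if z: "z \<in> QF n" "\<And>\<epsilon>. \<epsilon> \<in> cube n \<Longrightarrow> act u (z \<epsilon>) = z \<epsilon>" for z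
    proof -
      obtain p where p: "p \<in> ultrafilters (carrier (HK n T))" "bact n p (cube_diag n y') = z"
        using HK_orbit_dense[OF y'(1) z(1)] .
      define a where "a = (\<lambda>\<epsilon>\<in>cube n. bmul (bmul u (coord \<epsilon> p)) u)"
      have D: "cube_diag n y' \<in> topspace (CX n)" using y' by simp
      have "cube_act n act a (cube_diag n y') = z"
      proof (rule cube_point_eqI[of _ n])
        show "z \<in> extensional (cube n)" using QF_point[OF z(1)] by (simp add: cube_point_iff)
        fix \<epsilon> assume e: "\<epsilon> \<in> cube n"
        have cp: "coord \<epsilon> p \<in> BT" by (rule coord_ultrafilter[OF BHK_carrier[OF p(1)] e])
        have "cube_act n act a (cube_diag n y') \<epsilon> = act u (act (coord \<epsilon> p) y')"
          using e y' base.beta_act_mult[OF beta_closed[OF u_beta cp] u_beta y'(1)]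
            base.beta_act_mult[OF u_beta cp y'(1)] by (simp add: a_def)
        also have "\<dots> = z \<epsilon>"
          using bact_nth[OF BHK_carrier[OF p(1)] D e] p(2) z(2)[OF e] e by simp
        finally show "cube_act n act a (cube_diag n y') \<epsilon> = z \<epsilon>" .
      qed simp
      then show ?thesis using tau_closure_contains[OF p(1)] unfolding a_def by blast
    qed
    have 1: "cube_diag n y' \<in> (\<lambda>a. cube_act n act a (cube_diag n y')) ` ?C"
      using y' by (intro hit QF_diag) simp_all
    have 2: "corner n x' y' \<in> (\<lambda>a. cube_act n act a (cube_diag n y')) ` ?C"
      using x' y' by (intro hit c') (simp add: corner_nth)
    have "cube_diag n y' \<in> Q_cube n T X \<phi>"
      using QF_diag[OF y'(1)] by (simp add: Q_cube_eq_QF[OF n])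
    moreover have "\<exists>\<epsilon>\<in>cube n. \<forall>\<eta>\<in>cube n - {\<epsilon>}. cube_diag n y' \<eta> = corner n x' y' \<eta>"
      by (intro bexI[of _ "{}"]) (simp_all add: corner_nth)
    ultimately have "cube_diag n y' = corner n x' y'"
      using L 1 2 unfolding unique_tau_closure_def Let_def by blast
    then have "cube_diag n y' {} = corner n x' y' {}" by simp
    then have "act u x = act u y" by (simp add: corner_nth x'_def y'_def)
    then show "proximal T X \<phi> x y" by (rule proximal_of_act_eq[OF x y])
  qed
next
  let ?C = "tau_closure n T M u v (carrier (HK n G))"
  assume R: ?R
  show ?L
    unfolding unique_tau_closure_def Let_def
  proof (intro ballI impI)
    fix x y z
    assume "x \<in> Q_cube n T X \<phi>" and "y \<in> (\<lambda>a. cube_act n act a x) ` ?C" "z \<in> (\<lambda>a. cube_act n act a x) ` ?C"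
      and ex: "\<exists>\<epsilon>\<in>cube n. \<forall>\<eta>\<in>cube n - {\<epsilon>}. y \<eta> = z \<eta>"
    then obtain a b where x: "x \<in> QF n" and a: "a \<in> ?C" "y = cube_act n act a x"
        and b: "b \<in> ?C" "z = cube_act n act b x"
      by (auto simp: Q_cube_eq_QF[OF n])
    obtain \<epsilon> where e: "\<epsilon> \<in> cube n" and eq: "\<And>\<eta>. \<eta> \<in> cube n - {\<epsilon>} \<Longrightarrow> y \<eta> = z \<eta>"
      using ex by blast
    have y: "y \<in> QF n" "act u (y \<epsilon>) = y \<epsilon>"
      unfolding a(2) using tau_closure_act[OF a(1) x] e by blast+
    have z: "z \<in> QF n" "act u (z \<epsilon>) = z \<epsilon>"
      unfolding b(2) using tau_closure_act[OF b(1) x] e by blast+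
    have "corner n (y \<epsilon>) (z \<epsilon>) \<in> QF n"
      by (rule corner_of_common_coordinates[OF y(1) z(1) e eq])
    then have "proximal T X \<phi> (y \<epsilon>) (z \<epsilon>)"
      using R cube_point_nth[OF QF_point[OF y(1)] e] cube_point_nth[OF QF_point[OF z(1)] e] by blast
    then have "y \<epsilon> = z \<epsilon>" by (rule proximal_fixed_eq[OF _ y(2) z(2)])
    then show "y = z"
      using eq QF_point[OF y(1)] QF_point[OF z(1)]
      by (intro cube_point_eqI[of _ n]) (auto simp: cube_point_iff)
  qed
qed

end

theorem theorem3p7:
  fixes T :: "'t monoid" and X :: "'x topology" and \<phi> :: "'t \<Rightarrow> 'x \<Rightarrow> 'x" and d :: nat
    and M :: "'t filter set" and u :: "'t filter" and v :: "(nat set \<Rightarrow> 't) filter"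
  assumes "dynamical_system T X \<phi>"
    and "minimal_action T X \<phi>"
    and "d \<ge> 1"
    and "minimal_left_ideal (beta T) M"
    and "idempotent_in (beta T) u" and "u \<in> M"
    and "minimal_idempotent (beta (HK (d + 1) T)) v"
    and "beta_cube (d + 1) T v = cube_diag (d + 1) u"
  shows "unique_tau_closure (d + 1) T M u v X \<phi> \<longleftrightarrow>
    proximal_extension T X \<phi>
      (quotient_top X (RP d T X \<phi>)) (quotient_act X (RP d T X \<phi>) \<phi>)
      (quotient_proj X (RP d T X \<phi>))"
proof -
  \<comment> \<open>The dimension is d + 1 because \<open>RP d\<close> is described by corners of
    cubes of that dimension.\<close>
  interpret tau_system T X \<phi> M "d + 1" u v
  proof (intro tau_system.intro minimal_cube_system.intro minimal_cube_system_axioms.intro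
      tau_system_axioms.intro assms)
    show "1 \<le> d + 1" by simp
    show "beta_mult T u u = u" using assms(5) by (simp add: idempotent_in_def)
    show "v \<in> ultrafilters (carrier (HK (d + 1) T))"
      using assms(7) by (simp add: minimal_idempotent_def idempotent_in_def)
  qed
  show ?thesis
    unfolding proximal_extension_quotient_iff unique_tau_closure_iff
    by (auto simp: RP_iff_corner)
qed

end
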